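(* Let $d\ge 2$, $\alpha>1+1/d$, $p\in(0,1]$, $\beta>0$, and consider supercritical long-range percolation on $\mathbb{Z}^d$ with these parameters. There exist $\beta_0=\beta_0(p,\alpha,d)$ and $\varepsilon=\varepsilon(\alpha,d)>0$ such that if $\beta\ge\beta_0$ or $p(1\wedge\beta)^{d\alpha}\ge 1-\varepsilon$, then for all sufficiently large $k$ and all integers $n\ge 2$ satisfying $n(\log n)^{-2d/(d-1)}\ge k$, $$\mathbb{P}\big(|\mathcal{C}_n^{(2)}|\ge k\big)\le (n\log n)\exp\big(-k^{(d-1)/d}\big).$$
   Context: Write $x\wedge y=\min(x,y)$ and let $\|\cdot\|$ be the Euclidean norm. Long-range percolation with parameters $d\in\mathbb{N}$, $\alpha>1$, $p\in(0,1]$, $\beta>0$ is the random graph $\mathcal{G}_\infty$ with vertex set $\mathbb{Z}^d$ in which each pair $\{x,y\}$ of distinct vertices is an edge independently of all other pairs with probability $$\mathrm{p}(\|x-y\|)=p\Big(1\wedge\frac{\beta}{\|x-y\|}\Big)^{d\alpha}.$$ It is supercritical if the origin lies in an infinite connected component with positive probability. For $n\in\mathbb{N}$ let $\Lambda_n=\mathbb{Z}^d\cap[-n^{1/d}/2,n^{1/d}/2)^d$ and let $\mathcal{G}_n$ be the subgraph of $\mathcal{G}_\infty$ induced on $\Lambda_n$. $\mathcal{C}_n^{(2)}$ is the second-largest connected component (in number of vertices) of $\mathcal{G}_n$, with $\mathcal{C}_n^{(2)}=\emptyset$ if $\mathcal{G}_n$ is connected; $|\cdot|$ denotes number of vertices.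 *)

theory Defs
  imports "HOL-Probability.Probability"
begin

text \<open>The lattice \<open>\<int>\<^sup>d\<close> is the type \<open>int ^ 'd\<close>, where \<open>d = CARD('d)\<close>.\<close>

definition lattice_point :: "int ^ 'd \<Rightarrow> real ^ 'd" where
  "lattice_point x = (\<chi> i. real_of_int (x $ i))"

definition potential_edges :: "(int ^ 'd) set set" where
  "potential_edges = {{x, y} | x y. x \<noteq> y}"

text \<open>
  The diameter is a function of the unordered pair; its value at \<open>{x, y}\<close> is the
  Euclidean norm of \<open>x - y\<close>, see \<open>edge_length_doubleton\<close>.
\<close>

definition edge_length :: "(int ^ 'd::finite) set \<Rightarrow> real" where
  "edge_length e = diameter (lattice_point ` e)"

lemma edge_length_doubleton:
  "edge_length {x, y} = norm (lattice_point x - lattice_point y)"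
proof (rule antisym)
  let ?S = "{lattice_point x, lattice_point y}"
  show "edge_length {x, y} \<le> norm (lattice_point x - lattice_point y)"
    unfolding edge_length_def image_insert image_empty
    by (rule diameter_le) (auto simp: norm_minus_commute)
  have "dist (lattice_point x) (lattice_point y) \<le> diameter ?S"
    by (rule diameter_bounded_bound) auto
  then show "norm (lattice_point x - lattice_point y) \<le> edge_length {x, y}"
    by (simp add: edge_length_def dist_norm)
qed

definition edge_prob :: "real \<Rightarrow> real \<Rightarrow> real \<Rightarrow> (int ^ 'd::finite) set \<Rightarrow> real" where
  "edge_prob p \<alpha> \<beta> e = p * min 1 (\<beta> / edge_length e) powr (real CARD('d) * \<alpha>)"

text \<open>A sample \<open>\<omega>\<close> says for each potential edge whether it is present.\<close>

definition lrp :: "real \<Rightarrow> real \<Rightarrow> real \<Rightarrow> ((int ^ 'd::finite) set \<Rightarrow> bool) measure" where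
  "lrp p \<alpha> \<beta> =
     (\<Pi>\<^sub>M e\<in>potential_edges. measure_pmf (bernoulli_pmf (edge_prob p \<alpha> \<beta> e)))"

definition induced_adj :: "('v set \<Rightarrow> bool) \<Rightarrow> 'v set \<Rightarrow> 'v rel" where
  "induced_adj \<omega> V = {(x, y). x \<in> V \<and> y \<in> V \<and> x \<noteq> y \<and> \<omega> {x, y}}"

definition component_of :: "('v set \<Rightarrow> bool) \<Rightarrow> 'v set \<Rightarrow> 'v \<Rightarrow> 'v set" where
  "component_of \<omega> V x = {y. (x, y) \<in> (induced_adj \<omega> V)\<^sup>*}"

definition graph_components :: "('v set \<Rightarrow> bool) \<Rightarrow> 'v set \<Rightarrow> 'v set set" where
  "graph_components \<omega> V = component_of \<omega> V ` V"

text \<open>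
  The next two definitions are meant for finite \<open>V\<close>. Ties are broken arbitrarily, which
  does not affect the cardinalities; in particular, if several components have maximal
  size, the second largest one has that size as well.
\<close>

definition largest_component :: "('v set \<Rightarrow> bool) \<Rightarrow> 'v set \<Rightarrow> 'v set" where
  "largest_component \<omega> V = (ARG_MAX card C. C \<in> graph_components \<omega> V)"

definition second_largest_component :: "('v set \<Rightarrow> bool) \<Rightarrow> 'v set \<Rightarrow> 'v set" where
  "second_largest_component \<omega> V =
     (let \<C> = graph_components \<omega> V - {largest_component \<omega> V}
      in if \<C> = {} then {} else (ARG_MAX card C. C \<in> \<C>))"

definition supercritical :: "'d::finite itself \<Rightarrow> real \<Rightarrow> real \<Rightarrow> real \<Rightarrow> bool" where
  "supercritical _ p \<alpha> \<beta> \<longleftrightarrow>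
     \<P>(\<omega> in lrp p \<alpha> \<beta>. infinite (component_of \<omega> UNIV (0 :: int ^ 'd))) > 0"

definition lattice_box :: "nat \<Rightarrow> (int ^ 'd::finite) set" where
  "lattice_box n =
     {x. \<forall>i. real_of_int (x $ i) \<in>
              {- (real n powr (1 / real CARD('d)) / 2) ..< real n powr (1 / real CARD('d)) / 2}}"

end

theory Submission
  imports Defs
begin

text \<open>
  Cut the box into blocks of side \<open>L\<close> (\<open>L = 1\<close> if nearest-neighbour edges are open with probability at least
  \<open>1 - \<epsilon>\<close>, and \<open>L\<close> of order \<open>\<beta>\<close> if \<open>\<beta>\<close> is large) and call an edge of the grid of blocks bad if the
  graph induced on its two blocks is disconnected; bad edges are very unlikely.

  Let \<open>C\<close> be a component other than a giant one, which is seen by a good cluster \<open>K\<close> filling almost all of the grid.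
  Let \<open>D \<supseteq> K\<close> be a component of the set of blocks not touched by \<open>C\<close>. The components of the complement of
  \<open>D\<close> have boundaries consisting of bad edges only, and these boundaries are connected, so that they can be counted
  by the Peierls argument. Since \<open>C\<close> is connected, these components are linked by open long edges. The expected
  number of edges leaving a set of blocks is at most a constant times the size of its boundary, because
  \<open>\<alpha> > 1 + 1/d\<close>; hence the entropy of the links is also paid for by the bad boundaries. By isoperimetry the total
  boundary has size of order at least \<open>k\<close> to the power \<open>(d - 1)/d\<close>.

  The cluster \<open>K\<close> exists unless disjoint bad contours enclose a positive fraction of the grid. As contours
  enclosing \<open>k\<close> blocks are excluded already, this has an exponentially small probability by a Chernoff bound.
\<close>

section \<open>Cut-connected sets and layered explorations\<close>

text \<open>The obstacle is entropy: a component avoiding the giant cluster may be scattered over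
  many islands joined by long edges, so no single contour surrounds it. The sum therefore runs over
  whole families of contours together with the open edges joining them. It factorises because the
  two ingredients are independent: islands do not touch each other, so links join blocks that are
  neither equal nor neighbouring, while badness of a grid edge only involves pairs inside two
  neighbouring blocks.

  The price per boundary edge explains the exponent 4d: bad edges sharing a block are dependent, so
  a matching is extracted (2d), and two disjoint contours may share an edge (2). A bad edge must
  thus have probability at most \<open>\<rho> ^ (4 * d)\<close>, where \<rho> contains exp(-1) for
  the links and exp(-\<mu>) for the decay. Here \<mu> is of order L^(d-1), since contours count
  blocks whereas k counts vertices. For large \<beta> this is a competition of exp(-p L^d) with
  exp(-c L^(d-1)), won by large L; for L = 1 it is met by choosing \<epsilon> small.\<close>

definition cut_connected :: "('a \<Rightarrow> 'a \<Rightarrow> bool) \<Rightarrow> 'a set \<Rightarrow> bool" where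
  "cut_connected adj A \<longleftrightarrow> (\<forall>B\<subseteq>A. B \<noteq> {} \<longrightarrow> B \<noteq> A \<longrightarrow> (\<exists>x\<in>B. \<exists>y\<in>A - B. adj x y))"

text \<open>Paths appear only here, to match \<open>component_of\<close>; elsewhere connectedness is
  used in its cut form. For x outside V the value is the singleton of x.\<close>

definition conn_component :: "('a \<Rightarrow> 'a \<Rightarrow> bool) \<Rightarrow> 'a set \<Rightarrow> 'a \<Rightarrow> 'a set" where
  "conn_component adj V x = {y. (x, y) \<in> {(u, v). u \<in> V \<and> v \<in> V \<and> adj u v}\<^sup>*}"

lemma cut_connectedD:
  assumes "cut_connected adj A" "B \<subseteq> A" "B \<noteq> {}" "B \<noteq> A"
  obtains x y where "x \<in> B" "y \<in> A" "y \<notin> B" "adj x y"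
  using assms unfolding cut_connected_def by blast

lemma cut_connected_mono: "cut_connected adj A \<Longrightarrow> (\<And>x y. adj x y \<Longrightarrow> adj' x y) \<Longrightarrow> cut_connected adj' A"
  unfolding cut_connected_def by meson

lemma conn_component_self [simp]: "x \<in> conn_component adj V x"
  by (simp add: conn_component_def)

lemma conn_component_subset: "x \<in> V \<Longrightarrow> conn_component adj V x \<subseteq> V"
proof
  fix y assume "x \<in> V" "y \<in> conn_component adj V x"
  then have "(x, y) \<in> {(u, v). u \<in> V \<and> v \<in> V \<and> adj u v}\<^sup>*" by (simp add: conn_component_def)
  then show "y \<in> V" using \<open>x \<in> V\<close> by (induction) auto
qed

lemma conn_component_step: "y \<in> conn_component adj V x \<Longrightarrow> y \<in> V \<Longrightarrow> z \<in> V \<Longrightarrow> adj y z \<Longrightarrow> z \<in> conn_component adj V x"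
  unfolding conn_component_def by (auto intro: rtrancl.rtrancl_into_rtrancl)

lemma conn_component_sym:
  assumes "\<And>u v. adj u v \<Longrightarrow> adj v u" "y \<in> conn_component adj V x"
  shows "x \<in> conn_component adj V y"
proof -
  let ?R = "{(u, v). u \<in> V \<and> v \<in> V \<and> adj u v}"
  have "sym ?R" using assms(1) by (auto simp: sym_def)
  then have "sym (?R\<^sup>*)" by (rule sym_rtrancl)
  then show ?thesis using assms(2) by (auto simp: conn_component_def sym_def)
qed

lemma conn_component_trans: "y \<in> conn_component adj V x \<Longrightarrow> z \<in> conn_component adj V y \<Longrightarrow> z \<in> conn_component adj V x"
  unfolding conn_component_def by auto

lemma conn_component_eq:
  assumes "\<And>u v. adj u v \<Longrightarrow> adj v u" "y \<in> conn_component adj V x"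
  shows "conn_component adj V y = conn_component adj V x"
proof -
  have "x \<in> conn_component adj V y" using conn_component_sym[of adj] assms by metis
  then show ?thesis using assms(2) conn_component_trans[of _ adj V] by blast
qed

lemma conn_component_disjoint:
  assumes "\<And>u v. adj u v \<Longrightarrow> adj v u" "conn_component adj V x \<noteq> conn_component adj V y"
  shows "conn_component adj V x \<inter> conn_component adj V y = {}"
proof (rule ccontr)
  assume "\<not> ?thesis"
  then obtain z where z: "z \<in> conn_component adj V x" "z \<in> conn_component adj V y" by blast
  have "conn_component adj V z = conn_component adj V x" using conn_component_eq[of adj] z(1) assms(1) by metis
  moreover have "conn_component adj V z = conn_component adj V y" using conn_component_eq[of adj] z(2) assms(1) by metis
  ultimately show False using assms(2) by simp
qed

lemma cut_connected_conn_component: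
  assumes sy: "\<And>u v. adj u v \<Longrightarrow> adj v u"
  shows "cut_connected adj (conn_component adj V x)"
  unfolding cut_connected_def
proof (intro allI impI)
  fix B assume B: "B \<subseteq> conn_component adj V x" "B \<noteq> {}" "B \<noteq> conn_component adj V x"
  let ?R = "{(u, v). u \<in> V \<and> v \<in> V \<and> adj u v}"
  obtain b where b: "b \<in> B" using B by blast
  obtain c where c: "c \<in> conn_component adj V x" "c \<notin> B" using B by blast
  have eq: "conn_component adj V b = conn_component adj V x" using conn_component_eq[of adj b V x] sy B b by blast
  have bc: "(b, c) \<in> ?R\<^sup>*" using c eq by (auto simp: conn_component_def)
  show "\<exists>u\<in>B. \<exists>y\<in>conn_component adj V x - B. adj u y"
  proof (rule ccontr)
    assume n: "\<not> (\<exists>u\<in>B. \<exists>y\<in>conn_component adj V x - B. adj u y)"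
    have "c \<in> B" using bc
    proof (induction)
      case base then show ?case by (rule b)
    next
      case (step y z)
      have "y \<in> conn_component adj V x" using step(3) B by blast
      then have "z \<in> conn_component adj V x" using step(2) conn_component_step[of y adj V x z] by auto
      then show ?case using n step by blast
    qed
    then show False using c by simp
  qed
qed

text \<open>Maximality of components: if B stuck out, the cut
  \<open>B \<inter> conn_component adj V x\<close> of B would have an edge leaving it, along which
  the component could be continued.\<close>

lemma cut_connected_subset_conn_component:
  assumes "cut_connected adj B" "B \<subseteq> V" "B \<inter> conn_component adj V x \<noteq> {}"
  shows "B \<subseteq> conn_component adj V x"
proof (rule ccontr)
  assume "\<not> ?thesis"
  then have "B \<inter> conn_component adj V x \<noteq> B" by blast
  then obtain u v where uv: "u \<in> B \<inter> conn_component adj V x" "v \<in> B" "v \<notin> B \<inter> conn_component adj V x" "adj u v"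
    using cut_connectedD[OF assms(1), of "B \<inter> conn_component adj V x"] assms(3) by blast
  then have "v \<in> conn_component adj V x" using conn_component_step[of u adj V x v] assms(2) by blast
  then show False using uv by blast
qed

text \<open>Meant for the complement of a hole: the hub K together with the other holes, each of
  them attached to K.\<close>

lemma cut_connected_star:
  assumes sy: "\<And>u v. adj u v \<Longrightarrow> adj v u"
    and K: "cut_connected adj K" "K \<noteq> {}"
    and A: "\<And>A. A \<in> \<A> \<Longrightarrow> cut_connected adj A" "\<And>A. A \<in> \<A> \<Longrightarrow> \<exists>a\<in>A. \<exists>k\<in>K. adj k a"
  shows "cut_connected adj (K \<union> \<Union>\<A>)"
proof -
  let ?U = "K \<union> \<Union>\<A>"
  \<comment> \<open>The case of a cut containing the whole hub. A cut missing the hub is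
    complemented, which is where symmetry enters, and a cut splitting the hub is crossed inside
    it.\<close>
  have main: "\<exists>x\<in>S. \<exists>y\<in>?U - S. adj x y" if S: "S \<subseteq> ?U" "S \<noteq> ?U" "K \<subseteq> S" for S
  proof -
    obtain y A where y: "y \<in> A" "A \<in> \<A>" "y \<notin> S" using S by blast
    obtain a k where ak: "a \<in> A" "k \<in> K" "adj k a" using A(2)[OF y(2)] by blast
    show ?thesis
    proof (cases "a \<in> S")
      case False then show ?thesis using ak y S by blast
    next
      case True
      then have "A \<inter> S \<noteq> {}" "A \<inter> S \<noteq> A" using ak y by blast+
      then obtain u v where "u \<in> A \<inter> S" "v \<in> A" "v \<notin> A \<inter> S" "adj u v"
        using cut_connectedD[OF A(1)[OF y(2)], of "A \<inter> S"] by blast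
      then show ?thesis using y by blast
    qed
  qed
  show ?thesis unfolding cut_connected_def
  proof (intro allI impI)
    fix S assume S: "S \<subseteq> ?U" "S \<noteq> {}" "S \<noteq> ?U"
    show "\<exists>x\<in>S. \<exists>y\<in>?U - S. adj x y"
    proof (cases "K \<subseteq> S")
      case True then show ?thesis using main S by blast
    next
      case False
      show ?thesis
      proof (cases "K \<inter> S = {}")
        case True
        have "\<exists>x\<in>?U - S. \<exists>y\<in>?U - (?U - S). adj x y" by (rule main) (use S True in blast)+
        then show ?thesis using sy by blast
      next
        case F2: False
        then obtain u v where "u \<in> K \<inter> S" "v \<in> K" "v \<notin> K \<inter> S" "adj u v"
          using cut_connectedD[OF K(1), of "K \<inter> S"] False by blast
        then show ?thesis by blast
      qed
    qed
  qed
qed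

text \<open>
  Exploring a connected set from a root in breadth-first layers: \<open>layer_weight J h L R\<close> sums, over all ways to
  split \<open>R\<close> into consecutive layers starting from \<open>L\<close>, the product over \<open>u \<in> R\<close> of the total weight \<open>J v u\<close>
  from the preceding layer. It replaces the sum over spanning trees of \<open>L \<union> R\<close>.
\<close>

primrec layer_weight :: "('a \<Rightarrow> 'a \<Rightarrow> real) \<Rightarrow> nat \<Rightarrow> 'a set \<Rightarrow> 'a set \<Rightarrow> real" where
  "layer_weight J 0 L R = (if R = {} then 1 else 0)"
| "layer_weight J (Suc h) L R =
     (\<Sum>L'\<in>Pow R. (\<Prod>u\<in>L'. \<Sum>v\<in>L. J v u) * layer_weight J h L' (R - L'))"

text \<open>The Boolean counterpart of \<open>layer_weight\<close>. The number h is fuel; once R is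
  exhausted, the remaining layers are empty.\<close>

primrec layered :: "('a \<Rightarrow> 'a \<Rightarrow> bool) \<Rightarrow> nat \<Rightarrow> 'a set \<Rightarrow> 'a set \<Rightarrow> bool" where
  "layered E 0 L R \<longleftrightarrow> R = {}"
| "layered E (Suc h) L R \<longleftrightarrow>
     (\<exists>L'\<subseteq>R. (\<forall>u\<in>L'. \<exists>v\<in>L. E v u) \<and> layered E h L' (R - L'))"

lemma layer_weight_nonneg: "(\<And>v u. 0 \<le> J v u) \<Longrightarrow> 0 \<le> layer_weight J h L R"
  by (induction h arbitrary: L R) (auto intro!: sum_nonneg mult_nonneg_nonneg prod_nonneg)

lemma layered_empty: "layered E h L {}"
  by (induction h arbitrary: L) auto

text \<open>Breadth-first search: the first layer consists of all points of R entered from L. No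
  later point can be entered from L, so L may be forgotten; and the layer is nonempty, so
  \<open>card R\<close> rounds of fuel suffice.\<close>

lemma layered_of_cut:
  assumes "finite R" "card R \<le> h"
    and "\<And>B. B \<subseteq> R \<Longrightarrow> B \<noteq> {} \<Longrightarrow> \<exists>u\<in>B. \<exists>v\<in>L \<union> (R - B). E v u"
  shows "layered E h L R"
  using assms
proof (induction h arbitrary: L R)
  case 0 then show ?case by simp
next
  case (Suc h)
  show ?case
  proof (cases "R = {}")
    case True then show ?thesis by (simp add: layered_empty del: layered.simps)
  next
    case False
    define L' where "L' = {u\<in>R. \<exists>v\<in>L. E v u}"
    have ne: "L' \<noteq> {}" using Suc.prems(3)[of R] False unfolding L'_def by blast
    have sub: "L' \<subseteq> R" by (auto simp: L'_def)
    have "layered E h L' (R - L')"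
    proof (rule Suc.IH)
      show "finite (R - L')" using Suc.prems by simp
      have "card (R - L') < card R" using ne sub Suc.prems(1) by (intro psubset_card_mono) auto
      then show "card (R - L') \<le> h" using Suc.prems(2) by simp
      fix B assume B: "B \<subseteq> R - L'" "B \<noteq> {}"
      then obtain u v where uv: "u \<in> B" "v \<in> L \<union> (R - B)" "E v u" using Suc.prems(3)[of B] by blast
      have "v \<notin> L" using uv B by (auto simp: L'_def)
      then show "\<exists>u\<in>B. \<exists>v\<in>L' \<union> (R - L' - B). E v u" using uv by blast
    qed
    moreover have "\<forall>u\<in>L'. \<exists>v\<in>L. E v u" by (auto simp: L'_def)
    ultimately show ?thesis using sub by auto
  qed
qed

lemma layered_of_cut_connected:
  assumes "cut_connected E V" "finite V" "r \<in> V" "card V \<le> h"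
    and sy: "\<And>u v. E u v \<Longrightarrow> E v u"
  shows "layered E h {r} (V - {r})"
proof (rule layered_of_cut)
  show "finite (V - {r})" using assms by simp
  show "card (V - {r}) \<le> h" using assms(2,4) card_mono[of V "V - {r}"] by auto
  fix B assume B: "B \<subseteq> V - {r}" "B \<noteq> {}"
  then obtain x y where "x \<in> B" "y \<in> V" "y \<notin> B" "E x y"
    using cut_connectedD[OF assms(1), of B] assms(3) by blast
  then show "\<exists>u\<in>B. \<exists>v\<in>{r} \<union> (V - {r} - B). E v u" using sy by blast
qed

lemma sum_Pow_prod:
  fixes f :: "'a \<Rightarrow> real"
  assumes "finite V" shows "(\<Sum>F\<in>Pow V. \<Prod>u\<in>F. f u) = (\<Prod>u\<in>V. 1 + f u)"
  using prod_add[OF assms, of f "\<lambda>_. 1"] by (simp add: add.commute)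

lemma sum_Pow_prod_le_exp:
  fixes f :: "'a \<Rightarrow> real"
  assumes "finite V" "\<And>u. u \<in> V \<Longrightarrow> 0 \<le> f u"
  shows "(\<Sum>F\<in>Pow V. \<Prod>u\<in>F. f u) \<le> exp (\<Sum>u\<in>V. f u)"
proof -
  have "(\<Prod>u\<in>V. 1 + f u) \<le> (\<Prod>u\<in>V. exp (f u))"
    by (rule prod_mono) (use assms(2) in \<open>auto simp: add_nonneg_nonneg\<close>)
  then show ?thesis using sum_Pow_prod[OF assms(1), of f] assms(1) by (simp add: exp_sum)
qed

text \<open>A criterion of Kotecky-Preiss type, in which \<open>a v\<close> is the budget for
  everything attached below v. When the first layer L' is split off, the induction hypothesis bounds
  the rest by the product of \<open>exp (a u)\<close> over L'. The sum over L' of such products is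
  at most the exponential of a sum, and \<open>le\<close> bounds that sum by the budget of
  L.\<close>

lemma sum_layer_weight_le:
  fixes J :: "'a \<Rightarrow> 'a \<Rightarrow> real"
  assumes V: "finite V" and J: "\<And>v u. 0 \<le> J v u" and w: "\<And>u. 0 \<le> w u" and a: "\<And>u. 0 \<le> a u"
    and le: "\<And>v. v \<in> V \<Longrightarrow> (\<Sum>u\<in>V. w u * exp (a u) * J v u) \<le> a v"
    and L: "L \<subseteq> V"
  shows "(\<Sum>R\<in>Pow V. (\<Prod>u\<in>R. w u) * layer_weight J h L R) \<le> exp (\<Sum>v\<in>L. a v)"
  using L
proof (induction h arbitrary: L)
  case 0
  have "(\<Sum>R\<in>Pow V. (\<Prod>u\<in>R. w u) * layer_weight J 0 L R) = (\<Sum>R\<in>Pow V. if R = {} then 1 else 0)"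
    by (intro sum.cong) auto
  also have "\<dots> = 1" using V by simp
  also have "\<dots> \<le> exp (\<Sum>v\<in>L. a v)" using a by (simp add: sum_nonneg)
  finally show ?case .
next
  case (Suc h)
  have finL: "finite L" using Suc.prems V finite_subset by blast
  define g where "g u = (\<Sum>v\<in>L. J v u)" for u
  have g0: "0 \<le> g u" for u using J by (auto simp: g_def intro: sum_nonneg)
  have K0: "0 \<le> layer_weight J h L R" for L R using layer_weight_nonneg[of J] J by blast
  have "(\<Sum>R\<in>Pow V. (\<Prod>u\<in>R. w u) * layer_weight J (Suc h) L R) =
      (\<Sum>R\<in>Pow V. \<Sum>L'\<in>Pow R. (\<Prod>u\<in>R. w u) * ((\<Prod>u\<in>L'. g u) * layer_weight J h L' (R - L')))"
    by (simp add: sum_distrib_left g_def)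
  also have "\<dots> = (\<Sum>(R, L')\<in>Sigma (Pow V) Pow. (\<Prod>u\<in>R. w u) * ((\<Prod>u\<in>L'. g u) * layer_weight J h L' (R - L')))"
    using V by (intro sum.Sigma) (auto dest: finite_subset)
  also have "\<dots> = (\<Sum>(L', R')\<in>(SIGMA L':Pow V. Pow (V - L')).
       (\<Prod>u\<in>L'. w u * g u) * ((\<Prod>u\<in>R'. w u) * layer_weight J h L' R'))"
  proof (rule sum.reindex_bij_witness[where i="\<lambda>(L', R'). (L' \<union> R', L')" and j="\<lambda>(R, L'). (L', R - L')"])
    fix x assume "x \<in> Sigma (Pow V) Pow"
    then obtain R L' where x: "x = (R, L')" "R \<subseteq> V" "L' \<subseteq> R" by auto
    have "finite R" using x V finite_subset by blast
    then have "(\<Prod>u\<in>R. w u) = (\<Prod>u\<in>L'. w u) * (\<Prod>u\<in>R - L'. w u)"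
      using x by (metis prod.subset_diff mult.commute)
    then show "(case case x of (R, L') \<Rightarrow> (L', R - L') of (L', R') \<Rightarrow>
         (\<Prod>u\<in>L'. w u * g u) * ((\<Prod>u\<in>R'. w u) * layer_weight J h L' R')) =
       (case x of (R, L') \<Rightarrow> (\<Prod>u\<in>R. w u) * ((\<Prod>u\<in>L'. g u) * layer_weight J h L' (R - L')))"
      by (simp add: x prod.distrib mult_ac)
  qed (auto simp: Un_Diff)
  also have "\<dots> = (\<Sum>L'\<in>Pow V. \<Sum>R'\<in>Pow (V - L').
       (\<Prod>u\<in>L'. w u * g u) * ((\<Prod>u\<in>R'. w u) * layer_weight J h L' R'))"
    using V by (subst sum.Sigma) auto
  also have "\<dots> \<le> (\<Sum>L'\<in>Pow V. \<Prod>u\<in>L'. w u * exp (a u) * g u)"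
  proof (rule sum_mono)
    fix L' assume L': "L' \<in> Pow V"
    then have finL': "finite L'" using V finite_subset by blast
    \<comment> \<open>Forgetting that the remaining points avoid L' makes the induction hypothesis
      applicable.\<close>
    have "(\<Sum>R'\<in>Pow (V - L'). (\<Prod>u\<in>R'. w u) * layer_weight J h L' R') \<le>
       (\<Sum>R'\<in>Pow V. (\<Prod>u\<in>R'. w u) * layer_weight J h L' R')"
      using V by (intro sum_mono2) (auto intro!: mult_nonneg_nonneg prod_nonneg w K0)
    also have "\<dots> \<le> exp (\<Sum>v\<in>L'. a v)" using Suc.IH L' by blast
    also have "\<dots> = (\<Prod>u\<in>L'. exp (a u))" using finL' by (simp add: exp_sum)
    finally have *: "(\<Sum>R'\<in>Pow (V - L'). (\<Prod>u\<in>R'. w u) * layer_weight J h L' R') \<le> (\<Prod>u\<in>L'. exp (a u))" .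
    have "(\<Prod>u\<in>L'. w u * g u) * (\<Sum>R'\<in>Pow (V - L'). (\<Prod>u\<in>R'. w u) * layer_weight J h L' R')
       \<le> (\<Prod>u\<in>L'. w u * g u) * (\<Prod>u\<in>L'. exp (a u))"
      by (intro mult_left_mono *) (auto intro!: prod_nonneg mult_nonneg_nonneg w g0)
    then show "(\<Sum>R'\<in>Pow (V - L'). (\<Prod>u\<in>L'. w u * g u) * ((\<Prod>u\<in>R'. w u) * layer_weight J h L' R'))
       \<le> (\<Prod>u\<in>L'. w u * exp (a u) * g u)"
      by (simp add: sum_distrib_left prod.distrib mult_ac)
  qed
  also have "\<dots> \<le> exp (\<Sum>u\<in>V. w u * exp (a u) * g u)"
    using V w g0 by (intro sum_Pow_prod_le_exp) auto
  also have "(\<Sum>u\<in>V. w u * exp (a u) * g u) = (\<Sum>v\<in>L. \<Sum>u\<in>V. w u * exp (a u) * J v u)"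
    unfolding g_def sum_distrib_left by (rule sum.swap)
  also have "exp \<dots> \<le> exp (\<Sum>v\<in>L. a v)"
    using Suc.prems le by (auto intro!: sum_mono)
  finally show ?case .
qed

lemma layer_weight_ge_1:
  assumes "\<And>v u. 0 \<le> J v u" "\<And>v u. E v u \<Longrightarrow> 1 \<le> J v u" "finite L" "finite R"
    and "layered E h L R"
  shows "1 \<le> layer_weight J h L R"
  using assms(3-)
proof (induction h arbitrary: L R)
  case 0 then show ?case by simp
next
  case (Suc h)
  then obtain L' where L': "L' \<subseteq> R" "\<forall>u\<in>L'. \<exists>v\<in>L. E v u" "layered E h L' (R - L')" by auto
  have K0: "0 \<le> layer_weight J h L R" for L R using layer_weight_nonneg[of J] assms(1) by blast
  have "1 \<le> (\<Prod>u\<in>L'. \<Sum>v\<in>L. J v u)"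
  proof (rule prod_ge_1)
    fix u assume "u \<in> L'"
    then obtain v where v: "v \<in> L" "E v u" using L' by blast
    have "1 \<le> J v u" using assms(2) v by blast
    also have "\<dots> \<le> (\<Sum>v\<in>L. J v u)" using Suc.prems v assms(1) by (intro member_le_sum) auto
    finally show "1 \<le> (\<Sum>v\<in>L. J v u)" .
  qed
  moreover have "1 \<le> layer_weight J h L' (R - L')"
    using Suc L' by (intro Suc.IH) (auto dest: finite_subset)
  ultimately have "1 * 1 \<le> (\<Prod>u\<in>L'. \<Sum>v\<in>L. J v u) * layer_weight J h L' (R - L')"
    by (intro mult_mono) auto
  also have "\<dots> \<le> layer_weight J (Suc h) L R"
    using L' Suc.prems by (simp del: One_nat_def, intro member_le_sum)
      (auto intro!: mult_nonneg_nonneg prod_nonneg sum_nonneg assms(1) K0)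
  finally show ?case by simp
qed

text \<open>Weighted lattice animals: \<open>sum_layer_weight_le\<close> with the adjacency
  indicator as J and constant budget 1, for which the criterion reads
  \<open>z * exp 1 * \<Delta> \<le> 1\<close>. The root contributes its weight z and its budget exp
  1.\<close>

lemma sum_cut_connected_sets_le:
  fixes E :: "'a \<Rightarrow> 'a \<Rightarrow> bool"
  assumes V: "finite V" and sy: "\<And>u v. E u v \<Longrightarrow> E v u"
    and deg: "\<And>v. v \<in> V \<Longrightarrow> card {u\<in>V. E v u} \<le> \<Delta>" and z: "0 \<le> z" "z * exp 1 * real \<Delta> \<le> 1"
    and r: "r \<in> V"
  shows "(\<Sum>B\<in>{B. B \<subseteq> V \<and> r \<in> B \<and> cut_connected E B}. z ^ card B) \<le> z * exp 1"
proof -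
  define J :: "'a \<Rightarrow> 'a \<Rightarrow> real" where "J v u = of_bool (E v u)" for v u
  let ?S = "{B. B \<subseteq> V \<and> r \<in> B \<and> cut_connected E B}"
  let ?h = "card V"
  have finS: "finite ?S" using V by (auto intro: finite_subset[of _ "Pow V"])
  have J0: "0 \<le> J v u" for v u by (simp add: J_def)
  have "(\<Sum>B\<in>?S. z ^ card B) \<le> (\<Sum>B\<in>?S. z * ((\<Prod>u\<in>B - {r}. z) * layer_weight J ?h {r} (B - {r})))"
  proof (rule sum_mono)
    fix B assume B: "B \<in> ?S"
    then have fin: "finite B" using V finite_subset by auto
    have "layered E ?h {r} (B - {r})"
      using B fin V by (intro layered_of_cut_connected) (auto intro: card_mono sy)
    then have "1 \<le> layer_weight J ?h {r} (B - {r})"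
      using fin by (intro layer_weight_ge_1[where E=E]) (auto simp: J_def)
    then have "z ^ card B * 1 \<le> z ^ card B * layer_weight J ?h {r} (B - {r})"
      using z by (intro mult_left_mono) auto
    moreover have "z ^ card B = z * (\<Prod>u\<in>B - {r}. z)"
      using B fin by (simp add: power_Suc[symmetric] card_gt_0_iff card_Diff_singleton_if del: power_Suc)
        (metis One_nat_def Suc_pred card_gt_0_iff empty_iff)
    ultimately show "z ^ card B \<le> z * ((\<Prod>u\<in>B - {r}. z) * layer_weight J ?h {r} (B - {r}))"
      by simp
  qed
  also have "\<dots> = (\<Sum>R\<in>(\<lambda>B. B - {r}) ` ?S. z * ((\<Prod>u\<in>R. z) * layer_weight J ?h {r} R))"
    by (subst sum.reindex) (auto simp: inj_on_def)
  also have "\<dots> \<le> (\<Sum>R\<in>Pow V. z * ((\<Prod>u\<in>R. z) * layer_weight J ?h {r} R))"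
    using V z J0 by (intro sum_mono2)
      (auto intro!: mult_nonneg_nonneg prod_nonneg layer_weight_nonneg)
  also have "\<dots> = z * (\<Sum>R\<in>Pow V. (\<Prod>u\<in>R. z) * layer_weight J ?h {r} R)"
    by (simp add: sum_distrib_left)
  also have "\<dots> \<le> z * exp (\<Sum>v\<in>{r}. 1)"
  proof (intro mult_left_mono sum_layer_weight_le)
    fix v assume v: "v \<in> V"
    have "(\<Sum>u\<in>V. z * exp 1 * J v u) = z * exp 1 * real (card {u\<in>V. E v u})"
      using V by (simp add: J_def sum_distrib_left[symmetric] Int_def)
    also have "\<dots> \<le> z * exp 1 * real \<Delta>" using deg[OF v] z by (intro mult_left_mono) auto
    finally show "(\<Sum>u\<in>V. z * exp 1 * J v u) \<le> 1" using z by simp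
  qed (use V z J0 r in auto)
  finally show ?thesis by simp
qed

section \<open>Edge boundaries in the grid\<close>

abbreviation unit :: "'d \<Rightarrow> int ^ 'd::finite" where
  "unit i \<equiv> axis i 1"

definition neighbours :: "int ^ 'd::finite \<Rightarrow> int ^ 'd \<Rightarrow> bool" where
  "neighbours x y \<longleftrightarrow> (\<exists>i. y = x + unit i \<or> x = y + unit i)"

definition int_box :: "int ^ 'd \<Rightarrow> int ^ 'd \<Rightarrow> (int ^ 'd::finite) set" where
  "int_box a b = {x. \<forall>i. a $ i \<le> x $ i \<and> x $ i \<le> b $ i}"

definition grid :: "nat \<Rightarrow> (int ^ 'd::finite) set" where
  "grid t = {x. \<forall>i. 0 \<le> x $ i \<and> x $ i < int t}"

text \<open>The pair \<open>(x, i)\<close> stands for the edge from x to \<open>x + unit i\<close>.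
  Edges leaving the grid are omitted, so this is the boundary relative to the cube; isoperimetry
  therefore has to assume that A is not too large.\<close>

definition bdry :: "nat \<Rightarrow> (int ^ 'd::finite) set \<Rightarrow> ((int ^ 'd) \<times> 'd) set" where
  "bdry t A = {(x, i). x \<in> grid t \<and> x + unit i \<in> grid t \<and> (x \<in> A) \<noteq> (x + unit i \<in> A)}"

definition norm1 :: "int ^ 'd::finite \<Rightarrow> nat" where
  "norm1 v = (\<Sum>i\<in>UNIV. nat \<bar>v $ i\<bar>)"

definition sup_norm :: "int ^ 'd::finite \<Rightarrow> nat" where
  "sup_norm v = (MAX i. nat \<bar>v $ i\<bar>)"

lemma neighbours_sym: "neighbours x y \<Longrightarrow> neighbours y x"
  by (auto simp: neighbours_def)

lemma unit_nth: "(unit i :: int ^ 'd::finite) $ j = (if i = j then 1 else 0)"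
  by (simp add: axis_def)

lemma bij_int_box: "bij_betw vec_nth (int_box a b) (PiE UNIV (\<lambda>i. {a $ i..b $ i}))"
  by (rule bij_betw_byWitness[where f'=vec_lambda]) (auto simp: int_box_def PiE_UNIV_domain)

lemma finite_int_box [simp]: "finite (int_box a b)"
  using bij_betw_finite[OF bij_int_box[of a b]] by (auto intro!: finite_PiE)

lemma card_int_box: "card (int_box a b) = (\<Prod>i\<in>UNIV. nat (b $ i - a $ i + 1))"
  using bij_betw_same_card[OF bij_int_box[of a b]] by (simp add: card_PiE)

lemma grid_eq_int_box: "grid t = int_box 0 (\<chi> i. int t - 1)"
  by (auto simp: grid_def int_box_def)

lemma finite_grid [simp]: "finite (grid t)"
  by (simp add: grid_eq_int_box)

lemma card_grid: "card (grid t :: (int ^ 'd::finite) set) = t ^ CARD('d)"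
  by (simp add: grid_eq_int_box card_int_box)

lemma sup_norm_le_iff: "sup_norm v \<le> r \<longleftrightarrow> (\<forall>i. \<bar>v $ i\<bar> \<le> int r)"
proof -
  have "sup_norm v \<le> r \<longleftrightarrow> (\<forall>i. nat \<bar>v $ i\<bar> \<le> r)" by (simp add: sup_norm_def)
  then show ?thesis by (simp add: nat_le_iff)
qed

lemma nth_le_sup_norm: "nat \<bar>v $ i\<bar> \<le> sup_norm v"
  by (simp add: sup_norm_def)

lemma sup_norm_eq_0: "sup_norm v = 0 \<longleftrightarrow> v = 0"
  using sup_norm_le_iff[of v 0] by (auto simp: vec_eq_iff)

lemma sup_norm_minus_commute: "sup_norm (x - y) = sup_norm (y - x)"
  by (simp add: sup_norm_def abs_minus_commute)

lemma sup_norm_ball: "{v. sup_norm v \<le> r} = int_box (\<chi> i. - int r) (\<chi> i. int r)"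
  by (auto simp: sup_norm_le_iff int_box_def abs_le_iff) (metis add.inverse_inverse neg_le_iff_le)+

lemma finite_sup_norm_ball [simp]: "finite {v. sup_norm v \<le> r}"
  by (simp add: sup_norm_ball)

lemma card_sup_norm_ball: "card {v :: int ^ 'd::finite. sup_norm v \<le> r} = (2 * r + 1) ^ CARD('d)"
  by (simp add: sup_norm_ball card_int_box nat_add_distrib nat_mult_distrib)

lemma norm1_le: "norm1 (v :: int ^ 'd::finite) \<le> CARD('d) * sup_norm v"
  using sum_bounded_above[of UNIV "\<lambda>i. nat \<bar>v $ i\<bar>" "sup_norm v"] by (simp add: norm1_def nth_le_sup_norm)

lemma bdry_subset: "bdry t A \<subseteq> grid t \<times> UNIV"
  by (auto simp: bdry_def)

lemma finite_bdry [simp]: "finite (bdry t A)"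
  by (rule finite_subset[OF bdry_subset]) simp

lemma bdry_Diff: "bdry t (grid t - A) = bdry t A"
  by (auto simp: bdry_def)

lemma bdryI: "x \<in> A \<Longrightarrow> y \<in> grid t - A \<Longrightarrow> A \<subseteq> grid t \<Longrightarrow> neighbours x y \<Longrightarrow>
   \<exists>e\<in>bdry t A. (e = (x, snd e) \<and> y = x + unit (snd e)) \<or> (e = (y, snd e) \<and> x = y + unit (snd e))"
  unfolding neighbours_def
proof (elim exE disjE)
  fix i assume "x \<in> A" "y \<in> grid t - A" "A \<subseteq> grid t" "y = x + unit i"
  then show ?thesis by (intro bexI[of _ "(x, i)"]) (auto simp: bdry_def)
next
  fix i assume "x \<in> A" "y \<in> grid t - A" "A \<subseteq> grid t" "x = y + unit i"
  then show ?thesis by (intro bexI[of _ "(y, i)"]) (auto simp: bdry_def)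
qed

text \<open>Peels off one unit step towards the origin. The coordinatewise bounds keep
  \<open>x + v'\<close> in every box containing x and \<open>x + v\<close>, so that walks stay in
  the grid.\<close>

lemma norm1_step:
  fixes v :: "int ^ 'd::finite"
  assumes "norm1 v = Suc n"
  obtains v' i where "norm1 v' = n" "v = v' + unit i \<or> v' = v + unit i"
    "\<And>j. min 0 (v $ j) \<le> v' $ j \<and> v' $ j \<le> max 0 (v $ j)"
proof -
  have "\<exists>i. v $ i \<noteq> 0"
  proof (rule ccontr)
    assume "\<not> ?thesis"
    then show False using assms by (simp add: norm1_def)
  qed
  then obtain i where i: "v $ i \<noteq> 0" by blast
  define \<sigma> where "\<sigma> = sgn (v $ i)"
  define v' where "v' = v - \<sigma> *s unit i"
  have v'i: "v' $ i = v $ i - \<sigma>" and v'j: "\<And>j. j \<noteq> i \<Longrightarrow> v' $ j = v $ j"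
    by (auto simp: v'_def unit_nth)
  have abs: "nat \<bar>v $ i\<bar> = Suc (nat \<bar>v' $ i\<bar>)" using i by (auto simp: v'i \<sigma>_def sgn_if)
  have "norm1 v = nat \<bar>v $ i\<bar> + (\<Sum>j\<in>UNIV - {i}. nat \<bar>v $ j\<bar>)" unfolding norm1_def by (subst sum.remove[of _ i]) auto
  also have "(\<Sum>j\<in>UNIV - {i}. nat \<bar>v $ j\<bar>) = (\<Sum>j\<in>UNIV - {i}. nat \<bar>v' $ j\<bar>)" using v'j by (intro sum.cong) auto
  also have "nat \<bar>v $ i\<bar> + \<dots> = Suc (norm1 v')" unfolding norm1_def by (subst sum.remove[of UNIV i]) (auto simp: abs)
  finally have "norm1 v' = n" using assms by simp
  moreover have "v = v' + unit i \<or> v' = v + unit i"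
  proof (cases "\<sigma> = 1")
    case True
    then show ?thesis by (simp add: v'_def vector_smult_lid)
  next
    case False
    then have "\<sigma> = - 1" using i by (auto simp: \<sigma>_def sgn_if)
    then show ?thesis by (auto simp: v'_def vec_eq_iff unit_nth)
  qed
  moreover have "min 0 (v $ j) \<le> v' $ j \<and> v' $ j \<le> max 0 (v $ j)" for j
    using i by (cases "j = i") (auto simp: v'i v'j \<sigma>_def sgn_if)
  ultimately show thesis by (rule that)
qed

text \<open>Walk from x to \<open>x + v\<close> by unit steps inside the grid. If x is in A and
  \<open>x + v\<close> is not, then either the walk without its last step already ends outside A, or
  the last step crosses the boundary; in the latter case the crossed edge determines x.\<close>

lemma card_shift_le:
  fixes A :: "(int ^ 'd::finite) set"
  assumes "A \<subseteq> grid t"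
  shows "card {x\<in>A. x + v \<in> grid t - A} \<le> norm1 v * card (bdry t A)"
proof (induction "norm1 v" arbitrary: v)
  case 0
  then have "v = 0" by (simp add: norm1_def vec_eq_iff)
  then have "{x\<in>A. x + v \<in> grid t - A} = {}" by auto
  then show ?case by (simp only: card.empty)
next
  case (Suc n)
  have finA: "finite A" by (rule finite_subset[OF assms finite_grid])
  obtain v' i where v': "norm1 v' = n" "v = v' + unit i \<or> v' = v + unit i"
    "\<And>j. min 0 (v $ j) \<le> v' $ j \<and> v' $ j \<le> max 0 (v $ j)"
    using norm1_step[OF Suc.hyps(2)[symmetric]] by metis
  let ?T = "{x. x + v' \<in> A \<and> x + v \<in> grid t - A}"
  have sub: "{x\<in>A. x + v \<in> grid t - A} \<subseteq> {x\<in>A. x + v' \<in> grid t - A} \<union> ?T"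
  proof
    fix x assume x: "x \<in> {x\<in>A. x + v \<in> grid t - A}"
    have "x + v' \<in> grid t"
      unfolding grid_def
    proof (intro CollectI allI)
      fix j
      have "0 \<le> x $ j" "x $ j < int t" "0 \<le> x $ j + v $ j" "x $ j + v $ j < int t"
        using x assms by (auto simp: grid_def)
      then show "0 \<le> (x + v') $ j \<and> (x + v') $ j < int t"
        using v'(3)[of j] by (auto simp: min_def max_def split: if_splits)
    qed
    then show "x \<in> {x\<in>A. x + v' \<in> grid t - A} \<union> ?T" using x by blast
  qed
  have "?T \<subseteq> (\<lambda>y. y - v') ` A" by (auto simp: image_iff) (metis add_diff_cancel)
  then have finT: "finite ?T" using finA finite_subset by blast
  have "card ?T \<le> card (bdry t A)"
    using v'(2)
  proof
    assume v: "v = v' + unit i"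
    have eq: "x + v = x + v' + unit i" for x by (simp add: v)
    show ?thesis
      by (rule card_inj_on_le[where f="\<lambda>x. (x + v', i)", OF _ _ finite_bdry])
        (use assms in \<open>auto simp: inj_on_def bdry_def eq\<close>)
  next
    assume v: "v' = v + unit i"
    have eq: "x + v' = x + v + unit i" for x by (simp add: v)
    show ?thesis
      by (rule card_inj_on_le[where f="\<lambda>x. (x + v, i)", OF _ _ finite_bdry])
        (use assms in \<open>auto simp: inj_on_def bdry_def eq\<close>)
  qed
  moreover have "card {x\<in>A. x + v' \<in> grid t - A} \<le> norm1 v' * card (bdry t A)"
    using Suc.hyps(1)[of v'] v'(1) by simp
  moreover have "card {x\<in>A. x + v \<in> grid t - A} \<le> card {x\<in>A. x + v' \<in> grid t - A} + card ?T"
    using card_mono[OF _ sub] card_Un_le[of "{x\<in>A. x + v' \<in> grid t - A}" ?T] finA finT by fastforce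
  ultimately show ?case by (simp add: v'(1) Suc.hyps(2)[symmetric])
qed

lemma cut_connected_neighbours_int_box:
  fixes a b :: "int ^ 'd::finite"
  shows "cut_connected neighbours (int_box a b)"
  unfolding cut_connected_def
proof (intro allI impI)
  fix B assume B: "B \<subseteq> int_box a b" "B \<noteq> {}" "B \<noteq> int_box a b"
  obtain x y where xy: "x \<in> B" "y \<in> int_box a b" "y \<notin> B" using B by blast
  have xb: "x \<in> int_box a b" using xy B by blast
  show "\<exists>x\<in>B. \<exists>y\<in>int_box a b - B. neighbours x y"
  proof (rule ccontr)
    assume n: "\<not> ?thesis"
    have "x + v \<in> int_box a b \<Longrightarrow> x + v \<in> B" for v
    proof (induction "norm1 v" arbitrary: v)
      case 0
      then have "v = 0" by (simp add: norm1_def vec_eq_iff)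
      then show ?case using xy by simp
    next
      case (Suc m)
      obtain v' i where v': "norm1 v' = m" "v = v' + unit i \<or> v' = v + unit i"
        "\<And>j. min 0 (v $ j) \<le> v' $ j \<and> v' $ j \<le> max 0 (v $ j)"
        using norm1_step[OF Suc.hyps(2)[symmetric]] by metis
      have "x + v' \<in> int_box a b" unfolding int_box_def
      proof (intro CollectI allI)
        fix j
        have "a $ j \<le> x $ j" "x $ j \<le> b $ j" "a $ j \<le> x $ j + v $ j" "x $ j + v $ j \<le> b $ j"
          using xb Suc.prems by (auto simp: int_box_def)
        then show "a $ j \<le> (x + v') $ j \<and> (x + v') $ j \<le> b $ j"
          using v'(3)[of j] by (auto simp: min_def max_def split: if_splits)
      qed
      then have "x + v' \<in> B" using Suc.hyps(1)[of v'] v'(1) by simp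
      moreover have "neighbours (x + v') (x + v)" using v'(2) by (auto simp: neighbours_def add.assoc)
      ultimately show ?case using n Suc.prems by blast
    qed
    from this[of "y - x"] show False using xy by simp
  qed
qed

lemma cut_connected_neighbours_grid: "cut_connected neighbours (grid t)"
  by (simp add: grid_eq_int_box cut_connected_neighbours_int_box)

lemma grid_subcube:
  fixes x :: "int ^ 'd::finite"
  assumes "x \<in> grid t" "l \<le> t" "1 \<le> l"
  obtains a b where "x \<in> int_box a b" "int_box a b \<subseteq> grid t" "card (int_box a b) = l ^ CARD('d)"
    "\<And>y. y \<in> int_box a b \<Longrightarrow> sup_norm (y - x) \<le> l"
proof
  \<comment> \<open>The corner is x itself, pushed back to \<open>t - l\<close> in the coordinates
    where the cube would stick out of the grid.\<close>
  let ?a = "\<chi> i. min (x $ i) (int t - int l)"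
  let ?b = "\<chi> i. min (x $ i) (int t - int l) + int l - 1"
  show "x \<in> int_box ?a ?b" using assms by (auto simp: int_box_def grid_def min_def)
  show "int_box ?a ?b \<subseteq> grid t"
  proof
    fix y assume y: "y \<in> int_box ?a ?b"
    show "y \<in> grid t" unfolding grid_def
    proof (intro CollectI allI)
      fix i
      have "0 \<le> x $ i" "min (x $ i) (int t - int l) \<le> y $ i" "y $ i \<le> min (x $ i) (int t - int l) + int l - 1"
        using y assms(1) by (auto simp: int_box_def grid_def)
      then show "0 \<le> y $ i \<and> y $ i < int t" using assms(2) by linarith
    qed
  qed
  show "card (int_box ?a ?b) = l ^ CARD('d)" by (simp add: card_int_box)
  fix y assume y: "y \<in> int_box ?a ?b"
  show "sup_norm (y - x) \<le> l" unfolding sup_norm_le_iff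
  proof
    fix i
    have "0 \<le> x $ i" "x $ i < int t" "min (x $ i) (int t - int l) \<le> y $ i" "y $ i \<le> min (x $ i) (int t - int l) + int l - 1"
      using y assms(1) by (auto simp: int_box_def grid_def)
    then show "\<bar>(y - x) $ i\<bar> \<le> int l" using assms(2) by simp
  qed
qed

lemma card_Collect_pair_swap:
  assumes "finite A" "finite W"
  shows "(\<Sum>v\<in>W. card {x\<in>A. P x v}) = (\<Sum>x\<in>A. card {v\<in>W. P x v})"
  using sum.swap[of "\<lambda>v x. of_bool (P x v) :: nat" A W] assms by (simp add: Int_def)

text \<open>Double counting of the pairs of a point x of A and a shift v of sup norm at most l with
  \<open>x + v\<close> outside A. A cube of side l containing x is at least half outside A, so every
  x has at least \<open>l ^ d / 2\<close> such shifts; by \<open>card_shift_le\<close>, each of the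
  at most \<open>(3 * l) ^ d\<close> shifts serves at most \<open>d * l * card (bdry t A)\<close>
  points.\<close>

lemma isoperimetry:
  fixes A :: "(int ^ 'd::finite) set"
  assumes A: "A \<subseteq> grid t" and l: "2 * card A \<le> l ^ CARD('d)" "l \<le> t"
  shows "card A \<le> 2 * CARD('d) * 3 ^ CARD('d) * l * card (bdry t A)"
proof (cases "l = 0")
  case True then show ?thesis using l by (simp add: power_0_left)
next
  case False
  let ?d = "CARD('d)"
  let ?W = "{v :: int ^ 'd. sup_norm v \<le> l}"
  have finA: "finite A" by (rule finite_subset[OF A finite_grid])
  have low: "l ^ ?d \<le> 2 * card {v\<in>?W. x + v \<in> grid t - A}" if x: "x \<in> A" for x
  proof -
    obtain a b where ab: "x \<in> int_box a b" "int_box a b \<subseteq> grid t" "card (int_box a b) = l ^ ?d"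
      "\<And>y. y \<in> int_box a b \<Longrightarrow> sup_norm (y - x) \<le> l"
      using grid_subcube[of x t l] x A l False by auto
    have "l ^ ?d - card A \<le> card (int_box a b - A)"
      using ab(3) diff_card_le_card_Diff[OF finA, of "int_box a b"] by simp
    also have "\<dots> \<le> card {v\<in>?W. x + v \<in> grid t - A}"
      by (rule card_inj_on_le[where f="\<lambda>y. y - x"]) (use ab in \<open>auto simp: inj_on_def\<close>)
    finally show ?thesis using l by linarith
  qed
  have "card A * l ^ ?d \<le> (\<Sum>x\<in>A. 2 * card {v\<in>?W. x + v \<in> grid t - A})"
    using sum_bounded_below[of A "l ^ ?d" "\<lambda>x. 2 * card {v\<in>?W. x + v \<in> grid t - A}"] low by simp
  also have "\<dots> = 2 * (\<Sum>v\<in>?W. card {x\<in>A. x + v \<in> grid t - A})"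
    using finA by (simp add: sum_distrib_left[symmetric] card_Collect_pair_swap)
  also have "(\<Sum>v\<in>?W. card {x\<in>A. x + v \<in> grid t - A}) \<le> (\<Sum>v\<in>?W. ?d * l * card (bdry t A))"
  proof (rule sum_mono)
    fix v assume v: "v \<in> ?W"
    have "card {x\<in>A. x + v \<in> grid t - A} \<le> norm1 v * card (bdry t A)" by (rule card_shift_le[OF A])
    also have "\<dots> \<le> ?d * l * card (bdry t A)"
      using norm1_le[of v] v by (intro mult_right_mono) (auto intro: order_trans[OF norm1_le])
    finally show "card {x\<in>A. x + v \<in> grid t - A} \<le> ?d * l * card (bdry t A)" .
  qed
  also have "\<dots> = (2 * l + 1) ^ ?d * (?d * l * card (bdry t A))" by (simp add: card_sup_norm_ball)
  also have "\<dots> \<le> (3 * l) ^ ?d * (?d * l * card (bdry t A))"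
    using False by (intro mult_right_mono power_mono) auto
  finally have "card A * l ^ ?d \<le> (2 * ?d * 3 ^ ?d * l * card (bdry t A)) * l ^ ?d"
    by (simp add: power_mult_distrib algebra_simps)
  then show ?thesis using False by simp
qed

section \<open>Summability of the long edges across a boundary\<close>

lemma sum_prod_nth_le:
  fixes h :: "nat \<Rightarrow> real"
  assumes h: "\<And>k. 0 \<le> h k" "summable h" and F: "finite F"
  shows "(\<Sum>v\<in>F. \<Prod>i\<in>UNIV. h (nat \<bar>(v :: int ^ 'd::finite) $ i\<bar>)) \<le> (2 * suminf h) ^ CARD('d)"
proof -
  define r where "r = Max (sup_norm ` F \<union> {0})"
  have r: "F \<subseteq> {v :: int ^ 'd. sup_norm v \<le> r}" using F by (auto simp: r_def)
  have "(\<Sum>v\<in>F. \<Prod>i\<in>UNIV. h (nat \<bar>v $ i\<bar>)) \<le> (\<Sum>v\<in>{v :: int ^ 'd. sup_norm v \<le> r}. \<Prod>i\<in>UNIV. h (nat \<bar>v $ i\<bar>))"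
    using r h by (intro sum_mono2) (auto intro: prod_nonneg)
  also have "\<dots> = (\<Sum>f\<in>PiE UNIV (\<lambda>i::'d. {- int r..int r}). \<Prod>i\<in>UNIV. h (nat \<bar>f i\<bar>))"
    unfolding sup_norm_ball
    by (rule sum.reindex_bij_betw[of vec_nth, where g="\<lambda>f. \<Prod>i\<in>UNIV. h (nat \<bar>f i\<bar>)"])
       (use bij_int_box[of "\<chi> i. - int r" "\<chi> i. int r"] in simp)
  also have "\<dots> = (\<Prod>i\<in>(UNIV::'d set). \<Sum>k\<in>{- int r..int r}. h (nat \<bar>k\<bar>))"
    by (rule prod_sum_PiE[symmetric]) auto
  also have "\<dots> = (\<Sum>k\<in>{- int r..int r}. h (nat \<bar>k\<bar>)) ^ CARD('d)" by simp
  also have "\<dots> \<le> (2 * suminf h) ^ CARD('d)"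
  proof (rule power_mono)
    have "(\<Sum>k\<in>{- int r..int r}. h (nat \<bar>k\<bar>)) \<le> (\<Sum>k\<in>int ` {..r} \<union> (\<lambda>n. - int n) ` {..r}. h (nat \<bar>k\<bar>))"
    proof (intro sum_mono2)
      show "{- int r..int r} \<subseteq> int ` {..r} \<union> (\<lambda>n. - int n) ` {..r}"
      proof
        fix k assume "k \<in> {- int r..int r}"
        then show "k \<in> int ` {..r} \<union> (\<lambda>n. - int n) ` {..r}"
          by (cases "0 \<le> k") (auto intro!: image_eqI[of _ _ "nat \<bar>k\<bar>"])
      qed
    qed (use h in auto)
    also have "\<dots> \<le> (\<Sum>k\<in>int ` {..r}. h (nat \<bar>k\<bar>)) + (\<Sum>k\<in>(\<lambda>n. - int n) ` {..r}. h (nat \<bar>k\<bar>))"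
      using h by (subst sum.union_inter[symmetric]) (auto intro: sum_nonneg)
    also have "\<dots> = 2 * (\<Sum>k\<le>r. h k)" by (simp add: sum.reindex inj_on_def)
    also have "\<dots> \<le> 2 * suminf h" using sum_le_suminf[OF h(2), of "{..r}"] h by auto
    finally show "(\<Sum>k\<in>{- int r..int r}. h (nat \<bar>k\<bar>)) \<le> 2 * suminf h" .
  qed (auto intro: sum_nonneg h)
  finally show ?thesis .
qed

text \<open>Sum over the shift v between X and Y: by \<open>card_shift_le\<close> it occurs for at
  most \<open>norm1 v * card (bdry t A)\<close> points X, so |v|^(1 - d \<alpha>) has to be summable
  over the lattice, that is, d \<alpha> - 1 > d.\<close>

lemma long_range_boundary_sum:
  fixes \<alpha> :: real
  assumes "\<alpha> > 1 + 1 / real CARD('d::finite)"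
  shows "\<exists>C>0. \<forall>t. \<forall>A \<subseteq> (grid t :: (int ^ 'd) set).
     (\<Sum>X\<in>A. \<Sum>Y\<in>grid t - A. real (sup_norm (X - Y)) powr (- (real CARD('d) * \<alpha>))) \<le> C * real (card (bdry t A))"
proof -
  let ?d = "CARD('d)"
  define s where "s = real ?d * \<alpha> - 1"
  have d0: "real ?d > 0" by simp
  have s: "s / ?d > 1"
  proof -
    have "real ?d * \<alpha> > real ?d * (1 + 1 / real ?d)" by (rule mult_strict_left_mono[OF assms d0])
    also have "real ?d * (1 + 1 / real ?d) = real ?d + 1" by (simp add: distrib_left)
    finally show ?thesis by (simp add: s_def)
  qed
  \<comment> \<open>The power is split evenly over the coordinates, each receiving an exponent s/d >
    1. The maximum with 1 matters because \<open>0 powr\<close> anything is 0, which would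
    annihilate the product on the coordinate hyperplanes.\<close>
  define h where "h k = (real (max 1 k)) powr (- (s / ?d))" for k :: nat
  have h0: "0 \<le> h k" for k by (simp add: h_def)
  have "summable (\<lambda>k. real k powr (- (s / ?d)))" using s by (subst summable_real_powr_iff) auto
  then have hs: "summable h"
    by (rule summable_cong[THEN iffD2, rotated]) (auto simp: h_def eventually_at_top_linorder max_def intro!: exI[of _ 1])
  define C where "C = ?d * (2 * suminf h) ^ ?d + 1"
  have "h 0 \<le> suminf h" using sum_le_suminf[OF hs, of "{0}"] h0 by auto
  then have C: "C > 0" unfolding C_def using h0[of 0] by (intro add_nonneg_pos mult_nonneg_nonneg) auto
  have pt: "real (norm1 v) * real (sup_norm v) powr (- (?d * \<alpha>)) \<le> ?d * (\<Prod>i\<in>UNIV. h (nat \<bar>v $ i\<bar>))" if "v \<noteq> 0" for v :: "int ^ 'd"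
  proof -
    have sv: "sup_norm v \<ge> 1" using that sup_norm_eq_0[of v] by (simp add: Suc_le_eq)
    have "real (norm1 v) * real (sup_norm v) powr (- (?d * \<alpha>)) \<le> (?d * real (sup_norm v)) * real (sup_norm v) powr (- (?d * \<alpha>))"
      using norm1_le[of v] by (intro mult_right_mono) (auto simp flip: of_nat_mult)
    also have "\<dots> = ?d * (real (sup_norm v) powr 1 * real (sup_norm v) powr (- (?d * \<alpha>)))" using sv by simp
    also have "\<dots> = ?d * real (sup_norm v) powr (- s)" unfolding s_def powr_add[symmetric] by simp
    also have "real (sup_norm v) powr (- s) = (\<Prod>i\<in>(UNIV :: 'd set). real (sup_norm v) powr (- (s / ?d)))"
      using sv by (simp add: powr_powr flip: powr_realpow)
    also have "\<dots> \<le> (\<Prod>i\<in>UNIV. h (nat \<bar>v $ i\<bar>))"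
    proof (rule prod_mono, intro conjI)
      fix i :: 'd
      have "max 1 (nat \<bar>v $ i\<bar>) \<le> sup_norm v" using sv nth_le_sup_norm[of v i] by simp
      then show "real (sup_norm v) powr - (s / ?d) \<le> h (nat \<bar>v $ i\<bar>)"
        unfolding h_def using s by (intro powr_mono2') auto
    qed auto
    finally show ?thesis by (simp add: mult_left_mono)
  qed
  have "(\<Sum>X\<in>A. \<Sum>Y\<in>grid t - A. real (sup_norm (X - Y)) powr (- (?d * \<alpha>))) \<le> C * real (card (bdry t A))"
    if A: "A \<subseteq> grid t" for t and A :: "(int ^ 'd) set"
  proof -
    have finA: "finite A" by (rule finite_subset[OF A finite_grid])
    let ?W = "{v :: int ^ 'd. sup_norm v \<le> t} - {0}"
    have "(\<Sum>X\<in>A. \<Sum>Y\<in>grid t - A. real (sup_norm (X - Y)) powr (- (?d * \<alpha>)))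
        = (\<Sum>X\<in>A. \<Sum>v\<in>{v\<in>?W. X + v \<in> grid t - A}. real (sup_norm v) powr (- (?d * \<alpha>)))"
    proof (rule sum.cong[OF refl])
      fix X assume X: "X \<in> A"
      have sm: "sup_norm (Y - X) \<le> t" if "Y \<in> grid t" for Y
        unfolding sup_norm_le_iff
      proof
        fix i have "0 \<le> X $ i" "X $ i < int t" "0 \<le> Y $ i" "Y $ i < int t" using X A that by (auto simp: grid_def)
        then show "\<bar>(Y - X) $ i\<bar> \<le> int t" by simp
      qed
      show "(\<Sum>Y\<in>grid t - A. real (sup_norm (X - Y)) powr (- (?d * \<alpha>))) = (\<Sum>v\<in>{v\<in>?W. X + v \<in> grid t - A}. real (sup_norm v) powr (- (?d * \<alpha>)))"
        by (rule sum.reindex_bij_witness[where i="\<lambda>v. X + v" and j="\<lambda>Y. Y - X"]) (use X sm in \<open>auto simp: sup_norm_minus_commute\<close>)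
    qed
    also have "\<dots> = (\<Sum>v\<in>?W. \<Sum>X\<in>{X\<in>A. X + v \<in> grid t - A}. real (sup_norm v) powr (- (?d * \<alpha>)))"
      using finA by (intro sum.swap_restrict) auto
    also have "\<dots> = (\<Sum>v\<in>?W. real (card {X\<in>A. X + v \<in> grid t - A}) * real (sup_norm v) powr (- (?d * \<alpha>)))" by simp
    also have "\<dots> \<le> (\<Sum>v\<in>?W. real (card (bdry t A)) * (?d * (\<Prod>i\<in>UNIV. h (nat \<bar>v $ i\<bar>))))"
    proof (rule sum_mono)
      fix v assume v: "v \<in> ?W"
      have "real (card {X\<in>A. X + v \<in> grid t - A}) * real (sup_norm v) powr (- (?d * \<alpha>))
         \<le> (real (norm1 v) * real (card (bdry t A))) * real (sup_norm v) powr (- (?d * \<alpha>))"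
        using card_shift_le[OF A, of v] by (intro mult_right_mono) (auto simp flip: of_nat_mult)
      also have "\<dots> = real (card (bdry t A)) * (real (norm1 v) * real (sup_norm v) powr (- (?d * \<alpha>)))" by simp
      also have "\<dots> \<le> real (card (bdry t A)) * (?d * (\<Prod>i\<in>UNIV. h (nat \<bar>v $ i\<bar>)))"
        using pt[of v] v by (intro mult_left_mono) auto
      finally show "real (card {X\<in>A. X + v \<in> grid t - A}) * real (sup_norm v) powr (- (?d * \<alpha>)) \<le> real (card (bdry t A)) * (?d * (\<Prod>i\<in>UNIV. h (nat \<bar>v $ i\<bar>)))" .
    qed
    also have "\<dots> = real (card (bdry t A)) * (?d * (\<Sum>v\<in>?W. \<Prod>i\<in>UNIV. h (nat \<bar>v $ i\<bar>)))"
      by (simp add: sum_distrib_left)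
    also have "\<dots> \<le> real (card (bdry t A)) * (?d * (2 * suminf h) ^ ?d)"
      by (intro mult_left_mono sum_prod_nth_le) (auto intro: h0 hs)
    also have "\<dots> \<le> C * real (card (bdry t A))" by (simp add: C_def algebra_simps)
    finally show ?thesis .
  qed
  then show ?thesis using C by blast
qed

section \<open>Contours and their number\<close>

text \<open>The sides may differ from coordinate to coordinate, so that the induction in
  \<open>cocycle_coboundary\<close> can shorten a single one.\<close>

definition corner_box :: "('d \<Rightarrow> nat) \<Rightarrow> (int ^ 'd::finite) set" where
  "corner_box b = {x. \<forall>i. 0 \<le> x $ i \<and> x $ i \<le> int (b i)}"

text \<open>
  The discrete Poincare lemma modulo 2. A set of edges that meets every unit square evenly is a cut.
\<close>

lemma cocycle_coboundary:
  fixes w :: "(int ^ 'd::finite) \<times> 'd \<Rightarrow> bool" and b :: "'d \<Rightarrow> nat"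
  assumes sq: "\<And>x i j. i \<noteq> j \<Longrightarrow> x \<in> corner_box b \<Longrightarrow> x + unit i + unit j \<in> corner_box b \<Longrightarrow>
     (w (x, i) \<noteq> w (x + unit i, j)) = (w (x, j) \<noteq> w (x + unit j, i))"
  shows "\<exists>f :: int ^ 'd \<Rightarrow> bool. \<forall>x i. x \<in> corner_box b \<longrightarrow> x + unit i \<in> corner_box b \<longrightarrow> w (x, i) = (f x \<noteq> f (x + unit i))"
  using sq
proof (induction "\<Sum>i\<in>UNIV. b i" arbitrary: b)
  case 0
  then have b: "b i = 0" for i by simp
  have "\<not> (x \<in> corner_box b \<and> x + unit i \<in> corner_box b)" for x i
  proof
    assume "x \<in> corner_box b \<and> x + unit i \<in> corner_box b"
    then have "0 \<le> x $ i" "(x + unit i) $ i \<le> int (b i)" unfolding corner_box_def by blast+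
    then show False using b by simp
  qed
  then show ?case by blast
next
  case (Suc n)
  have "\<exists>k. b k \<noteq> 0"
  proof (rule ccontr)
    assume "\<not> ?thesis" then have "(\<Sum>i\<in>UNIV. b i) = 0" by simp
    then show False using Suc by simp
  qed
  then obtain k where k: "b k > 0" by auto
  define b' where "b' = b(k := b k - 1)"
  have "int (b' i) \<le> int (b i)" for i by (simp add: b'_def)
  then have sub: "corner_box b' \<subseteq> corner_box b" unfolding corner_box_def by (blast intro: order_trans)
  have b'I: "x \<in> corner_box b'" if "x \<in> corner_box b" "x $ k < int (b k)" for x
    using that by (auto simp: corner_box_def b'_def of_nat_diff)
  have "(\<Sum>i\<in>UNIV. b i) = b k + (\<Sum>i\<in>UNIV - {k}. b i)" by (subst sum.remove[of _ k]) auto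
  also have "\<dots> = Suc (b' k + (\<Sum>i\<in>UNIV - {k}. b' i))" using k by (simp add: b'_def)
  also have "b' k + (\<Sum>i\<in>UNIV - {k}. b' i) = (\<Sum>i\<in>UNIV. b' i)" by (subst sum.remove[of UNIV k]) auto
  finally have nb: "n = (\<Sum>i\<in>UNIV. b' i)" using Suc.hyps(2) by simp
  have "\<exists>f :: int ^ 'd \<Rightarrow> bool. \<forall>x i. x \<in> corner_box b' \<longrightarrow> x + unit i \<in> corner_box b' \<longrightarrow> w (x, i) = (f x \<noteq> f (x + unit i))"
    by (rule Suc.hyps(1)[OF nb]) (use Suc.prems sub in blast)
  then obtain f :: "int ^ 'd \<Rightarrow> bool" where f: "\<And>x i. x \<in> corner_box b' \<Longrightarrow> x + unit i \<in> corner_box b' \<Longrightarrow> w (x, i) = (f x \<noteq> f (x + unit i))"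
    by blast
  \<comment> \<open>The last layer in direction k receives the values that the edges in direction k
    force.\<close>
  define f' where "f' x = (if x $ k = int (b k) then f (x - unit k) \<noteq> w (x - unit k, k) else f x)" for x
  have "w (x, j) = (f' x \<noteq> f' (x + unit j))" if x: "x \<in> corner_box b" "x + unit j \<in> corner_box b" for x j
  proof -
    have xk: "x $ k \<le> int (b k)" "(x + unit j) $ k \<le> int (b k)" "0 \<le> x $ k" using x by (auto simp: corner_box_def)
    consider "x $ k < int (b k)" "(x + unit j) $ k < int (b k)" | "x $ k < int (b k)" "(x + unit j) $ k = int (b k)"
      | "x $ k = int (b k)" using xk by linarith
    then show ?thesis
    proof cases
      case 1
      then show ?thesis using f[of x j] b'I x by (auto simp: f'_def)
    next
      case 2
      then have "j = k" by (auto simp: unit_nth split: if_splits)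
      then show ?thesis using 2 by (auto simp: f'_def)
    next
      case 3
      then have jk: "j \<noteq> k" using xk by auto
      \<comment> \<open>An edge inside the last layer is compared with its translate one layer
        below, through the unit square between them.\<close>
      define y where "y = x - unit k"
      have xy: "x = y + unit k" by (simp add: y_def)
      have yb: "y \<in> corner_box b" "y + unit j \<in> corner_box b"
        using x 3 k jk by (auto simp: corner_box_def y_def unit_nth split: if_splits)
      have yk: "y $ k < int (b k)" "(y + unit j) $ k < int (b k)" using 3 jk by (auto simp: y_def unit_nth)
      have "w (y, j) = (f y \<noteq> f (y + unit j))" using f b'I yb yk by blast
      moreover have "(w (y, j) \<noteq> w (y + unit j, k)) = (w (y, k) \<noteq> w (y + unit k, j))"
        using Suc.prems[of j k y] jk yb x by (auto simp: xy add_ac)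
      moreover have "f' x = (f y \<noteq> w (y, k))" using 3 by (auto simp: f'_def y_def)
      moreover have "f' (x + unit j) = (f (y + unit j) \<noteq> w (y + unit j, k))"
        using 3 jk by (auto simp: f'_def unit_nth y_def algebra_simps)
      ultimately show ?thesis unfolding xy by argo
    qed
  qed
  then show ?case by blast
qed

definition square :: "int ^ 'd \<Rightarrow> 'd \<Rightarrow> 'd \<Rightarrow> ((int ^ 'd::finite) \<times> 'd) set" where
  "square x i j = {(x, i), (x + unit i, j), (x, j), (x + unit j, i)}"

text \<open>The edges of a unit square are dual to (d-1)-dimensional faces that share the
  (d-2)-dimensional face dual to the square. So this is connectedness of the dual surface.\<close>

definition sqadj :: "(int ^ 'd::finite) \<times> 'd \<Rightarrow> (int ^ 'd) \<times> 'd \<Rightarrow> bool" where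
  "sqadj e e' \<longleftrightarrow> (\<exists>x i j. i \<noteq> j \<and> e \<in> square x i j \<and> e' \<in> square x i j)"

lemma sqadj_sym: "sqadj e e' \<Longrightarrow> sqadj e' e"
  by (auto simp: sqadj_def)

lemma card_sqadj:
  fixes V :: "((int ^ 'd::finite) \<times> 'd) set"
  shows "card {u\<in>V. sqadj e u} \<le> 3 ^ CARD('d) * CARD('d)"
proof -
  let ?S = "(\<lambda>(v, l). (fst e + v, l)) ` ({v :: int ^ 'd. sup_norm v \<le> 1} \<times> (UNIV :: 'd set))"
  have sub: "{u\<in>V. sqadj e u} \<subseteq> ?S"
  proof
    fix u assume "u \<in> {u\<in>V. sqadj e u}"
    then obtain x i j where u: "e \<in> square x i j" "u \<in> square x i j" by (auto simp: sqadj_def)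
    have "sup_norm (fst u - fst e) \<le> 1"
      using u by (auto simp: square_def sup_norm_le_iff unit_nth)
    then show "u \<in> ?S"
      by (intro image_eqI[of _ _ "(fst u - fst e, snd u)"]) auto
  qed
  have "card {u\<in>V. sqadj e u} \<le> card ?S" by (rule card_mono[OF _ sub]) simp
  also have "\<dots> \<le> card ({v :: int ^ 'd. sup_norm v \<le> 1} \<times> (UNIV :: 'd set))" by (rule card_image_le) simp
  also have "\<dots> = 3 ^ CARD('d) * CARD('d)" by (simp add: card_cartesian_product card_sup_norm_ball eval_nat_numeral)
  finally show ?thesis .
qed

text \<open>
  If \<open>B\<close> were a union of connected components of the boundary, it would meet every unit square evenly, hence be the
  cut of a function that is constant on \<open>A\<close> and on its complement.
\<close>

lemma cut_connected_bdry:
  fixes A :: "(int ^ 'd::finite) set"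
  assumes A: "A \<subseteq> grid t" "cut_connected neighbours A" "cut_connected neighbours (grid t - A)"
  shows "cut_connected sqadj (bdry t A)"
  unfolding cut_connected_def
proof (intro allI impI, rule ccontr)
  fix B assume B: "B \<subseteq> bdry t A" "B \<noteq> {}" "B \<noteq> bdry t A"
    and n: "\<not> (\<exists>x\<in>B. \<exists>y\<in>bdry t A - B. sqadj x y)"
  obtain x0 i0 where "(x0, i0) \<in> B" using B by auto
  then have "x0 \<in> grid t" using B by (auto simp: bdry_def)
  then have t: "t > 0" by (auto simp: grid_def)
  have G: "grid t = (corner_box (\<lambda>_. t - 1) :: (int ^ 'd) set)"
    using t by (auto simp: grid_def corner_box_def)
  have "\<exists>f :: int ^ 'd \<Rightarrow> bool. \<forall>x i. x \<in> grid t \<longrightarrow> x + unit i \<in> grid t \<longrightarrow>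
      ((x, i) \<in> B) = (f x \<noteq> f (x + unit i))"
    unfolding G
  proof (rule cocycle_coboundary[where w="\<lambda>e. e \<in> B" and b="\<lambda>_. t - 1"], unfold G[symmetric])
    fix x :: "int ^ 'd" and i j :: 'd
    assume ij: "i \<noteq> j" and x: "x \<in> grid t" "x + unit i + unit j \<in> grid t"
    have g: "x + unit i \<in> grid t" "x + unit j \<in> grid t"
    proof -
      have "0 \<le> (x + unit k) $ l \<and> (x + unit k) $ l < int t" if "k = i \<or> k = j" for k l
      proof -
        have "0 \<le> x $ l" "(x + unit i + unit j) $ l < int t" using x by (auto simp: grid_def)
        then show ?thesis using that by (auto simp: unit_nth split: if_splits)
      qed
      then show "x + unit i \<in> grid t" "x + unit j \<in> grid t" unfolding grid_def by blast+
    qed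
    have c: "x + unit j + unit i = x + unit i + unit j" by simp
    have g4: "x + unit j + unit i \<in> grid t" using x(2) unfolding c .
    have m: "e \<in> bdry t A \<longleftrightarrow> (fst e \<in> A) \<noteq> (fst e + unit (snd e) \<in> A)" if "e \<in> square x i j" for e
      using that g g4 x by (auto simp: bdry_def square_def)
    have tot: "(((x, i) \<in> bdry t A) \<noteq> ((x + unit i, j) \<in> bdry t A)) = (((x, j) \<in> bdry t A) \<noteq> ((x + unit j, i) \<in> bdry t A))"
      using m[of "(x, i)"] m[of "(x + unit i, j)"] m[of "(x, j)"] m[of "(x + unit j, i)"] c
      by (auto simp: square_def)
    show "(((x, i) \<in> B) \<noteq> ((x + unit i, j) \<in> B)) = (((x, j) \<in> B) \<noteq> ((x + unit j, i) \<in> B))"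
    proof (cases "square x i j \<inter> B = {}")
      case True then show ?thesis by (auto simp: square_def)
    next
      \<comment> \<open>A square met by B contains no boundary edge outside B, so on it B agrees
        with the whole boundary, which meets the square evenly because it is a cut.\<close>
      case False
      then have "e \<in> B \<longleftrightarrow> e \<in> bdry t A" if "e \<in> square x i j" for e
        using n B that ij unfolding sqadj_def by blast
      then show ?thesis using tot by (auto simp: square_def)
    qed
  qed
  then obtain f :: "int ^ 'd \<Rightarrow> bool" where f: "\<And>x i. x \<in> grid t \<Longrightarrow> x + unit i \<in> grid t \<Longrightarrow> ((x, i) \<in> B) = (f x \<noteq> f (x + unit i))"
    by blast
  \<comment> \<open>An edge inside D does not belong to the boundary of A, hence not to B, so f does
    not change along it.\<close>
  have const: "f x = f y" if D: "cut_connected neighbours D" "D \<subseteq> grid t" "\<And>x. x \<in> D \<Longrightarrow> x \<in> A = c" "x \<in> D" "y \<in> D" for D c x y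
  proof (rule ccontr)
    assume ne: "f x \<noteq> f y"
    define S where "S = {z\<in>D. f z = f x}"
    have "x \<in> S" "y \<notin> S" using D(4) ne by (auto simp: S_def)
    then have "S \<subseteq> D" "S \<noteq> {}" "S \<noteq> D" using D(5) by (auto simp: S_def)
    then obtain u v where uv: "u \<in> S" "v \<in> D" "v \<notin> S" "neighbours u v" using cut_connectedD[OF D(1)] by metis
    have fuv: "f u \<noteq> f v" using uv by (auto simp: S_def)
    from uv(4) obtain i where "v = u + unit i \<or> u = v + unit i" by (auto simp: neighbours_def)
    then show False
    proof
      assume "v = u + unit i"
      then have "(u, i) \<in> B" using f[of u i] fuv uv D(2) by (auto simp: S_def)
      then have "(u, i) \<in> bdry t A" using B by blast
      then show False using D(3)[of u] D(3)[of v] uv \<open>v = u + unit i\<close> by (auto simp: bdry_def S_def)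
    next
      assume "u = v + unit i"
      then have "(v, i) \<in> B" using f[of v i] fuv uv D(2) by (auto simp: S_def)
      then have "(v, i) \<in> bdry t A" using B by blast
      then show False using D(3)[of u] D(3)[of v] uv \<open>u = v + unit i\<close> by (auto simp: bdry_def S_def)
    qed
  qed
  have cA: "f x = f y" if "x \<in> A" "y \<in> A" for x y using const[of A True x y] A that by auto
  have cB: "f x = f y" if "x \<in> grid t - A" "y \<in> grid t - A" for x y using const[of "grid t - A" False x y] A that by auto
  \<comment> \<open>A boundary edge outside B and one inside B make the constants of f on A and on
    its complement both equal and different.\<close>
  obtain x1 i1 where e1: "(x1, i1) \<in> bdry t A" "(x1, i1) \<notin> B" using B by auto
  obtain x2 i2 where e2: "(x2, i2) \<in> B" "(x2, i2) \<in> bdry t A" using B by auto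
  have "f x1 = f (x1 + unit i1)" using f[of x1 i1] e1 by (auto simp: bdry_def)
  moreover have "f x2 \<noteq> f (x2 + unit i2)" using f[of x2 i2] e2 by (auto simp: bdry_def)
  ultimately show False using e1(1) e2(2) cA cB unfolding bdry_def by blast
qed

text \<open>Since the grid is connected, every component of the complement touches K. Hence the
  complement of one of them is a star with hub K, and both B and its complement are connected, as
  \<open>cut_connected_bdry\<close> requires.\<close>

lemma conn_component_complement:
  fixes K :: "(int ^ 'd::finite) set"
  assumes K: "K \<subseteq> grid t" "K \<noteq> {}" "cut_connected neighbours K" and X: "X \<in> grid t - K"
  defines "B \<equiv> conn_component neighbours (grid t - K) X"
  shows "B \<subseteq> grid t - K" "cut_connected neighbours B" "cut_connected neighbours (grid t - B)"
    "\<And>x y. x \<in> B \<Longrightarrow> y \<in> grid t - B \<Longrightarrow> neighbours x y \<Longrightarrow> y \<in> K"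
    "\<exists>x\<in>B. \<exists>y\<in>K. neighbours x y"
proof -
  show Bs: "B \<subseteq> grid t - K" unfolding B_def by (rule conn_component_subset[OF X])
  show "cut_connected neighbours B" unfolding B_def by (rule cut_connected_conn_component) (rule neighbours_sym)
  have link: "\<exists>x\<in>conn_component neighbours (grid t - K) Y. \<exists>y\<in>K. neighbours x y" if Y: "Y \<in> grid t - K" for Y
  proof -
    let ?C = "conn_component neighbours (grid t - K) Y"
    have s: "?C \<subseteq> grid t - K" by (rule conn_component_subset[OF Y])
    have "?C \<noteq> grid t" using s K by blast
    moreover have "?C \<noteq> {}" using conn_component_self[of Y neighbours "grid t - K"] by blast
    ultimately obtain x y where xy: "x \<in> ?C" "y \<in> grid t" "y \<notin> ?C" "neighbours x y"
      using cut_connectedD[OF cut_connected_neighbours_grid[of t], of ?C] s by blast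
    have "y \<in> K"
    proof (rule ccontr)
      assume "y \<notin> K"
      then have "y \<in> ?C" using conn_component_step[of x neighbours "grid t - K" Y y] xy s by blast
      then show False using xy by blast
    qed
    then show ?thesis using xy by blast
  qed
  then show "\<exists>x\<in>B. \<exists>y\<in>K. neighbours x y" using X by (simp add: B_def)
  show "y \<in> K" if "x \<in> B" "y \<in> grid t - B" "neighbours x y" for x y
  proof (rule ccontr)
    assume "y \<notin> K"
    then have "y \<in> B" using conn_component_step[of x neighbours "grid t - K" X y] that Bs unfolding B_def by blast
    then show False using that by blast
  qed
  define \<A> where "\<A> = {C. \<exists>Y\<in>grid t - K. C = conn_component neighbours (grid t - K) Y \<and> C \<noteq> B}"
  have "grid t - B = K \<union> \<Union>\<A>"
  proof
    show "grid t - B \<subseteq> K \<union> \<Union>\<A>"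
    proof
      fix y assume y: "y \<in> grid t - B"
      show "y \<in> K \<union> \<Union>\<A>"
      proof (cases "y \<in> K")
        case False
        then have "y \<in> grid t - K" using y by blast
        moreover have "conn_component neighbours (grid t - K) y \<noteq> B" using y conn_component_self[of y neighbours "grid t - K"] by blast
        ultimately show ?thesis using conn_component_self[of y neighbours "grid t - K"] unfolding \<A>_def by blast
      qed simp
    qed
    show "K \<union> \<Union>\<A> \<subseteq> grid t - B"
    proof
      fix y assume "y \<in> K \<union> \<Union>\<A>"
      then show "y \<in> grid t - B"
      proof
        assume "y \<in> K" then show ?thesis using K Bs by blast
      next
        assume "y \<in> \<Union>\<A>"
        then obtain Y where Y: "Y \<in> grid t - K" "y \<in> conn_component neighbours (grid t - K) Y" "conn_component neighbours (grid t - K) Y \<noteq> B"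
          by (auto simp: \<A>_def)
        have "conn_component neighbours (grid t - K) Y \<inter> B = {}"
          unfolding B_def by (rule conn_component_disjoint, erule neighbours_sym, rule Y(3)[unfolded B_def])
        then show ?thesis using Y conn_component_subset[OF Y(1), of neighbours] by blast
      qed
    qed
  qed
  moreover have "cut_connected neighbours (K \<union> \<Union>\<A>)"
  proof (rule cut_connected_star[OF neighbours_sym K(3) K(2)])
    fix A assume "A \<in> \<A>"
    then obtain Y where Y: "Y \<in> grid t - K" "A = conn_component neighbours (grid t - K) Y" by (auto simp: \<A>_def)
    show "cut_connected neighbours A" unfolding Y(2) by (rule cut_connected_conn_component) (rule neighbours_sym)
    show "\<exists>a\<in>A. \<exists>k\<in>K. neighbours k a" using link[OF Y(1)] neighbours_sym unfolding Y(2) by blast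
  qed
  ultimately show "cut_connected neighbours (grid t - B)" by simp
qed

text \<open>Connectedness is recorded for the boundary, because the counting goes through
  boundaries, from which the set is recovered by \<open>bdry_inj\<close>. The half-volume bound
  keeps isoperimetry available.\<close>

definition contours :: "nat \<Rightarrow> (int ^ 'd::finite) set set" where
  "contours t = {A. A \<subseteq> grid t \<and> A \<noteq> {} \<and> 2 * card A \<le> t ^ CARD('d) \<and> cut_connected sqadj (bdry t A)}"

lemma finite_contours [simp]: "finite (contours t)"
  by (rule finite_subset[of _ "Pow (grid t)"]) (auto simp: contours_def)

lemma contoursI:
  fixes A :: "(int ^ 'd::finite) set"
  assumes "A \<subseteq> grid t" "A \<noteq> {}" "2 * card A \<le> t ^ CARD('d)" "cut_connected neighbours A" "cut_connected neighbours (grid t - A)"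
  shows "A \<in> contours t"
  using assms cut_connected_bdry[of A t] by (auto simp: contours_def)

text \<open>\<open>cube_side d k\<close> is the side of the smallest cube in which a set of \<open>k\<close> points has density at most 1/2.\<close>

definition cube_side :: "nat \<Rightarrow> nat \<Rightarrow> nat" where
  "cube_side d k = (LEAST l. 2 * k \<le> l ^ d)"

lemma cube_side_ge:
  assumes "d > 0" shows "2 * k \<le> cube_side d k ^ d"
  unfolding cube_side_def
proof (rule LeastI[of "\<lambda>l. 2 * k \<le> l ^ d" "2 * k"])
  show "2 * k \<le> (2 * k) ^ d"
    using self_le_power[of "2 * k" d] assms by (cases "k = 0") simp_all
qed

lemma cube_side_le: "2 * k \<le> l ^ d \<Longrightarrow> cube_side d k \<le> l"
  unfolding cube_side_def by (rule Least_le)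

text \<open>By minimality \<open>(l - 1) ^ d < 2 * k\<close>, and l is at most twice l - 1 because
  it is at least 2.\<close>

lemma cube_side_upper:
  assumes "d > 0" "k > 0" shows "cube_side d k ^ d \<le> 2 ^ (d + 1) * k"
proof -
  let ?l = "cube_side d k"
  have l2: "?l \<ge> 2"
  proof (rule ccontr)
    assume "\<not> ?thesis" then have "?l ^ d \<le> 1 ^ d" by (intro power_mono) auto
    then show False using cube_side_ge[of d k] assms by simp
  qed
  have "\<not> 2 * k \<le> (?l - 1) ^ d" using l2 cube_side_le[of k "?l - 1" d] by auto
  then have "(?l - 1) ^ d \<le> 2 * k" by simp
  have "?l ^ d \<le> (2 * (?l - 1)) ^ d" using l2 by (intro power_mono) auto
  also have "\<dots> = 2 ^ d * (?l - 1) ^ d" by (simp add: power_mult_distrib)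
  also have "\<dots> \<le> 2 ^ d * (2 * k)" using \<open>(?l - 1) ^ d \<le> 2 * k\<close> by simp
  finally show ?thesis by simp
qed

lemma cube_side_pos: "d > 0 \<Longrightarrow> k > 0 \<Longrightarrow> cube_side d k > 0"
  using cube_side_ge[of d k] by (metis gr0I mult_pos_pos not_le power_0_left zero_less_numeral)

definition iso_const :: "nat \<Rightarrow> nat" where
  "iso_const d = 2 * d * 3 ^ d"

definition perim_const :: "nat \<Rightarrow> nat" where
  "perim_const d = 2 ^ (d + 1) * iso_const d"

lemma iso_cube_side:
  fixes A :: "(int ^ 'd::finite) set"
  assumes "A \<subseteq> grid t" "card A \<le> k" "2 * k \<le> t ^ CARD('d)"
  shows "card A \<le> iso_const CARD('d) * cube_side CARD('d) k * card (bdry t A)"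
  unfolding iso_const_def using cube_side_ge[of "CARD('d)" k] assms
  by (intro isoperimetry[OF assms(1)] cube_side_le) auto

text \<open>Here \<open>cube_side d k ^ (d - 1)\<close> plays the role of k^((d-1)/d). As long as
  all members have at most k points, isoperimetry holds with one common side and can be summed over
  the family; a member with more than k points suffices alone.\<close>

lemma perimeter_bound:
  fixes F :: "(int ^ 'd::finite) set set"
  assumes F: "finite F" "\<And>A. A \<in> F \<Longrightarrow> A \<subseteq> grid t" "\<And>A. A \<in> F \<Longrightarrow> 2 * card A \<le> t ^ CARD('d)"
    and k: "0 < k" "2 * k \<le> t ^ CARD('d)" "k \<le> (\<Sum>A\<in>F. card A)"
  shows "cube_side CARD('d) k ^ (CARD('d) - 1) \<le> perim_const CARD('d) * (\<Sum>A\<in>F. card (bdry t A))"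
proof -
  let ?d = "CARD('d)"
  have d: "?d > 0" by simp
  have main: "cube_side ?d k ^ (?d - 1) \<le> perim_const ?d * (\<Sum>A\<in>F. card (bdry t A))"
    if F: "finite F" "\<And>A. A \<in> F \<Longrightarrow> A \<subseteq> grid t" "\<And>A. A \<in> F \<Longrightarrow> card A \<le> k"
      and k: "0 < k" "2 * k \<le> t ^ ?d" "k \<le> (\<Sum>A\<in>F. card A)" for F :: "(int ^ 'd) set set" and k
  proof -
    let ?l = "cube_side ?d k"
    have "k \<le> (\<Sum>A\<in>F. card A)" by (rule k)
    also have "\<dots> \<le> (\<Sum>A\<in>F. iso_const ?d * ?l * card (bdry t A))"
      using F k by (intro sum_mono iso_cube_side) auto
    finally have 1: "k \<le> iso_const ?d * ?l * (\<Sum>A\<in>F. card (bdry t A))" by (simp add: sum_distrib_left)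
    have "?l * ?l ^ (?d - 1) = ?l ^ ?d" by (metis d power_eq_if less_irrefl mult.commute)
    also have "\<dots> \<le> 2 ^ (?d + 1) * k" by (rule cube_side_upper[OF d k(1)])
    also have "\<dots> \<le> 2 ^ (?d + 1) * (iso_const ?d * ?l * (\<Sum>A\<in>F. card (bdry t A)))" using 1 by (intro mult_left_mono) auto
    also have "\<dots> = ?l * (perim_const ?d * (\<Sum>A\<in>F. card (bdry t A)))" by (simp add: perim_const_def)
    finally show ?thesis using cube_side_pos[OF d k(1)] by simp
  qed
  show ?thesis
  proof (cases "\<forall>A\<in>F. card A \<le> k")
    case True then show ?thesis using main[of F k] F k by blast
  next
    case False
    then obtain A where A: "A \<in> F" "k < card A" by auto
    have "cube_side ?d k \<le> cube_side ?d (card A)"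
      using A cube_side_ge[OF d, of "card A"] by (intro cube_side_le) linarith
    then have "cube_side ?d k ^ (?d - 1) \<le> cube_side ?d (card A) ^ (?d - 1)" by (intro power_mono) auto
    also have "\<dots> \<le> perim_const ?d * (\<Sum>A\<in>{A}. card (bdry t A))"
      using F(2,3)[OF A(1)] A(2) by (intro main[of "{A}"]) auto
    also have "\<dots> \<le> perim_const ?d * (\<Sum>A\<in>F. card (bdry t A))"
      using A F(1) by (intro mult_left_mono sum_mono2) auto
    finally show ?thesis .
  qed
qed

text \<open>A cube of this side containing Y has more points than A, so it meets A and its
  complement; being connected, it contains a boundary edge. This edge serves as the root when
  contours through Y are counted.\<close>

lemma contour_near_edge:
  fixes A :: "(int ^ 'd::finite) set"
  assumes A: "A \<in> contours t" and Y: "Y \<in> A"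
  shows "\<exists>e\<in>bdry t A. sup_norm (fst e - Y) \<le> cube_side CARD('d) (card A)"
proof -
  let ?d = "CARD('d)" let ?l = "cube_side ?d (card A)"
  have A': "A \<subseteq> grid t" "2 * card A \<le> t ^ ?d" using A by (auto simp: contours_def)
  have finA: "finite A" by (rule finite_subset[OF A'(1) finite_grid])
  have cA: "card A > 0" using Y finA card_gt_0_iff by blast
  have l: "?l \<le> t" "1 \<le> ?l" using cube_side_le[OF A'(2)] cube_side_pos[of ?d "card A"] cA by auto
  obtain a b where ab: "Y \<in> int_box a b" "int_box a b \<subseteq> grid t" "card (int_box a b) = ?l ^ ?d"
      "\<And>y. y \<in> int_box a b \<Longrightarrow> sup_norm (y - Y) \<le> ?l"
    using grid_subcube[of Y t ?l] l Y A' by blast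
  have "card A < card (int_box a b)" using ab(3) cube_side_ge[of ?d "card A"] cA by simp
  then have "\<not> int_box a b \<subseteq> A" using card_mono[OF finA, of "int_box a b"] by auto
  then have "A \<inter> int_box a b \<noteq> int_box a b" "A \<inter> int_box a b \<noteq> {}" using ab Y by blast+
  then obtain u v where uv: "u \<in> A \<inter> int_box a b" "v \<in> int_box a b" "v \<notin> A \<inter> int_box a b" "neighbours u v"
    using cut_connectedD[OF cut_connected_neighbours_int_box[of a b], of "A \<inter> int_box a b"] by blast
  obtain e where e: "e \<in> bdry t A" "fst e = u \<or> fst e = v"
    using bdryI[of u A v t] uv A' ab(2) by (metis DiffI IntE IntI fst_conv subsetD)
  then show ?thesis using ab(4) uv by blast
qed

text \<open>The symmetric difference has no boundary, so it is empty or the whole grid, and the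
  common point Y excludes the latter.\<close>

lemma bdry_inj:
  assumes "A \<subseteq> grid t" "A' \<subseteq> grid t" "Y \<in> A" "Y \<in> A'" "bdry t A = bdry t A'"
  shows "A = A'"
proof (rule ccontr)
  assume ne: "A \<noteq> A'"
  let ?D = "{x\<in>grid t. (x \<in> A) \<noteq> (x \<in> A')}"
  have "?D \<noteq> {}" "?D \<noteq> grid t" using assms ne by blast+
  then obtain u v where uv: "u \<in> ?D" "v \<in> grid t" "v \<notin> ?D" "neighbours u v"
    using cut_connectedD[OF cut_connected_neighbours_grid[of t], of ?D] by blast
  then obtain i where "v = u + unit i \<or> u = v + unit i" by (auto simp: neighbours_def)
  then show False
  proof
    assume v: "v = u + unit i"
    have "(u, i) \<in> bdry t A \<longleftrightarrow> (u, i) \<in> bdry t A'" using assms by simp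
    then show False using uv v by (auto simp: bdry_def)
  next
    assume v: "u = v + unit i"
    have "(v, i) \<in> bdry t A \<longleftrightarrow> (v, i) \<in> bdry t A'" using assms by simp
    then show False using uv v by (auto simp: bdry_def)
  qed
qed

text \<open>A Peierls sum with a bound linear in z. The boundary, of size m, is rooted at an edge
  near Y, at distance at most a constant times m. Of the weight z^m, a part \<eta>^m pays for the
  connected edge sets containing the root, a part exp(-m) pays for the position of the root, and one
  factor y proportional to z is left over.\<close>

lemma contour_sum:
  assumes d2: "CARD('d::finite) \<ge> 2"
  shows "\<exists>C>0::real. \<forall>z t (Y :: int ^ 'd). 0 \<le> z \<longrightarrow> C * z \<le> 1 \<longrightarrow>
    (\<Sum>A\<in>{A\<in>contours t. Y \<in> A}. z ^ card (bdry t A)) \<le> C * z"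
proof -
  let ?d = "CARD('d)"
  define \<Delta> where "\<Delta> = 3 ^ ?d * ?d"
  define c where "c = real (perim_const ?d)"
  have "perim_const ?d > 0" by (simp add: perim_const_def iso_const_def)
  then have c0: "c \<ge> 1" by (simp add: c_def)
  have "\<Delta> > 0" by (simp add: \<Delta>_def)
  then have \<Delta>0: "\<Delta> \<ge> 1" by simp
  define \<eta> where "\<eta> = 1 / (exp 1 * real \<Delta>)"
  have \<eta>0: "\<eta> > 0" "\<eta> * exp 1 * real \<Delta> \<le> 1" "\<eta> * exp 1 \<le> 1" using \<Delta>0 by (auto simp: \<eta>_def field_simps)
  \<comment> \<open>The one-dimensional factor of a majorant for
    \<open>exp (- (sup_norm v / c))\<close>: the product over the coordinates is the exponential of
    \<open>- norm1 v / (d * c)\<close>, and the l1 norm is at most d times the sup norm.\<close>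
  define h where "h n = exp (- (1 / (?d * c))) ^ n" for n :: nat
  have h0: "0 \<le> h n" for n by (simp add: h_def)
  have hs: "summable h" unfolding h_def using c0 by (intro summable_geometric) auto
  define S where "S = real ?d * (2 * suminf h) ^ ?d"
  have S0: "S \<ge> 0" unfolding S_def using suminf_nonneg[OF hs h0] by simp
  define C where "C = exp 1 * exp 1 * real \<Delta> * (1 + S)"
  have C0: "C > 0" using S0 \<Delta>0 unfolding C_def by (intro mult_pos_pos) auto
  have hexp: "exp (- (real (sup_norm v) / c)) \<le> (\<Prod>i\<in>UNIV. h (nat \<bar>v $ i\<bar>))" for v :: "int ^ 'd"
  proof -
    have hx: "h n = exp (- (real n / (?d * c)))" for n
      by (simp add: h_def flip: exp_of_nat_mult)
    have "real (norm1 v) \<le> real ?d * real (sup_norm v)" using norm1_le[of v] by (simp flip: of_nat_mult)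
    then have "real (norm1 v) / (?d * c) \<le> real (sup_norm v) / c" using c0 by (simp add: field_simps)
    moreover have "(\<Prod>i\<in>UNIV. h (nat \<bar>v $ i\<bar>)) = exp (- (real (norm1 v) / (?d * c)))"
      unfolding hx exp_sum[symmetric, OF finite] by (simp add: norm1_def sum_negf sum_divide_distrib)
    ultimately show ?thesis by simp
  qed
  have "(\<Sum>A\<in>{A\<in>contours t. Y \<in> A}. z ^ card (bdry t A)) \<le> C * z"
    if z: "0 \<le> z" "C * z \<le> 1" for z t and Y :: "int ^ 'd"
  proof -
    let ?\<C> = "{A\<in>contours t. Y \<in> A}"
    let ?E = "(grid t :: (int ^ 'd) set) \<times> (UNIV :: 'd set)"
    define y where "y = z * (exp 1 * exp 1 * real \<Delta>)"
    have y: "0 \<le> y" "y \<le> 1" "z = \<eta> * exp (- 1) * y"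
    proof -
      show "0 \<le> y" using z by (simp add: y_def)
      have "C * z = y + y * S" by (simp add: C_def y_def algebra_simps)
      then show "y \<le> 1" using z S0 \<open>0 \<le> y\<close> by (smt (verit) mult_nonneg_nonneg)
      show "z = \<eta> * exp (- 1) * y" using \<Delta>0 by (simp add: \<eta>_def y_def exp_minus field_simps)
    qed
    define g where "g A e = y * exp (- (real (sup_norm (fst e - Y)) / c)) * \<eta> ^ card (bdry t A)" for A :: "(int ^ 'd) set" and e :: "(int ^ 'd) \<times> 'd"
    have g0: "0 \<le> g A e" for A e using y \<eta>0 by (simp add: g_def)
    have "(\<Sum>A\<in>?\<C>. z ^ card (bdry t A)) \<le> (\<Sum>A\<in>?\<C>. \<Sum>e\<in>{e\<in>?E. e \<in> bdry t A}. g A e)"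
    proof (rule sum_mono)
      fix A assume A: "A \<in> ?\<C>"
      obtain e where e: "e \<in> bdry t A" "sup_norm (fst e - Y) \<le> cube_side ?d (card A)"
        using contour_near_edge[of A t Y] A by blast
      let ?m = "card (bdry t A)"
      have m1: "?m \<ge> 1" using e by (simp add: Suc_le_eq card_gt_0_iff) blast
      have finA: "finite A" using A finite_subset[OF _ finite_grid] by (auto simp: contours_def)
      have cA: "card A > 0" using A finA card_gt_0_iff by blast
      \<comment> \<open>Here d \<ge> 2 enters: the side is at most its power d - 1, which is
        controlled by the perimeter.\<close>
      have "cube_side ?d (card A) \<le> cube_side ?d (card A) ^ (?d - 1)"
        using d2 cube_side_pos[of ?d "card A"] cA by (intro self_le_power) auto
      also have "\<dots> \<le> perim_const ?d * (\<Sum>A\<in>{A}. card (bdry t A))"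
        using A cA by (intro perimeter_bound) (auto simp: contours_def)
      finally have "real (sup_norm (fst e - Y)) \<le> c * real ?m"
        using e by (simp add: c_def flip: of_nat_mult)
      then have le: "real (sup_norm (fst e - Y)) / c \<le> real ?m" using c0 by (simp add: field_simps)
      have "z ^ ?m = (y ^ ?m * exp (- 1) ^ ?m) * \<eta> ^ ?m" by (simp add: y(3) power_mult_distrib)
      also have "\<dots> \<le> (y * exp (- (real (sup_norm (fst e - Y)) / c))) * \<eta> ^ ?m"
      proof (intro mult_right_mono mult_mono)
        show "y ^ ?m \<le> y" using y m1 power_decreasing[of 1 ?m y] by simp
        show "exp (- 1) ^ ?m \<le> exp (- (real (sup_norm (fst e - Y)) / c))"
          using le by (simp flip: exp_of_nat_mult)
      qed (use y \<eta>0 in auto)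
      also have "\<dots> = g A e" by (simp add: g_def)
      also have "\<dots> \<le> (\<Sum>e\<in>{e\<in>?E. e \<in> bdry t A}. g A e)"
        using e g0 bdry_subset[of t A] by (intro member_le_sum) auto
      finally show "z ^ ?m \<le> (\<Sum>e\<in>{e\<in>?E. e \<in> bdry t A}. g A e)" .
    qed
    also have "\<dots> = (\<Sum>e\<in>?E. \<Sum>A\<in>{A\<in>?\<C>. e \<in> bdry t A}. g A e)"
      by (rule sum.swap_restrict) auto
    also have "\<dots> \<le> (\<Sum>e\<in>?E. y * exp (- (real (sup_norm (fst e - Y)) / c)))"
    proof (rule sum_mono)
      fix e assume e: "e \<in> ?E"
      let ?S = "{A\<in>?\<C>. e \<in> bdry t A}"
      \<comment> \<open>Contours may be replaced by their boundaries because all of them contain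
        Y.\<close>
      have "inj_on (bdry t) ?S"
      proof (rule inj_onI)
        fix A A' assume "A \<in> ?S" "A' \<in> ?S" "bdry t A = bdry t A'"
        then show "A = A'" by (intro bdry_inj[of A t A' Y]) (simp_all add: contours_def)
      qed
      then have "(\<Sum>A\<in>?S. \<eta> ^ card (bdry t A)) = (\<Sum>B\<in>bdry t ` ?S. \<eta> ^ card B)"
        by (subst sum.reindex) auto
      also have "\<dots> \<le> (\<Sum>B\<in>{B. B \<subseteq> ?E \<and> e \<in> B \<and> cut_connected sqadj B}. \<eta> ^ card B)"
        using \<eta>0 bdry_subset by (intro sum_mono2) (auto intro: finite_subset[of _ "Pow ?E"] simp: contours_def)
      also have "\<dots> \<le> \<eta> * exp 1"
        by (rule sum_cut_connected_sets_le[of _ _ \<Delta>]) (use \<eta>0 e sqadj_sym card_sqadj in \<open>auto simp: \<Delta>_def\<close>)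
      also have "\<dots> \<le> 1" by (rule \<eta>0)
      finally have le1: "(\<Sum>A\<in>?S. \<eta> ^ card (bdry t A)) \<le> 1" .
      have "(\<Sum>A\<in>?S. g A e) = y * exp (- (real (sup_norm (fst e - Y)) / c)) * (\<Sum>A\<in>?S. \<eta> ^ card (bdry t A))"
        by (simp add: g_def sum_distrib_left)
      also have "\<dots> \<le> y * exp (- (real (sup_norm (fst e - Y)) / c)) * 1"
        using y by (intro mult_left_mono le1) auto
      finally show "(\<Sum>A\<in>?S. g A e) \<le> y * exp (- (real (sup_norm (fst e - Y)) / c))" by simp
    qed
    also have "\<dots> = y * (\<Sum>e\<in>?E. exp (- (real (sup_norm (fst e - Y)) / c)))" by (simp add: sum_distrib_left)
    also have "(\<Sum>e\<in>?E. exp (- (real (sup_norm (fst e - Y)) / c))) = real ?d * (\<Sum>x\<in>grid t. exp (- (real (sup_norm (x - Y)) / c)))"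
      by (simp add: sum.cartesian_product' sum_distrib_left)
    also have "(\<Sum>x\<in>(grid t :: (int ^ 'd) set). exp (- (real (sup_norm (x - Y)) / c))) = (\<Sum>v\<in>(\<lambda>x. x - Y) ` grid t. exp (- (real (sup_norm v) / c)))"
      by (subst sum.reindex) (auto simp: inj_on_def)
    also have "\<dots> \<le> (\<Sum>v\<in>(\<lambda>x. x - Y) ` grid t. \<Prod>i\<in>UNIV. h (nat \<bar>v $ i\<bar>))"
      by (intro sum_mono hexp)
    also have "\<dots> \<le> (2 * suminf h) ^ ?d"
      by (rule sum_prod_nth_le[OF h0 hs]) simp
    finally have "(\<Sum>A\<in>?\<C>. z ^ card (bdry t A)) \<le> y * S"
      using y by (simp add: S_def mult_left_mono)
    also have "\<dots> \<le> C * z" using z by (simp add: C_def y_def algebra_simps)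
    finally show ?thesis .
  qed
  then show ?thesis by (intro exI[of _ C] conjI C0 allI impI)
qed

section \<open>Percolation on finitely many edges\<close>

abbreviation perc :: "'e set \<Rightarrow> ('e \<Rightarrow> real) \<Rightarrow> ('e \<Rightarrow> bool) pmf" where
  "perc E p \<equiv> Pi_pmf E False (\<lambda>e. bernoulli_pmf (p e))"

lemma prob_UN_le:
  assumes "finite I" "A \<subseteq> (\<Union>i\<in>I. B i)"
  shows "measure_pmf.prob P A \<le> (\<Sum>i\<in>I. measure_pmf.prob P (B i))"
proof -
  have "measure_pmf.prob P A \<le> measure_pmf.prob P (\<Union>i\<in>I. B i)"
    using assms by (intro measure_pmf.finite_measure_mono) auto
  also have "\<dots> \<le> (\<Sum>i\<in>I. measure_pmf.prob P (B i))"
    using assms by (intro measure_pmf.finite_measure_subadditive_finite) auto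
  finally show ?thesis .
qed

lemma prob_closed_open:
  assumes E: "finite E" and p: "\<And>e. e \<in> E \<Longrightarrow> 0 \<le> p e \<and> p e \<le> 1"
    and FT: "F \<subseteq> E" "T \<subseteq> E" "F \<inter> T = {}"
  shows "measure_pmf.prob (perc E p) {\<eta>. (\<forall>e\<in>F. \<not> \<eta> e) \<and> (\<forall>e\<in>T. \<eta> e)} =
    (\<Prod>e\<in>F. 1 - p e) * (\<Prod>e\<in>T. p e)"
proof -
  define B where "B e = (if e \<in> F then {False} else if e \<in> T then {True} else UNIV)" for e
  have "{\<eta>. (\<forall>e\<in>F. \<not> \<eta> e) \<and> (\<forall>e\<in>T. \<eta> e)} = Pi E B"
    using FT by (fastforce simp: B_def Pi_def split: if_splits)
  then have "measure_pmf.prob (perc E p) {\<eta>. (\<forall>e\<in>F. \<not> \<eta> e) \<and> (\<forall>e\<in>T. \<eta> e)} =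
    (\<Prod>e\<in>E. measure_pmf.prob (bernoulli_pmf (p e)) (B e))"
    by (simp add: measure_Pi_pmf_Pi[OF E])
  also have "\<dots> = (\<Prod>e\<in>E. (if e \<in> F then 1 - p e else 1) * (if e \<in> T then p e else 1))"
    using p FT by (intro prod.cong refl) (auto simp: B_def measure_pmf_single)
  also have "\<dots> = (\<Prod>e\<in>E. if e \<in> F then 1 - p e else 1) * (\<Prod>e\<in>E. if e \<in> T then p e else 1)"
    by (rule prod.distrib)
  also have "(\<Prod>e\<in>E. if e \<in> F then 1 - p e else 1) = (\<Prod>e\<in>F. 1 - p e)"
    using E FT by (simp add: prod.inter_restrict[symmetric] Int_absorb1)
  also have "(\<Prod>e\<in>E. if e \<in> T then p e else 1) = (\<Prod>e\<in>T. p e)"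
    using E FT by (simp add: prod.inter_restrict[symmetric] Int_absorb1)
  finally show ?thesis .
qed

text \<open>The event is covered by the cylinders over those finitely many patterns on E that
  satisfy Q. Only an upper bound is wanted, so measurability is checked for the cylinders instead of
  the event.\<close>

lemma PiM_bernoulli_le_perc:
  assumes E: "finite E" "E \<subseteq> I" and p: "\<And>e. e \<in> I \<Longrightarrow> 0 \<le> p e \<and> p e \<le> 1"
    and Q: "\<And>\<omega> \<omega>'. (\<And>e. e \<in> E \<Longrightarrow> \<omega> e = \<omega>' e) \<Longrightarrow> Q \<omega> = Q \<omega>'"
  shows "\<P>(\<omega> in PiM I (\<lambda>e. measure_pmf (bernoulli_pmf (p e))). Q \<omega>) \<le> measure_pmf.prob (perc E p) {\<eta>. Q \<eta>}"
proof -
  let ?M = "PiM I (\<lambda>e. measure_pmf (bernoulli_pmf (p e)))"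
  interpret product_prob_space "\<lambda>e. measure_pmf (bernoulli_pmf (p e))" I ..
  define H where "H = {\<eta>\<in>PiE_dflt E False (\<lambda>_. UNIV). Q \<eta>}"
  define Y where "Y \<eta> = {\<omega>\<in>space ?M. \<forall>e\<in>E. \<omega> e \<in> {\<eta> e}}" for \<eta> :: "'a \<Rightarrow> bool"
  have finH: "finite H" unfolding H_def using E by (auto intro!: finite_subset[OF _ finite_PiE_dflt[of E "\<lambda>_. UNIV"]])
  have Ysets: "Y \<eta> \<in> sets ?M" for \<eta>
  proof -
    have "Y \<eta> = prod_emb I (\<lambda>e. measure_pmf (bernoulli_pmf (p e))) E (PiE E (\<lambda>e. {\<eta> e}))"
      using E unfolding Y_def prod_emb_def by (auto simp: space_PiM Pi_iff)
    also have "\<dots> \<in> sets ?M" using E by (intro sets_PiM_I) auto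
    finally show ?thesis .
  qed
  have Ym: "measure ?M (Y \<eta>) = pmf (perc E p) \<eta>" if "\<eta> \<in> H" for \<eta>
  proof -
    have "emeasure ?M (Y \<eta>) = (\<Prod>e\<in>E. emeasure (measure_pmf (bernoulli_pmf (p e))) {\<eta> e})"
      unfolding Y_def using E by (intro emeasure_PiM_Collect) auto
    also have "\<dots> = ennreal (\<Prod>e\<in>E. pmf (bernoulli_pmf (p e)) (\<eta> e))"
      by (simp add: emeasure_pmf_single prod_ennreal)
    also have "(\<Prod>e\<in>E. pmf (bernoulli_pmf (p e)) (\<eta> e)) = pmf (perc E p) \<eta>"
      using that E by (subst pmf_Pi') (auto simp: H_def PiE_dflt_def)
    finally show ?thesis by (simp add: measure_def)
  qed
  have "{\<omega>\<in>space ?M. Q \<omega>} \<subseteq> (\<Union>\<eta>\<in>H. Y \<eta>)"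
  proof
    fix \<omega> assume w: "\<omega> \<in> {\<omega>\<in>space ?M. Q \<omega>}"
    define \<eta> where "\<eta> e = (if e \<in> E then \<omega> e else False)" for e
    have "Q \<eta>" using w Q[of \<omega> \<eta>] by (auto simp: \<eta>_def)
    then have "\<eta> \<in> H" by (auto simp: H_def PiE_dflt_def \<eta>_def)
    moreover have "\<omega> \<in> Y \<eta>" using w by (auto simp: Y_def \<eta>_def)
    ultimately show "\<omega> \<in> (\<Union>\<eta>\<in>H. Y \<eta>)" by blast
  qed
  then have "\<P>(\<omega> in ?M. Q \<omega>) \<le> measure ?M (\<Union>\<eta>\<in>H. Y \<eta>)"
    using finH Ysets by (intro P.finite_measure_mono) auto
  also have "\<dots> \<le> (\<Sum>\<eta>\<in>H. measure ?M (Y \<eta>))"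
    using finH Ysets by (intro P.finite_measure_subadditive_finite) auto
  also have "\<dots> = (\<Sum>\<eta>\<in>H. pmf (perc E p) \<eta>)" using Ym by simp
  also have "\<dots> = measure_pmf.prob (perc E p) H" using finH by (simp add: measure_measure_pmf_finite)
  also have "\<dots> \<le> measure_pmf.prob (perc E p) {\<eta>. Q \<eta>}"
    by (intro measure_pmf.finite_measure_mono) (auto simp: H_def)
  finally show ?thesis .
qed

text \<open>Union bound over all selections of one closed set per block. The selected sets lie in
  disjoint blocks, so probabilities factorise, and the sum over selections of products is the
  product of sums.\<close>

lemma prob_blocks_closed:
  assumes E: "finite E" and p: "\<And>e. e \<in> E \<Longrightarrow> 0 \<le> p e \<and> p e \<le> 1"
    and I: "finite I" and W: "\<And>i. i \<in> I \<Longrightarrow> finite (\<W> i)"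
    and c: "\<And>i w. i \<in> I \<Longrightarrow> w \<in> \<W> i \<Longrightarrow> c i w \<subseteq> Bl i" and Bl: "\<And>i. i \<in> I \<Longrightarrow> Bl i \<subseteq> E"
    and dis: "\<And>i j. i \<in> I \<Longrightarrow> j \<in> I \<Longrightarrow> i \<noteq> j \<Longrightarrow> Bl i \<inter> Bl j = {}"
    and T: "T \<subseteq> E" "\<And>i. i \<in> I \<Longrightarrow> Bl i \<inter> T = {}"
  shows "measure_pmf.prob (perc E p) {\<eta>. (\<forall>i\<in>I. \<exists>w\<in>\<W> i. \<forall>e\<in>c i w. \<not> \<eta> e) \<and> (\<forall>e\<in>T. \<eta> e)}
    \<le> (\<Prod>i\<in>I. \<Sum>w\<in>\<W> i. \<Prod>e\<in>c i w. 1 - p e) * (\<Prod>e\<in>T. p e)"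
proof -
  let ?P = "measure_pmf.prob (perc E p)"
  define F where "F f = (\<Union>i\<in>I. c i (f i))" for f
  have "?P {\<eta>. (\<forall>i\<in>I. \<exists>w\<in>\<W> i. \<forall>e\<in>c i w. \<not> \<eta> e) \<and> (\<forall>e\<in>T. \<eta> e)}
    \<le> (\<Sum>f\<in>PiE I \<W>. ?P {\<eta>. (\<forall>e\<in>F f. \<not> \<eta> e) \<and> (\<forall>e\<in>T. \<eta> e)})"
  proof (rule prob_UN_le)
    show "finite (PiE I \<W>)" using I W by (intro finite_PiE)
    show "{\<eta>. (\<forall>i\<in>I. \<exists>w\<in>\<W> i. \<forall>e\<in>c i w. \<not> \<eta> e) \<and> (\<forall>e\<in>T. \<eta> e)}
       \<subseteq> (\<Union>f\<in>PiE I \<W>. {\<eta>. (\<forall>e\<in>F f. \<not> \<eta> e) \<and> (\<forall>e\<in>T. \<eta> e)})"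
    proof
      fix \<eta> assume h: "\<eta> \<in> {\<eta>. (\<forall>i\<in>I. \<exists>w\<in>\<W> i. \<forall>e\<in>c i w. \<not> \<eta> e) \<and> (\<forall>e\<in>T. \<eta> e)}"
      then have "\<forall>i\<in>I. \<exists>w. w \<in> \<W> i \<and> (\<forall>e\<in>c i w. \<not> \<eta> e)" by blast
      then obtain f where f: "\<forall>i\<in>I. f i \<in> \<W> i \<and> (\<forall>e\<in>c i (f i). \<not> \<eta> e)" by (auto dest: bchoice)
      have "restrict f I \<in> PiE I \<W>" using f by auto
      moreover have "\<forall>e\<in>F (restrict f I). \<not> \<eta> e" using f by (auto simp: F_def)
      ultimately show "\<eta> \<in> (\<Union>f\<in>PiE I \<W>. {\<eta>. (\<forall>e\<in>F f. \<not> \<eta> e) \<and> (\<forall>e\<in>T. \<eta> e)})" using h by blast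
    qed
  qed
  also have "\<dots> = (\<Sum>f\<in>PiE I \<W>. (\<Prod>i\<in>I. \<Prod>e\<in>c i (f i). 1 - p e) * (\<Prod>e\<in>T. p e))"
  proof (rule sum.cong[OF refl])
    fix f assume f: "f \<in> PiE I \<W>"
    have cf: "c i (f i) \<subseteq> Bl i" if "i \<in> I" for i using c f that by auto
    have FE: "F f \<subseteq> E" "F f \<inter> T = {}" unfolding F_def using cf Bl T by blast+
    have "?P {\<eta>. (\<forall>e\<in>F f. \<not> \<eta> e) \<and> (\<forall>e\<in>T. \<eta> e)} = (\<Prod>e\<in>F f. 1 - p e) * (\<Prod>e\<in>T. p e)"
      using FE T by (intro prob_closed_open[OF E p]) auto
    also have "(\<Prod>e\<in>F f. 1 - p e) = (\<Prod>i\<in>I. \<Prod>e\<in>c i (f i). 1 - p e)"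
      unfolding F_def
    proof (rule prod.UNION_disjoint[OF I])
      show "\<forall>i\<in>I. finite (c i (f i))" using cf Bl E by (meson finite_subset)
      show "\<forall>i\<in>I. \<forall>j\<in>I. i \<noteq> j \<longrightarrow> c i (f i) \<inter> c j (f j) = {}" using cf dis by blast
    qed
    finally show "?P {\<eta>. (\<forall>e\<in>F f. \<not> \<eta> e) \<and> (\<forall>e\<in>T. \<eta> e)} = (\<Prod>i\<in>I. \<Prod>e\<in>c i (f i). 1 - p e) * (\<Prod>e\<in>T. p e)" .
  qed
  also have "\<dots> = (\<Prod>i\<in>I. \<Sum>w\<in>\<W> i. \<Prod>e\<in>c i w. 1 - p e) * (\<Prod>e\<in>T. p e)"
    using I W by (simp add: sum_distrib_right[symmetric] prod_sum_PiE)
  finally show ?thesis .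
qed

section \<open>Families of sets joined by open edges\<close>

definition link :: "('a \<Rightarrow> 'v set) \<Rightarrow> ('v set \<Rightarrow> bool) \<Rightarrow> 'a \<Rightarrow> 'a \<Rightarrow> bool" where
  "link \<beta> \<eta> A B \<longleftrightarrow> (\<exists>x\<in>\<beta> A. \<exists>y\<in>\<beta> B. \<eta> {x, y})"

text \<open>For disjoint sets this is the expected number of open edges between them. The difference
  is taken in view of overlapping sets: summed over all B, only edges leaving A are counted, as in
  \<open>link_weight_sum_le\<close>.\<close>

definition link_weight :: "('a \<Rightarrow> 'v set) \<Rightarrow> ('v set \<Rightarrow> real) \<Rightarrow> 'a \<Rightarrow> 'a \<Rightarrow> real" where
  "link_weight \<beta> p A B = (\<Sum>x\<in>\<beta> A. \<Sum>y\<in>\<beta> B - \<beta> A. p {x, y})"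

text \<open>The set T0 collects the edges already found open. In each layer one open edge is
  selected into every new u; it ends in \<open>\<beta> u\<close>, which no earlier edge meets, so
  the new edges differ from each other and from T0. In the end \<open>base\<close> is applied to all
  selected edges at once, and summing the products over the selections gives the layer
  weight.\<close>

lemma prob_layered_le:
  fixes P :: "('v set \<Rightarrow> bool) pmf" and \<beta> :: "'a \<Rightarrow> 'v set"
  assumes fin\<beta>: "\<And>A. finite (\<beta> A)" and p: "\<And>e. 0 \<le> p e" and c: "0 \<le> c"
    and base: "\<And>T. finite T \<Longrightarrow> T \<subseteq> \<T> \<Longrightarrow>
      measure_pmf.prob P {\<eta>. Bev \<eta> \<and> (\<forall>e\<in>T. \<eta> e)} \<le> c * (\<Prod>e\<in>T. p e)"
    and fin: "finite L" "finite R" and LR: "L \<inter> R = {}"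
    and dis: "\<And>A B. A \<in> L \<union> R \<Longrightarrow> B \<in> L \<union> R \<Longrightarrow> A \<noteq> B \<Longrightarrow> \<beta> A \<inter> \<beta> B = {}"
    and far: "\<And>A B x y. A \<in> L \<union> R \<Longrightarrow> B \<in> R \<Longrightarrow> A \<noteq> B \<Longrightarrow> x \<in> \<beta> A \<Longrightarrow> y \<in> \<beta> B \<Longrightarrow> {x, y} \<in> \<T>"
    and T0: "finite T0" "T0 \<subseteq> \<T>" "\<And>e A. e \<in> T0 \<Longrightarrow> A \<in> R \<Longrightarrow> e \<inter> \<beta> A = {}"
  shows "measure_pmf.prob P {\<eta>. Bev \<eta> \<and> (\<forall>e\<in>T0. \<eta> e) \<and> layered (link \<beta> \<eta>) h L R}
     \<le> c * (\<Prod>e\<in>T0. p e) * layer_weight (link_weight \<beta> p) h L R"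
  using fin LR dis far T0
proof (induction h arbitrary: L R T0)
  case 0
  show ?case
  proof (cases "R = {}")
    case True then show ?thesis using base[OF "0.prems"(6,7)] by simp
  next
    case False then show ?thesis by simp
  qed
next
  case (Suc h)
  let ?S = "\<lambda>u. SIGMA v:L. \<beta> v \<times> \<beta> u"
  \<comment> \<open>A selection records the predecessor v and both endpoints; \<open>ed\<close>
    forgets v.\<close>
  define ed :: "('a \<times> 'v \<times> 'v) \<Rightarrow> 'v set" where "ed = (\<lambda>(v, x, y). {x, y})"
  define G where "G L' f = {\<eta>. Bev \<eta> \<and> (\<forall>e\<in>T0 \<union> (ed \<circ> f) ` L'. \<eta> e) \<and> layered (link \<beta> \<eta>) h L' (R - L')}" for L' f
  let ?J = "link_weight \<beta> p"
  have K0: "0 \<le> layer_weight ?J h A B" for A B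
    by (rule layer_weight_nonneg) (auto simp: link_weight_def intro!: sum_nonneg p)
  have "measure_pmf.prob P {\<eta>. Bev \<eta> \<and> (\<forall>e\<in>T0. \<eta> e) \<and> layered (link \<beta> \<eta>) (Suc h) L R}
     \<le> (\<Sum>(L', f)\<in>(SIGMA L':Pow R. PiE L' ?S). measure_pmf.prob P (G L' f))"
    unfolding case_prod_unfold
  proof (rule prob_UN_le)
    show "finite (SIGMA L':Pow R. PiE L' ?S)"
      using Suc.prems(1,2) fin\<beta> by (intro finite_SigmaI finite_PiE) (auto dest: finite_subset)
    show "{\<eta>. Bev \<eta> \<and> (\<forall>e\<in>T0. \<eta> e) \<and> layered (link \<beta> \<eta>) (Suc h) L R}
      \<subseteq> (\<Union>i\<in>(SIGMA L':Pow R. PiE L' ?S). G (fst i) (snd i))"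
    proof
      fix \<eta> assume "\<eta> \<in> {\<eta>. Bev \<eta> \<and> (\<forall>e\<in>T0. \<eta> e) \<and> layered (link \<beta> \<eta>) (Suc h) L R}"
      then have h: "Bev \<eta>" "\<forall>e\<in>T0. \<eta> e" "layered (link \<beta> \<eta>) (Suc h) L R" by auto
      then obtain L' where L': "L' \<subseteq> R" "\<forall>u\<in>L'. \<exists>v\<in>L. link \<beta> \<eta> v u" "layered (link \<beta> \<eta>) h L' (R - L')" by auto
      have ex: "\<forall>u\<in>L'. \<exists>s. s \<in> ?S u \<and> \<eta> (ed s)"
      proof
        fix u assume "u \<in> L'"
        then obtain v x y where "v \<in> L" "x \<in> \<beta> v" "y \<in> \<beta> u" "\<eta> {x, y}" using L'(2) by (auto simp: link_def)
        then show "\<exists>s. s \<in> ?S u \<and> \<eta> (ed s)" by (intro exI[of _ "(v, x, y)"]) (auto simp: ed_def)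
      qed
      obtain f where f: "\<forall>u\<in>L'. f u \<in> ?S u \<and> \<eta> (ed (f u))" using bchoice[OF ex] by blast
      have "restrict f L' \<in> PiE L' ?S" using f by (intro restrict_PiE_iff[THEN iffD2]) blast
      moreover have "\<eta> \<in> G L' (restrict f L')" using h f L' by (auto simp: G_def)
      ultimately show "\<eta> \<in> (\<Union>i\<in>(SIGMA L':Pow R. PiE L' ?S). G (fst i) (snd i))" using L'(1)
        by (intro UN_I[of "(L', restrict f L')"]) auto
    qed
  qed
  also have "\<dots> = (\<Sum>L'\<in>Pow R. \<Sum>f\<in>PiE L' ?S. measure_pmf.prob P (G L' f))"
    using Suc.prems(1,2) fin\<beta> by (intro sum.Sigma[symmetric] ballI finite_PiE) (auto dest: finite_subset)
  also have "\<dots> \<le> (\<Sum>L'\<in>Pow R. c * (\<Prod>e\<in>T0. p e) * ((\<Prod>u\<in>L'. \<Sum>v\<in>L. ?J v u) * layer_weight ?J h L' (R - L')))"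
  proof (rule sum_mono)
    fix L' assume "L' \<in> Pow R"
    then have L': "L' \<subseteq> R" by simp
    have finL': "finite L'" using L' Suc.prems(2) finite_subset by blast
    have "(\<Sum>f\<in>PiE L' ?S. measure_pmf.prob P (G L' f)) \<le>
      (\<Sum>f\<in>PiE L' ?S. (c * (\<Prod>e\<in>T0. p e)) * layer_weight ?J h L' (R - L') * (\<Prod>u\<in>L'. p (ed (f u))))"
    proof (rule sum_mono)
      fix f assume f: "f \<in> PiE L' ?S"
      have fu: "\<exists>v x y. f u = (v, x, y) \<and> v \<in> L \<and> x \<in> \<beta> v \<and> y \<in> \<beta> u" if "u \<in> L'" for u
      proof -
        have "f u \<in> ?S u" using f that by (auto simp: PiE_def Pi_def)
        then show ?thesis by (cases "f u") auto
      qed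
      have sep: "\<beta> v \<inter> \<beta> u = {}" if "v \<in> L" "u \<in> R" for v u
        using Suc.prems(4)[of v u] Suc.prems(3) that by blast
      \<comment> \<open>The endpoint in the new layer tells the edges apart: it lies in no other set
        of that layer and in no set of the old one.\<close>
      have inj: "inj_on (ed \<circ> f) L'"
      proof (rule inj_onI, rule ccontr)
        fix u u' assume u: "u \<in> L'" "u' \<in> L'" "(ed \<circ> f) u = (ed \<circ> f) u'" "u \<noteq> u'"
        obtain v x y where 1: "f u = (v, x, y)" "v \<in> L" "x \<in> \<beta> v" "y \<in> \<beta> u" using fu[OF u(1)] by blast
        obtain v' x' y' where 2: "f u' = (v', x', y')" "v' \<in> L" "x' \<in> \<beta> v'" "y' \<in> \<beta> u'" using fu[OF u(2)] by blast
        have "{x, y} = {x', y'}" using u 1 2 by (simp add: ed_def)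
        moreover have "y \<noteq> y'" using Suc.prems(4)[of u u'] u 1 2 L' by blast
        moreover have "y \<noteq> x'" using sep[OF 2(2), of u] u 1 2 L' by blast
        ultimately show False by blast
      qed
      have T0dis: "T0 \<inter> (ed \<circ> f) ` L' = {}"
      proof (rule ccontr)
        assume "\<not> ?thesis"
        then obtain u where u: "u \<in> L'" "ed (f u) \<in> T0" by auto
        obtain v x y where 1: "f u = (v, x, y)" "y \<in> \<beta> u" using fu[OF u(1)] by blast
        have "ed (f u) \<inter> \<beta> u = {}" using Suc.prems(8)[OF u(2)] u(1) L' by blast
        then show False using 1 by (simp add: ed_def)
      qed
      have "measure_pmf.prob P (G L' f) \<le>
        c * (\<Prod>e\<in>T0 \<union> (ed \<circ> f) ` L'. p e) * layer_weight ?J h L' (R - L')"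
        unfolding G_def
      proof (rule Suc.IH)
        show "finite L'" "finite (R - L')" using finL' Suc.prems(2) by auto
        show "L' \<inter> (R - L') = {}" by blast
        show "\<beta> A \<inter> \<beta> B = {}" if "A \<in> L' \<union> (R - L')" "B \<in> L' \<union> (R - L')" "A \<noteq> B" for A B
          using Suc.prems(4)[of A B] that L' by blast
        show "{x, y} \<in> \<T>" if "A \<in> L' \<union> (R - L')" "B \<in> R - L'" "A \<noteq> B" "x \<in> \<beta> A" "y \<in> \<beta> B" for A B x y
          using Suc.prems(5)[of A B x y] that L' by blast
        show "finite (T0 \<union> (ed \<circ> f) ` L')" using Suc.prems(6) finL' by simp
        show "T0 \<union> (ed \<circ> f) ` L' \<subseteq> \<T>"
        proof
          fix e assume "e \<in> T0 \<union> (ed \<circ> f) ` L'"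
          then show "e \<in> \<T>"
          proof
            assume "e \<in> (ed \<circ> f) ` L'"
            then obtain u where u: "u \<in> L'" "e = ed (f u)" by auto
            obtain v x y where 1: "f u = (v, x, y)" "v \<in> L" "x \<in> \<beta> v" "y \<in> \<beta> u" using fu[OF u(1)] by blast
            show ?thesis using Suc.prems(5)[of v u x y] u 1 L' Suc.prems(3) by (auto simp: ed_def)
          qed (use Suc.prems(7) in blast)
        qed
        \<comment> \<open>The new edges run between L and L', so they avoid what is left of
          R.\<close>
        show "e \<inter> \<beta> A = {}" if "e \<in> T0 \<union> (ed \<circ> f) ` L'" "A \<in> R - L'" for e A
          using that(1)
        proof
          assume "e \<in> (ed \<circ> f) ` L'"
          then obtain u where u: "u \<in> L'" "e = ed (f u)" by auto
          obtain v x y where 1: "f u = (v, x, y)" "v \<in> L" "x \<in> \<beta> v" "y \<in> \<beta> u" using fu[OF u(1)] by blast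
          have "\<beta> v \<inter> \<beta> A = {}" "\<beta> u \<inter> \<beta> A = {}"
            using sep[OF 1(2)] Suc.prems(4)[of u A] that(2) u L' by blast+
          then show ?thesis using u 1 by (auto simp: ed_def)
        qed (use Suc.prems(8) that(2) in blast)
      qed
      also have "(\<Prod>e\<in>T0 \<union> (ed \<circ> f) ` L'. p e) = (\<Prod>e\<in>T0. p e) * (\<Prod>u\<in>L'. p (ed (f u)))"
        using Suc.prems(6) finL' T0dis by (subst prod.union_disjoint) (simp_all add: prod.reindex[OF inj] del: image_comp o_apply, simp add: o_def)
      finally show "measure_pmf.prob P (G L' f) \<le>
         (c * (\<Prod>e\<in>T0. p e)) * layer_weight ?J h L' (R - L') * (\<Prod>u\<in>L'. p (ed (f u)))"
        by (simp add: mult_ac)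
    qed
    also have "\<dots> = (c * (\<Prod>e\<in>T0. p e)) * layer_weight ?J h L' (R - L') * (\<Sum>f\<in>PiE L' ?S. \<Prod>u\<in>L'. p (ed (f u)))"
      by (simp add: sum_distrib_left)
    also have "(\<Sum>f\<in>PiE L' ?S. \<Prod>u\<in>L'. p (ed (f u))) = (\<Prod>u\<in>L'. \<Sum>s\<in>?S u. p (ed s))"
      using finL' Suc.prems(1) fin\<beta> by (intro prod_sum_PiE[symmetric]) auto
    also have "\<dots> = (\<Prod>u\<in>L'. \<Sum>v\<in>L. ?J v u)"
    proof (rule prod.cong[OF refl])
      fix u assume u: "u \<in> L'"
      have "(\<Sum>s\<in>?S u. p (ed s)) = (\<Sum>v\<in>L. \<Sum>xy\<in>\<beta> v \<times> \<beta> u. p (ed (v, xy)))"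
        using Suc.prems(1) fin\<beta> by (subst sum.Sigma) auto
      also have "\<dots> = (\<Sum>v\<in>L. ?J v u)"
      proof (rule sum.cong[OF refl])
        fix v assume v: "v \<in> L"
        have "\<beta> v \<inter> \<beta> u = {}" using Suc.prems(4)[of v u] Suc.prems(3) u v L' by blast
        then have "\<beta> u - \<beta> v = \<beta> u" by blast
        then show "(\<Sum>xy\<in>\<beta> v \<times> \<beta> u. p (ed (v, xy))) = ?J v u"
          by (simp add: link_weight_def ed_def sum.cartesian_product')
      qed
      finally show "(\<Sum>s\<in>?S u. p (ed s)) = (\<Sum>v\<in>L. ?J v u)" .
    qed
    finally show "(\<Sum>f\<in>PiE L' ?S. measure_pmf.prob P (G L' f)) \<le>
        c * (\<Prod>e\<in>T0. p e) * ((\<Prod>u\<in>L'. \<Sum>v\<in>L. ?J v u) * layer_weight ?J h L' (R - L'))"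
      by (simp add: mult_ac)
  qed
  also have "\<dots> = c * (\<Prod>e\<in>T0. p e) * layer_weight ?J (Suc h) L R"
    by (simp add: sum_distrib_left)
  finally show ?case .
qed

section \<open>Blocks, bad edges and their joint probability\<close>

definition block :: "'v set \<Rightarrow> ('v \<Rightarrow> 'x) \<Rightarrow> 'x set \<Rightarrow> 'v set" where
  "block \<Lambda> \<phi> A = {x\<in>\<Lambda>. \<phi> x \<in> A}"

definition block_pair :: "'v set \<Rightarrow> ('v \<Rightarrow> int ^ 'd) \<Rightarrow> (int ^ 'd::finite) \<times> 'd \<Rightarrow> 'v set" where
  "block_pair \<Lambda> \<phi> e = block \<Lambda> \<phi> {fst e, fst e + unit (snd e)}"

definition pairs :: "'v set \<Rightarrow> 'v set set" where
  "pairs U = {{x, y} | x y. x \<in> U \<and> y \<in> U \<and> x \<noteq> y}"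

definition cut_edges :: "'v set \<Rightarrow> 'v set \<Rightarrow> 'v set set" where
  "cut_edges U W = {{x, y} | x y. x \<in> W \<and> y \<in> U - W}"

definition cut_sets :: "'v set \<Rightarrow> 'v set set" where
  "cut_sets U = {W. W \<subseteq> U \<and> W \<noteq> {} \<and> W \<noteq> U}"

text \<open>Disconnectedness is written as the existence of a closed cut. This makes the event a
  union over W of events that prescribed edges are closed, the form required by
  \<open>prob_blocks_closed\<close>.\<close>

definition bad_edge :: "'v set \<Rightarrow> ('v \<Rightarrow> int ^ 'd) \<Rightarrow> ('v set \<Rightarrow> bool) \<Rightarrow> (int ^ 'd::finite) \<times> 'd \<Rightarrow> bool" where
  "bad_edge \<Lambda> \<phi> \<eta> e \<longleftrightarrow> (\<exists>W\<in>cut_sets (block_pair \<Lambda> \<phi> e). \<forall>e'\<in>cut_edges (block_pair \<Lambda> \<phi> e) W. \<not> \<eta> e')"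

text \<open>Such pairs lie in no pair of neighbouring blocks, so their states are independent of all
  bad edges.\<close>

definition far_pairs :: "'v set \<Rightarrow> ('v \<Rightarrow> int ^ 'd::finite) \<Rightarrow> 'v set set" where
  "far_pairs \<Lambda> \<phi> = {{x, y} | x y. x \<in> \<Lambda> \<and> y \<in> \<Lambda> \<and> \<phi> x \<noteq> \<phi> y \<and> \<not> neighbours (\<phi> x) (\<phi> y)}"

lemma finite_pairs: "finite U \<Longrightarrow> finite (pairs U)"
  by (rule finite_subset[of _ "Pow U"]) (auto simp: pairs_def)

lemma cut_edges_subset_pairs: "W \<subseteq> U \<Longrightarrow> cut_edges U W \<subseteq> pairs U"
  unfolding cut_edges_def pairs_def by blast

text \<open>Edges are classified by their direction i and the parity of their i-th coordinate.
  Distinct edges of one direction that share an endpoint are consecutive on a line and have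
  different parities. There are 2d classes, of which the largest is taken.\<close>

lemma matching_class:
  fixes M :: "((int ^ 'd::finite) \<times> 'd) set"
  assumes "finite M"
  obtains M' where "M' \<subseteq> M" "card M \<le> 2 * CARD('d) * card M'"
    "\<And>e e'. e \<in> M' \<Longrightarrow> e' \<in> M' \<Longrightarrow> e \<noteq> e' \<Longrightarrow>
       {fst e, fst e + unit (snd e)} \<inter> {fst e', fst e' + unit (snd e')} = {}"
proof -
  define cls where "cls e = (snd e, even (fst e $ snd e))" for e :: "(int ^ 'd) \<times> 'd"
  define N where "N c = {e\<in>M. cls e = c}" for c
  have "card M = card (\<Union>c\<in>UNIV. N c)" by (rule arg_cong[where f=card]) (auto simp: N_def)
  also have "\<dots> \<le> (\<Sum>c\<in>UNIV. card (N c))" by (rule card_UN_le) simp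
  also have "\<dots> \<le> (\<Sum>c\<in>(UNIV :: ('d \<times> bool) set). Max (range (\<lambda>c. card (N c))))" by (intro sum_mono) auto
  also have "\<dots> = 2 * CARD('d) * Max (range (\<lambda>c. card (N c)))" by (simp add: card_cartesian_product UNIV_Times_UNIV[symmetric] del: UNIV_Times_UNIV)
  finally have le: "card M \<le> 2 * CARD('d) * Max (range (\<lambda>c. card (N c)))" .
  have "Max (range (\<lambda>c. card (N c))) \<in> range (\<lambda>c. card (N c))" by (intro Max_in) auto
  then obtain c where c: "card (N c) = Max (range (\<lambda>c. card (N c)))" by (metis (no_types, lifting) rangeE)
  show thesis
  proof (rule that[of "N c"])
    show "N c \<subseteq> M" by (auto simp: N_def)
    show "card M \<le> 2 * CARD('d) * card (N c)" using le c by simp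
    fix e e' assume e: "e \<in> N c" "e' \<in> N c" "e \<noteq> e'"
    obtain x i where ex: "e = (x, i)" by (cases e)
    obtain y j where ey: "e' = (y, j)" by (cases e')
    have ij: "j = i" "even (x $ i) = even (y $ i)" using e by (auto simp: N_def cls_def ex ey)
    have "x \<noteq> y" using e ij by (auto simp: ex ey)
    moreover have "x \<noteq> y + unit i" "y \<noteq> x + unit i" using ij by auto
    ultimately show "{fst e, fst e + unit (snd e)} \<inter> {fst e', fst e' + unit (snd e')} = {}"
      by (auto simp: ex ey ij)
  qed
qed

text \<open>Bad edges sharing a block are dependent. Restricting to the subfamily of
  \<open>matching_class\<close> makes them independent, at the cost of a root of order 2d.\<close>

lemma prob_bad_edges_le:
  fixes \<phi> :: "'v \<Rightarrow> int ^ 'd::finite"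
  assumes \<Lambda>: "finite \<Lambda>" and p: "\<And>e. e \<in> pairs \<Lambda> \<Longrightarrow> 0 \<le> p e \<and> p e \<le> 1"
    and q: "0 \<le> q" "q \<le> 1"
    and M: "finite M" "\<And>e. e \<in> M \<Longrightarrow>
       (\<Sum>W\<in>cut_sets (block_pair \<Lambda> \<phi> e). \<Prod>e'\<in>cut_edges (block_pair \<Lambda> \<phi> e) W. 1 - p e') \<le> q"
    and T: "T \<subseteq> far_pairs \<Lambda> \<phi>"
  shows "measure_pmf.prob (perc (pairs \<Lambda>) p) {\<eta>. (\<forall>e\<in>M. bad_edge \<Lambda> \<phi> \<eta> e) \<and> (\<forall>e\<in>T. \<eta> e)}
    \<le> (q powr (1 / (2 * CARD('d)))) ^ card M * (\<Prod>e\<in>T. p e)"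
proof -
  let ?P = "measure_pmf.prob (perc (pairs \<Lambda>) p)" and ?U = "block_pair \<Lambda> \<phi>"
  obtain M' where M': "M' \<subseteq> M" "card M \<le> 2 * CARD('d) * card M'"
    "\<And>e e'. e \<in> M' \<Longrightarrow> e' \<in> M' \<Longrightarrow> e \<noteq> e' \<Longrightarrow>
       {fst e, fst e + unit (snd e)} \<inter> {fst e', fst e' + unit (snd e')} = {}"
    using matching_class[OF M(1)] by blast
  have finM': "finite M'" using M' M finite_subset by blast
  have Usub: "?U e \<subseteq> \<Lambda>" for e by (auto simp: block_pair_def block_def)
  have finU: "finite (?U e)" for e using Usub \<Lambda> finite_subset by blast
  have pU: "pairs (?U e) \<subseteq> pairs \<Lambda>" for e using Usub[of e] unfolding pairs_def by blast
  have TE: "T \<subseteq> pairs \<Lambda>" using T unfolding far_pairs_def pairs_def by blast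
  have T0: "0 \<le> (\<Prod>e\<in>T. p e)" using TE p by (intro prod_nonneg) blast
  have "?P {\<eta>. (\<forall>e\<in>M. bad_edge \<Lambda> \<phi> \<eta> e) \<and> (\<forall>e\<in>T. \<eta> e)} \<le>
     ?P {\<eta>. (\<forall>e\<in>M'. \<exists>W\<in>cut_sets (?U e). \<forall>e'\<in>cut_edges (?U e) W. \<not> \<eta> e') \<and> (\<forall>e\<in>T. \<eta> e)}"
    using M' by (intro measure_pmf.finite_measure_mono) (auto simp: bad_edge_def)
  also have "\<dots> \<le> (\<Prod>e\<in>M'. \<Sum>W\<in>cut_sets (?U e). \<Prod>e'\<in>cut_edges (?U e) W. 1 - p e') * (\<Prod>e\<in>T. p e)"
  proof (rule prob_blocks_closed[where Bl="\<lambda>e. pairs (?U e)"])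
    show "finite (pairs \<Lambda>)" by (rule finite_pairs[OF \<Lambda>])
    show "finite M'" by fact
    show "finite (cut_sets (?U e))" for e
      by (rule finite_subset[of _ "Pow (?U e)"]) (auto simp: cut_sets_def finU)
    show "cut_edges (?U e) W \<subseteq> pairs (?U e)" if "W \<in> cut_sets (?U e)" for e W
      using that by (intro cut_edges_subset_pairs) (auto simp: cut_sets_def)
    show "pairs (?U e) \<subseteq> pairs \<Lambda>" for e by (rule pU)
    show "T \<subseteq> pairs \<Lambda>" by fact
    show "pairs (?U e) \<inter> pairs (?U e') = {}" if "e \<in> M'" "e' \<in> M'" "e \<noteq> e'" for e e'
    proof -
      have "?U e \<inter> ?U e' = {}" using M'(3)[OF that] unfolding block_pair_def block_def by blast
      then show ?thesis unfolding pairs_def by (auto simp: doubleton_eq_iff)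
    qed
    \<comment> \<open>A pair inside a block pair has its endpoints over equal or neighbouring
      blocks, so it is not a far pair.\<close>
    show "pairs (?U e) \<inter> T = {}" for e
    proof -
      have "x = y \<or> neighbours x y" if "x \<in> {fst e, fst e + unit (snd e)}" "y \<in> {fst e, fst e + unit (snd e)}" for x y
        using that by (auto simp: neighbours_def)
      then have "\<phi> x = \<phi> y \<or> neighbours (\<phi> x) (\<phi> y)" if "x \<in> ?U e" "y \<in> ?U e" for x y
        using that unfolding block_pair_def block_def by blast
      then have c: "\<phi> x = \<phi> y \<or> neighbours (\<phi> x) (\<phi> y)" if "x \<in> ?U e" "y \<in> ?U e" for x y using that by blast
      show ?thesis
      proof (rule ccontr)
        assume "\<not> ?thesis"
        then obtain e' where e': "e' \<in> pairs (?U e)" "e' \<in> far_pairs \<Lambda> \<phi>" using T by blast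
        then obtain x y where "e' = {x, y}" "\<phi> x \<noteq> \<phi> y" "\<not> neighbours (\<phi> x) (\<phi> y)" unfolding far_pairs_def by blast
        moreover from this e'(1) have "x \<in> ?U e" "y \<in> ?U e" unfolding pairs_def by (auto simp: doubleton_eq_iff)
        ultimately show False using c by blast
      qed
    qed
  qed (use p in auto)
  also have "\<dots> \<le> (\<Prod>e\<in>M'. q) * (\<Prod>e\<in>T. p e)"
  proof (intro mult_right_mono T0 prod_mono conjI)
    fix e assume e: "e \<in> M'"
    show "0 \<le> (\<Sum>W\<in>cut_sets (?U e). \<Prod>e'\<in>cut_edges (?U e) W. 1 - p e')"
    proof (intro sum_nonneg prod_nonneg)
      fix W e' assume "W \<in> cut_sets (?U e)" "e' \<in> cut_edges (?U e) W"
      then have "e' \<in> pairs \<Lambda>" using cut_edges_subset_pairs[of W "?U e"] pU[of e] by (auto simp: cut_sets_def)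
      then show "0 \<le> 1 - p e'" using p by auto
    qed
    show "(\<Sum>W\<in>cut_sets (?U e). \<Prod>e'\<in>cut_edges (?U e) W. 1 - p e') \<le> q" using M(2) e M' by blast
  qed
  also have "\<dots> \<le> (q powr (1 / (2 * CARD('d)))) ^ card M * (\<Prod>e\<in>T. p e)"
  proof (intro mult_right_mono T0)
    show "(\<Prod>e\<in>M'. q) \<le> (q powr (1 / (2 * CARD('d)))) ^ card M"
    proof (cases "q = 0")
      case True
      show ?thesis
      proof (cases "card M = 0")
        case True then show ?thesis using q by (simp add: power_le_one)
      next
        case False then have "card M' \<noteq> 0" using M'(2) by (cases "card M' = 0") auto
        then show ?thesis using True by (simp add: zero_power)
      qed
    next
      case False
      then have q0: "q > 0" using q by simp
      have "real (card M) \<le> real (2 * CARD('d)) * real (card M')" using M'(2) by (simp flip: of_nat_mult)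
      then have le: "1 / (2 * CARD('d)) * card M \<le> card M'" by (simp add: field_simps)
      have "(\<Prod>e\<in>M'. q) = q powr (card M')" using q0 by (simp add: powr_realpow)
      also have "\<dots> \<le> q powr (1 / (2 * CARD('d)) * card M)" by (rule powr_mono'[OF le]) (use q in auto)
      also have "\<dots> = (q powr (1 / (2 * CARD('d)))) ^ card M"
        using q0 by (simp only: powr_powr[symmetric]) (simp add: powr_realpow)
      finally show ?thesis .
    qed
  qed
  finally show ?thesis .
qed

section \<open>A giant good cluster and chains of bad contours\<close>

lemma cut_connected_ex: "cut_connected adj A \<Longrightarrow> B \<subseteq> A \<Longrightarrow> B \<noteq> {} \<Longrightarrow> B \<noteq> A \<Longrightarrow> \<exists>x\<in>B. \<exists>y\<in>A - B. adj x y"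
  unfolding cut_connected_def by blast

definition good_adj :: "((int ^ 'd::finite) \<times> 'd \<Rightarrow> bool) \<Rightarrow> int ^ 'd \<Rightarrow> int ^ 'd \<Rightarrow> bool" where
  "good_adj b X Y \<longleftrightarrow> (\<exists>i. (Y = X + unit i \<and> \<not> b (X, i)) \<or> (X = Y + unit i \<and> \<not> b (Y, i)))"

definition bad_contours :: "((int ^ 'd::finite) \<times> 'd \<Rightarrow> bool) \<Rightarrow> nat \<Rightarrow> (int ^ 'd) set set" where
  "bad_contours b t = {A\<in>contours t. \<forall>e\<in>bdry t A. b e}"

lemma good_adj_sym: "good_adj b X Y \<Longrightarrow> good_adj b Y X"
  by (auto simp: good_adj_def)

lemma good_adj_neighbours: "good_adj b X Y \<Longrightarrow> neighbours X Y"
  by (auto simp: good_adj_def neighbours_def)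

text \<open>A hole borders only on K, and a good edge across its boundary would enlarge K.\<close>

lemma good_component_holes:
  fixes b :: "(int ^ 'd::finite) \<times> 'd \<Rightarrow> bool" and X Y :: "int ^ 'd"
  assumes X: "X \<in> grid t"
  defines "K \<equiv> conn_component (good_adj b) (grid t) X"
  assumes Y: "Y \<in> grid t - K"
  defines "B \<equiv> conn_component neighbours (grid t - K) Y"
  shows "B \<subseteq> grid t - K" "cut_connected neighbours B" "cut_connected neighbours (grid t - B)" "\<forall>e\<in>bdry t B. b e"
proof -
  have "X \<in> K" by (simp add: K_def)
  then have K: "K \<subseteq> grid t" "K \<noteq> {}" using conn_component_subset[OF X, of "good_adj b"] unfolding K_def by blast+
  have Kc: "cut_connected neighbours K" unfolding K_def
    by (rule cut_connected_mono[OF _ good_adj_neighbours], rule cut_connected_conn_component, erule good_adj_sym)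
  note cc = conn_component_complement[OF K Kc Y, folded B_def]
  show "B \<subseteq> grid t - K" "cut_connected neighbours B" "cut_connected neighbours (grid t - B)" using cc by auto
  show "\<forall>e\<in>bdry t B. b e"
  proof (intro ballI, rule ccontr)
    fix e assume e: "e \<in> bdry t B" "\<not> b e"
    obtain x i where ex: "e = (x, i)" by (cases e)
    have g: "x \<in> grid t" "x + unit i \<in> grid t" "(x \<in> B) \<noteq> (x + unit i \<in> B)" using e by (auto simp: bdry_def ex)
    have n: "neighbours x (x + unit i)" "neighbours (x + unit i) x" by (auto simp: neighbours_def)
    have ga: "good_adj b x (x + unit i)" "good_adj b (x + unit i) x" using e ex by (auto simp: good_adj_def)
    show False
    proof (cases "x \<in> B")
      case True
      then have "x + unit i \<in> K" using cc(4)[of x "x + unit i"] g n by blast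
      then have "x \<in> K" using conn_component_step[of "x + unit i" "good_adj b" "grid t" X x] ga g unfolding K_def by blast
      then show False using True cc(1) by blast
    next
      case False
      then have "x \<in> K" using cc(4)[of "x + unit i" x] g n by blast
      then have "x + unit i \<in> K" using conn_component_step[of x "good_adj b" "grid t" X "x + unit i"] ga g unfolding K_def by blast
      then show False using False g cc(1) by blast
    qed
  qed
qed

text \<open>
  If every good cluster \<open>K X\<close> had a hole \<open>B X\<close> filling more than half of the grid, then the sets
  \<open>A X = grid - B X\<close> would form a laminar family, whose maximal members are disjoint bad contours
  covering the whole grid.
\<close>

lemma good_giant:
  fixes b :: "(int ^ 'd::finite) \<times> 'd \<Rightarrow> bool"
  assumes small: "\<And>F. F \<subseteq> bad_contours b t \<Longrightarrow> disjoint F \<Longrightarrow> (\<Sum>A\<in>F. card A) < D"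
    and D: "D \<le> t ^ CARD('d)"
  shows "\<exists>K. K \<subseteq> grid t \<and> K \<noteq> {} \<and> cut_connected (good_adj b) K \<and> t ^ CARD('d) < card K + D"
proof -
  let ?G = "grid t :: (int ^ 'd) set" and ?N = "t ^ CARD('d)"
  have cG: "card ?G = ?N" by (rule card_grid)
  define K where "K X = conn_component (good_adj b) ?G X" for X
  have KG: "K X \<subseteq> ?G" if "X \<in> ?G" for X unfolding K_def by (rule conn_component_subset[OF that])
  have KX: "X \<in> K X" for X by (simp add: K_def)
  have Kg: "cut_connected (good_adj b) (K X)" for X unfolding K_def by (rule cut_connected_conn_component) (rule good_adj_sym)
  have Kn: "cut_connected neighbours (K X)" for X by (rule cut_connected_mono[OF Kg good_adj_neighbours])
  have Kdis: "K X \<inter> K Y = {}" if "K X \<noteq> K Y" for X Y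
    using that unfolding K_def by (intro conn_component_disjoint) (erule good_adj_sym)
  note holes = good_component_holes[where b=b and t=t, folded K_def]
  \<comment> \<open>It suffices to find a cluster none of whose holes fills more than half of the
    grid: its holes are then disjoint bad contours, so together they have fewer than D
    points.\<close>
  have "\<exists>X\<in>?G. \<forall>Y\<in>?G - K X. 2 * card (conn_component neighbours (?G - K X) Y) \<le> ?N"
  proof (rule ccontr)
    assume "\<not> ?thesis"
    then have ex: "\<forall>X\<in>?G. \<exists>Y. Y \<in> ?G - K X \<and> ?N < 2 * card (conn_component neighbours (?G - K X) Y)" by (auto simp: not_le)
    obtain y where y: "\<forall>X\<in>?G. y X \<in> ?G - K X \<and> ?N < 2 * card (conn_component neighbours (?G - K X) (y X))"
      using bchoice[OF ex] by (elim exE)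
    define B where "B X = conn_component neighbours (?G - K X) (y X)" for X
    define A where "A X = ?G - B X" for X
    have yG: "y X \<in> ?G - K X" if "X \<in> ?G" for X using y that by blast
    have Bbig: "?N < 2 * card (B X)" if "X \<in> ?G" for X using y that by (auto simp: B_def)
    have BG: "B X \<subseteq> ?G - K X" if "X \<in> ?G" for X using holes(1)[OF that yG[OF that]] by (simp add: B_def)
    have Bc: "cut_connected neighbours (B X)" if "X \<in> ?G" for X using holes(2)[OF that yG[OF that]] by (simp add: B_def)
    have Ac: "cut_connected neighbours (A X)" if "X \<in> ?G" for X using holes(3)[OF that yG[OF that]] by (simp add: B_def A_def)
    have Bb: "\<forall>e\<in>bdry t (B X). b e" if "X \<in> ?G" for X using holes(4)[OF that yG[OF that]] by (simp add: B_def)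
    have XA: "X \<in> A X" if "X \<in> ?G" for X using BG[OF that] KX that by (auto simp: A_def)
    have GA: "?G - A X = B X" if "X \<in> ?G" for X using BG[OF that] by (auto simp: A_def)
    have Abad: "A X \<in> bad_contours b t" if X: "X \<in> ?G" for X
    proof -
      have "card (A X) = ?N - card (B X)" unfolding A_def
        using BG[OF X] cG by (subst card_Diff_subset) (auto intro: finite_subset[OF _ finite_grid])
      then have "A X \<in> contours t" using Bbig[OF X] XA[OF X] Ac[OF X] Bc[OF X] GA[OF X]
        by (intro contoursI) (auto simp: A_def)
      moreover have "bdry t (A X) = bdry t (B X)" unfolding A_def by (rule bdry_Diff)
      ultimately show ?thesis using Bb[OF X] by (simp add: bad_contours_def)
    qed
    have meet: "B X \<inter> B Y \<noteq> {}" if "X \<in> ?G" "Y \<in> ?G" for X Y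
    proof
      assume "B X \<inter> B Y = {}"
      then have "card (B X) + card (B Y) = card (B X \<union> B Y)"
        using BG[OF that(1)] BG[OF that(2)] by (subst card_Un_disjoint) (auto intro: finite_subset[OF _ finite_grid])
      also have "\<dots> \<le> card ?G" using BG[OF that(1)] BG[OF that(2)] by (intro card_mono) auto
      finally show False using Bbig[OF that(1)] Bbig[OF that(2)] cG by simp
    qed
    have lam: "A X \<subseteq> A Y \<or> A Y \<subseteq> A X \<or> A X \<inter> A Y = {}" if X: "X \<in> ?G" and Y: "Y \<in> ?G" for X Y
    proof (cases "K X = K Y")
      case True
      have "B X = B Y"
      proof (rule ccontr)
        assume "B X \<noteq> B Y"
        then have "B X \<inter> B Y = {}" unfolding B_def True by (intro conn_component_disjoint) (erule neighbours_sym)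
        then show False using meet[OF X Y] by blast
      qed
      then show ?thesis by (simp add: A_def)
    next
      case False
      have dis: "K X \<inter> K Y = {}" using Kdis[OF False] .
      \<comment> \<open>If the cluster of Y' misses the big hole of X', that hole lies in a single
        component of the complement of this cluster. As two big holes always meet, this component is
        the big hole of Y'.\<close>
      have nest: "A Y' \<subseteq> A X'" if "X' \<in> ?G" "Y' \<in> ?G" "K Y' \<inter> B X' = {}" for X' Y'
      proof -
        have "B X' \<subseteq> B Y'" unfolding B_def[of Y']
        proof (rule cut_connected_subset_conn_component[OF Bc[OF that(1)]])
          show "B X' \<subseteq> ?G - K Y'" using BG[OF that(1)] that(3) by blast
          show "B X' \<inter> conn_component neighbours (?G - K Y') (y Y') \<noteq> {}" using meet[OF that(1,2)] by (simp add: B_def)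
        qed
        then show ?thesis by (auto simp: A_def)
      qed
      consider "K Y \<inter> B X = {}" | "K X \<inter> B Y = {}" | "K Y \<inter> B X \<noteq> {}" "K X \<inter> B Y \<noteq> {}" by blast
      then show ?thesis
      proof cases
        case 1 then show ?thesis using nest[OF X Y] by blast
      next
        case 2 then show ?thesis using nest[OF Y X] by blast
      next
        case 3
        \<comment> \<open>Now K Y lies inside the big hole of X, so A X avoids K Y. As A X is
          connected and meets the big hole of Y, it lies in that hole.\<close>
        have "K Y \<subseteq> B X" unfolding B_def
          by (rule cut_connected_subset_conn_component[OF Kn]) (use KG[OF Y] dis 3(1) in \<open>auto simp: B_def\<close>)
        then have "A X \<subseteq> ?G - K Y" by (auto simp: A_def)
        moreover have "A X \<inter> B Y \<noteq> {}" using 3(2) BG[OF X] KG[OF X] unfolding A_def by blast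
        ultimately have "A X \<subseteq> B Y" using cut_connected_subset_conn_component[OF Ac[OF X], of "?G - K Y" "y Y"] by (simp add: B_def)
        then show ?thesis by (auto simp: A_def)
      qed
    qed
    define F where "F = {A X | X. X \<in> ?G \<and> (\<forall>Z\<in>?G. A X \<subseteq> A Z \<longrightarrow> A X = A Z)}"
    have Fbad: "F \<subseteq> bad_contours b t" using Abad by (auto simp: F_def)
    have Fdis: "disjoint F"
    proof (rule disjointI)
      fix a a' assume "a \<in> F" "a' \<in> F" "a \<noteq> a'"
      then show "a \<inter> a' = {}" using lam unfolding F_def by blast
    qed
    have FU: "\<Union>F = ?G"
    proof
      show "\<Union>F \<subseteq> ?G" by (auto simp: F_def A_def)
      show "?G \<subseteq> \<Union>F"
      proof
        fix X assume X: "X \<in> ?G"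
        have "finite (A ` ?G)" "A X \<in> A ` ?G" using X by auto
        then obtain m where m: "m \<in> A ` ?G" "A X \<subseteq> m" "\<forall>c\<in>A ` ?G. m \<subseteq> c \<longrightarrow> m = c"
          using finite_has_maximal2[of "A ` ?G" "A X"] by metis
        then have "m \<in> F" unfolding F_def by blast
        then show "X \<in> \<Union>F" using m(2) XA[OF X] by blast
      qed
    qed
    have "(\<Sum>a\<in>F. card a) = card (\<Union>F)"
      using Fdis by (intro card_Union_disjoint[symmetric])
        (auto simp: F_def A_def disjoint_def pairwise_def disjnt_def intro: finite_subset[OF _ finite_grid])
    then show False using small[OF Fbad Fdis] FU cG D by simp
  qed
  then obtain X where X: "X \<in> ?G" "\<And>Y. Y \<in> ?G - K X \<Longrightarrow> 2 * card (conn_component neighbours (?G - K X) Y) \<le> ?N" by blast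
  define F where "F = conn_component neighbours (?G - K X) ` (?G - K X)"
  have Fbad: "F \<subseteq> bad_contours b t"
  proof
    fix B assume "B \<in> F"
    then obtain Y where Y: "Y \<in> ?G - K X" "B = conn_component neighbours (?G - K X) Y" by (auto simp: F_def)
    have "Y \<in> B" using Y(2) by simp
    then have "B \<noteq> {}" by blast
    then have "B \<in> contours t" using holes[OF X(1) Y(1)] X(2)[OF Y(1)] unfolding Y(2) by (intro contoursI) auto
    then show "B \<in> bad_contours b t" using holes(4)[OF X(1) Y(1)] by (simp add: bad_contours_def Y(2))
  qed
  have Fdis: "disjoint F"
  proof (rule disjointI)
    fix a a' assume "a \<in> F" "a' \<in> F" "a \<noteq> a'"
    then obtain Y Y' where "a = conn_component neighbours (?G - K X) Y" "a' = conn_component neighbours (?G - K X) Y'"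
      by (auto simp: F_def)
    then show "a \<inter> a' = {}" using conn_component_disjoint[of neighbours "?G - K X" Y Y', OF neighbours_sym] \<open>a \<noteq> a'\<close> by blast
  qed
  have FU: "\<Union>F = ?G - K X"
  proof
    show "\<Union>F \<subseteq> ?G - K X" using conn_component_subset[of _ "?G - K X" neighbours] unfolding F_def by blast
    show "?G - K X \<subseteq> \<Union>F" unfolding F_def by (rule subsetI, rule UN_I, assumption, rule conn_component_self)
  qed
  have "(\<Sum>a\<in>F. card a) = card (\<Union>F)"
  proof (rule card_Union_disjoint[symmetric])
    show "pairwise disjnt F" using Fdis by (auto simp: disjoint_def pairwise_def disjnt_def)
    show "finite a" if "a \<in> F" for a
    proof -
      have "a \<subseteq> ?G" using that Fbad by (auto simp: bad_contours_def contours_def)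
      then show ?thesis by (rule finite_subset) simp
    qed
  qed
  also have "\<dots> = ?N - card (K X)" unfolding FU using KG[OF X(1)] cG
    by (subst card_Diff_subset) (auto intro: finite_subset[OF _ finite_grid])
  finally have "?N < card (K X) + D" using small[OF Fbad Fdis] by simp
  then show ?thesis using KG[OF X(1)] KX Kg by blast
qed

section \<open>From a good cluster to linked bad contours\<close>

definition vadj :: "('v set \<Rightarrow> bool) \<Rightarrow> 'v \<Rightarrow> 'v \<Rightarrow> bool" where
  "vadj \<eta> x y \<longleftrightarrow> x \<noteq> y \<and> \<eta> {x, y}"

lemma vadj_sym: "vadj \<eta> x y \<Longrightarrow> vadj \<eta> y x"
proof -
  assume h: "vadj \<eta> x y"
  have "{y, x} = {x, y}" by blast
  then show ?thesis using h unfolding vadj_def by (simp only:) blast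
qed

lemma component_of_eq: "component_of \<eta> V x = conn_component (vadj \<eta>) V x"
  by (simp add: component_of_def conn_component_def induced_adj_def vadj_def)

lemma cut_connected_block_pair:
  assumes "\<not> bad_edge \<Lambda> \<phi> \<eta> e"
  shows "cut_connected (vadj \<eta>) (block_pair \<Lambda> \<phi> e)"
  unfolding cut_connected_def
proof (intro allI impI)
  fix W assume "W \<subseteq> block_pair \<Lambda> \<phi> e" "W \<noteq> {}" "W \<noteq> block_pair \<Lambda> \<phi> e"
  then have "W \<in> cut_sets (block_pair \<Lambda> \<phi> e)" by (simp add: cut_sets_def)
  then obtain e' where "e' \<in> cut_edges (block_pair \<Lambda> \<phi> e) W" "\<eta> e'" using assms unfolding bad_edge_def by blast
  moreover from this(1) obtain x y where xy: "e' = {x, y}" "x \<in> W" "y \<in> block_pair \<Lambda> \<phi> e - W"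
    by (auto simp: cut_edges_def)
  ultimately have "vadj \<eta> x y" by (auto simp: vadj_def)
  then show "\<exists>x\<in>W. \<exists>y\<in>block_pair \<Lambda> \<phi> e - W. vadj \<eta> x y" using xy(2,3) by (intro bexI)
qed

text \<open>A component with more than half of the vertices is the unique largest one, so the second
  largest is a different component. Positive size excludes the default value
  \<open>{}\<close>.\<close>

lemma second_largest_disjoint:
  assumes V: "finite V" and x0: "x0 \<in> V" and big: "card V < 2 * card (component_of \<eta> V x0)"
    and k: "0 < card (second_largest_component \<eta> V)"
  shows "\<exists>x\<in>V. second_largest_component \<eta> V = component_of \<eta> V x \<and>
     component_of \<eta> V x \<inter> component_of \<eta> V x0 = {}"
proof -
  let ?\<G> = "graph_components \<eta> V" and ?C0 = "component_of \<eta> V x0"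
  have sub: "C \<subseteq> V" if C: "C \<in> ?\<G>" for C
  proof -
    obtain x where "x \<in> V" "C = conn_component (vadj \<eta>) V x"
      using C unfolding graph_components_def component_of_eq by blast
    then show ?thesis using conn_component_subset by simp
  qed
  have bound: "\<forall>C. C \<in> ?\<G> \<longrightarrow> card C < Suc (card V)"
    by (intro allI impI le_imp_less_Suc card_mono[OF V] sub)
  have C0: "?C0 \<in> ?\<G>" using x0 by (simp add: graph_components_def)
  have dis: "C \<inter> C' = {}" if C: "C \<in> ?\<G>" "C' \<in> ?\<G>" "C \<noteq> C'" for C C'
  proof -
    obtain x x' where x: "C = conn_component (vadj \<eta>) V x" "C' = conn_component (vadj \<eta>) V x'"
      using C(1,2) unfolding graph_components_def component_of_eq by blast
    show ?thesis using C(3) unfolding x by (intro conn_component_disjoint) (erule vadj_sym)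
  qed
  let ?L = "largest_component \<eta> V"
  have L: "?L \<in> ?\<G> \<and> (\<forall>C. C \<in> ?\<G> \<longrightarrow> card C \<le> card ?L)"
    unfolding largest_component_def by (rule arg_max_nat_lemma[of "\<lambda>C. C \<in> ?\<G>", OF C0 bound])
  have LC: "?L = ?C0"
  proof (rule ccontr)
    assume ne: "?L \<noteq> ?C0"
    have LG: "?L \<in> ?\<G>" and le: "card ?C0 \<le> card ?L" using L C0 by blast+
    have "card ?L + card ?C0 = card (?L \<union> ?C0)"
      by (rule card_Un_disjoint[symmetric, OF finite_subset[OF sub[OF LG] V] finite_subset[OF sub[OF C0] V] dis[OF LG C0 ne]])
    also have "\<dots> \<le> card V" using sub[OF LG] sub[OF C0] by (intro card_mono V) simp
    finally show False using big le by linarith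
  qed
  let ?\<C> = "?\<G> - {?L}"
  have ne: "?\<C> \<noteq> {}" using k by (auto simp: second_largest_component_def Let_def)
  then obtain C1 where C1: "C1 \<in> ?\<C>" by blast
  have "second_largest_component \<eta> V = (ARG_MAX card C. C \<in> ?\<C>)" using ne by (simp add: second_largest_component_def Let_def)
  moreover have "(ARG_MAX card C. C \<in> ?\<C>) \<in> ?\<C>"
  proof (rule conjunct1[OF arg_max_nat_lemma[of "\<lambda>C. C \<in> ?\<C>", OF C1]])
    show "\<forall>C. C \<in> ?\<C> \<longrightarrow> card C < Suc (card V)" using bound by blast
  qed
  ultimately have "second_largest_component \<eta> V \<in> ?\<G>" "second_largest_component \<eta> V \<noteq> ?C0" using LC by auto
  then have d: "second_largest_component \<eta> V \<inter> ?C0 = {}" using dis[OF _ C0] by blast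
  obtain x where x: "x \<in> V" "second_largest_component \<eta> V = component_of \<eta> V x"
    using \<open>second_largest_component \<eta> V \<in> ?\<G>\<close> unfolding graph_components_def by blast
  show ?thesis using d unfolding x(2) by (intro bexI[OF _ x(1)] conjI refl)
qed

lemma card_block_le:
  assumes "finite A" "\<And>X. X \<in> A \<Longrightarrow> card (block \<Lambda> \<phi> {X}) \<le> m"
  shows "card (block \<Lambda> \<phi> A) \<le> m * card A"
proof -
  have "block \<Lambda> \<phi> A = (\<Union>X\<in>A. block \<Lambda> \<phi> {X})" by (auto simp: block_def)
  then have "card (block \<Lambda> \<phi> A) \<le> (\<Sum>X\<in>A. card (block \<Lambda> \<phi> {X}))"
    using card_UN_le[OF assms(1), of "\<lambda>X. block \<Lambda> \<phi> {X}"] by simp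
  also have "\<dots> \<le> m * card A" using sum_bounded_above[of A "\<lambda>X. card (block \<Lambda> \<phi> {X})" m] assms(2) by (simp add: mult.commute)
  finally show ?thesis .
qed

text \<open>More than disjointness: members do not even touch. Hence an edge between the blocks of
  two members is a far pair, which makes links independent of bad edges.\<close>

definition separated :: "(int ^ 'd::finite) set set \<Rightarrow> bool" where
  "separated F \<longleftrightarrow> (\<forall>A\<in>F. \<forall>B\<in>F. A \<noteq> B \<longrightarrow> (\<forall>x\<in>A. \<forall>y\<in>B. x \<noteq> y \<and> \<not> neighbours x y))"

text \<open>The deterministic half of the argument. Good edges glue the blocks of K into one vertex
  component, which has more than half of the vertices because fewer than D blocks of at most m
  points are missing. So the second largest component avoids the blocks of K. The factor m converts
  vertices into blocks.\<close>

lemma linked_bad_contours: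
  fixes \<phi> :: "'v \<Rightarrow> int ^ 'd::finite"
  assumes \<Lambda>: "finite \<Lambda>" "\<phi> ` \<Lambda> = grid t" and m: "\<And>X. card (block \<Lambda> \<phi> {X}) \<le> m"
    and K: "K \<subseteq> grid t" "cut_connected (good_adj (bad_edge \<Lambda> \<phi> \<eta>)) K" "t ^ CARD('d) < card K + D"
    and D: "2 * D \<le> t ^ CARD('d)" "2 * m * D \<le> card \<Lambda>" "3 \<le> t ^ CARD('d)"
    and k: "0 < k" "k \<le> card (second_largest_component \<eta> \<Lambda>)"
  shows "\<exists>F. F \<noteq> {} \<and> F \<subseteq> bad_contours (bad_edge \<Lambda> \<phi> \<eta>) t \<and> separated F \<and>
     cut_connected (link (block \<Lambda> \<phi>) \<eta>) F \<and> k \<le> m * (\<Sum>A\<in>F. card A)"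
proof -
  let ?G = "grid t :: (int ^ 'd) set" and ?N = "t ^ CARD('d)" and ?\<beta> = "block \<Lambda> \<phi>" and ?bad = "bad_edge \<Lambda> \<phi> \<eta>"
  have cG: "card ?G = ?N" by (rule card_grid)
  have finK: "finite K" by (rule finite_subset[OF K(1) finite_grid])
  have K2: "?N < 2 * card K" using K(3) D(1) by linarith
  have ne: "\<exists>x\<in>\<Lambda>. \<phi> x = X" if "X \<in> ?G" for X
  proof -
    have "X \<in> \<phi> ` \<Lambda>" using that \<Lambda>(2) by (simp only:)
    then show ?thesis by blast
  qed
  \<comment> \<open>K must contain a second block: the vertices of one block are known to be
    connected only through a good pair containing it.\<close>
  have "card K \<noteq> 0" "card K \<noteq> 1" using K2 D(3) by linarith+
  then have "K \<noteq> {}" by auto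
  then obtain X0 where X0K: "X0 \<in> K" by blast
  have "{X0} \<noteq> K" using \<open>card K \<noteq> 1\<close> by auto
  note X0 = X0K this
  obtain x0 where x0: "x0 \<in> \<Lambda>" "\<phi> x0 = X0" using ne X0(1) K(1) by blast
  define C0 where "C0 = conn_component (vadj \<eta>) \<Lambda> x0"
  have pair: "?\<beta> {X, Y} \<subseteq> C0" if ga: "good_adj ?bad X Y" and ne2: "?\<beta> {X, Y} \<inter> C0 \<noteq> {}" for X Y
  proof -
    obtain e where e: "\<not> ?bad e" "block_pair \<Lambda> \<phi> e = ?\<beta> {X, Y}"
    proof -
      from ga obtain i where "Y = X + unit i \<and> \<not> ?bad (X, i) \<or> X = Y + unit i \<and> \<not> ?bad (Y, i)"
        unfolding good_adj_def by blast
      then show thesis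
      proof
        assume "Y = X + unit i \<and> \<not> ?bad (X, i)"
        then show thesis by (intro that[of "(X, i)"]) (auto simp: block_pair_def)
      next
        assume h: "X = Y + unit i \<and> \<not> ?bad (Y, i)"
        then have "{fst (Y, i), fst (Y, i) + unit (snd (Y, i))} = {X, Y}" by auto
        then have "block_pair \<Lambda> \<phi> (Y, i) = ?\<beta> {X, Y}" unfolding block_pair_def by (rule arg_cong)
        with h show thesis by (intro that[of "(Y, i)"]) blast+
      qed
    qed
    have "cut_connected (vadj \<eta>) (?\<beta> {X, Y})" using cut_connected_block_pair[OF e(1)] e(2) by simp
    then show ?thesis using ne2 unfolding C0_def by (intro cut_connected_subset_conn_component) (auto simp: block_def)
  qed
  have KC: "?\<beta> K \<subseteq> C0"
  proof -
    define Z where "Z = {X\<in>K. ?\<beta> {X} \<subseteq> C0}"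
    have "\<exists>x\<in>{X0}. \<exists>y\<in>K - {X0}. good_adj ?bad x y" by (rule cut_connected_ex[OF K(2)]) (use X0 in simp_all)
    then obtain X1 where X1: "X1 \<in> K" "good_adj ?bad X0 X1" by blast
    have "x0 \<in> ?\<beta> {X0, X1} \<inter> C0" using x0 by (simp add: block_def C0_def)
    then have "?\<beta> {X0, X1} \<subseteq> C0" using pair[OF X1(2)] by blast
    then have X0Z: "X0 \<in> Z" using X0 by (auto simp: Z_def block_def)
    have "Z = K"
    proof (rule ccontr)
      assume "Z \<noteq> K"
      moreover have "Z \<subseteq> K" "Z \<noteq> {}" using X0Z by (auto simp: Z_def)
      ultimately have "\<exists>x\<in>Z. \<exists>y\<in>K - Z. good_adj ?bad x y" by (intro cut_connected_ex[OF K(2)])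
      then obtain X Y where XY: "X \<in> Z" "Y \<in> K" "Y \<notin> Z" "good_adj ?bad X Y" by blast
      have "X \<in> K" using XY(1) by (simp add: Z_def)
      then obtain x where x: "x \<in> \<Lambda>" "\<phi> x = X" using ne K(1) by blast
      then have "x \<in> ?\<beta> {X, Y} \<inter> C0" using XY(1) by (auto simp: Z_def block_def)
      then have "?\<beta> {X, Y} \<subseteq> C0" using pair[OF XY(4)] by blast
      then show False using XY by (auto simp: Z_def block_def)
    qed
    then show ?thesis by (auto simp: Z_def block_def)
  qed
  have C0sub: "C0 \<subseteq> \<Lambda>" unfolding C0_def by (rule conn_component_subset[OF x0(1)])
  have big: "card \<Lambda> < 2 * card C0"
  proof -
    have "\<Lambda> - C0 \<subseteq> ?\<beta> (?G - K)" using KC \<Lambda>(2) by (auto simp: block_def)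
    then have "card (\<Lambda> - C0) \<le> card (?\<beta> (?G - K))" using \<Lambda>(1) by (intro card_mono) (auto simp: block_def)
    also have "\<dots> \<le> m * card (?G - K)" using m by (intro card_block_le) auto
    finally have 1: "card (\<Lambda> - C0) \<le> m * card (?G - K)" .
    have "card K \<le> ?N" using card_mono[OF finite_grid K(1)] cG by simp
    then have "card (?G - K) < D" using K cG finK by (subst card_Diff_subset) auto
    have m0: "m > 0"
    proof -
      have "card (?\<beta> {X0}) > 0" using x0 \<Lambda>(1) by (auto simp: card_gt_0_iff block_def)
      then show ?thesis using m[of X0] by simp
    qed
    then have "m * card (?G - K) < m * D" using \<open>card (?G - K) < D\<close> by simp
    then have "2 * card (\<Lambda> - C0) < card \<Lambda>" using 1 D(2) by linarith
    moreover have "card (\<Lambda> - C0) = card \<Lambda> - card C0" using C0sub \<Lambda>(1) by (intro card_Diff_subset) (auto intro: finite_subset)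
    ultimately show ?thesis using card_mono[OF \<Lambda>(1) C0sub] by linarith
  qed
  have "\<exists>x\<in>\<Lambda>. second_largest_component \<eta> \<Lambda> = component_of \<eta> \<Lambda> x \<and>
      component_of \<eta> \<Lambda> x \<inter> component_of \<eta> \<Lambda> x0 = {}"
    by (rule second_largest_disjoint[OF \<Lambda>(1) x0(1)]) (use big k in \<open>simp_all add: component_of_eq C0_def\<close>)
  then obtain x1 where x1: "x1 \<in> \<Lambda>" "second_largest_component \<eta> \<Lambda> = conn_component (vadj \<eta>) \<Lambda> x1"
      "conn_component (vadj \<eta>) \<Lambda> x1 \<inter> C0 = {}"
    unfolding component_of_eq C0_def by (elim bexE conjE)
  define C where "C = conn_component (vadj \<eta>) \<Lambda> x1"
  have Csub: "C \<subseteq> \<Lambda>" unfolding C_def by (rule conn_component_subset[OF x1(1)])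
  have Cc: "cut_connected (vadj \<eta>) C" unfolding C_def by (rule cut_connected_conn_component) (rule vadj_sym)
  have Ccl: "y \<in> C" if "x \<in> C" "y \<in> \<Lambda>" "vadj \<eta> x y" for x y
    using conn_component_step[of x "vadj \<eta>" \<Lambda> x1 y] that Csub unfolding C_def by blast
  define S where "S = \<phi> ` C"
  have SG: "S \<subseteq> ?G" using Csub \<Lambda>(2) by (auto simp: S_def)
  have SK: "S \<inter> K = {}"
  proof (rule ccontr)
    assume "\<not> ?thesis"
    then obtain x where "x \<in> C" "\<phi> x \<in> K" by (auto simp: S_def)
    then have "x \<in> C0" using KC Csub by (auto simp: block_def)
    then show False using x1(3) \<open>x \<in> C\<close> by (auto simp: C_def)
  qed
  \<comment> \<open>Untouched blocks that are cut off from K are counted as part of the holes. This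
    makes the complement of the holes connected, hence their boundaries connected.\<close>
  define Dm where "Dm = conn_component neighbours (?G - S) X0"
  have X0GS: "X0 \<in> ?G - S" using X0 K(1) SK by blast
  have Dmsub: "Dm \<subseteq> ?G - S" unfolding Dm_def by (rule conn_component_subset[OF X0GS])
  have Dmc: "cut_connected neighbours Dm" unfolding Dm_def by (rule cut_connected_conn_component) (rule neighbours_sym)
  have KDm: "K \<subseteq> Dm" unfolding Dm_def
  proof (rule cut_connected_subset_conn_component)
    show "cut_connected neighbours K" by (rule cut_connected_mono[OF K(2) good_adj_neighbours])
    show "K \<subseteq> ?G - S" using K(1) SK by blast
    show "K \<inter> conn_component neighbours (?G - S) X0 \<noteq> {}" using X0 conn_component_self[of X0 neighbours "?G - S"] by blast
  qed
  have Dm: "Dm \<subseteq> ?G" "Dm \<noteq> {}" using Dmsub KDm X0 by blast+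
  have finDm: "finite Dm" by (rule finite_subset[OF Dm(1) finite_grid])
  have Dmbig: "?N < 2 * card Dm" using K2 card_mono[OF finDm KDm] by simp
  define cmp where "cmp Y = conn_component neighbours (?G - Dm) Y" for Y
  define F where "F = cmp ` (?G - Dm)"
  note cc = conn_component_complement[OF Dm Dmc, folded cmp_def]
  \<comment> \<open>A block next to \<open>Dm\<close> but outside it is touched by C, since
    otherwise it would belong to \<open>Dm\<close>.\<close>
  have touch: "x \<in> S" if "x \<in> ?G - Dm" "y \<in> Dm" "neighbours x y" for x y
  proof (rule ccontr)
    assume "x \<notin> S"
    then have "x \<in> Dm" using conn_component_step[of y neighbours "?G - S" X0 x] that Dmsub neighbours_sym[of x y] unfolding Dm_def by blast
    then show False using that by blast
  qed
  have FU: "\<Union>F = ?G - Dm"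
  proof
    show "\<Union>F \<subseteq> ?G - Dm" using cc(1) unfolding F_def by blast
    show "?G - Dm \<subseteq> \<Union>F" unfolding F_def cmp_def by (rule subsetI, rule UN_I, assumption, rule conn_component_self)
  qed
  have Fdisj: "A \<inter> B = {}" if AB: "A \<in> F" "B \<in> F" "A \<noteq> B" for A B
  proof -
    obtain Y Y' where Y: "A = conn_component neighbours (?G - Dm) Y" "B = conn_component neighbours (?G - Dm) Y'"
      using AB by (auto simp: F_def cmp_def)
    show ?thesis using AB(3) unfolding Y by (intro conn_component_disjoint) (erule neighbours_sym)
  qed
  have Fsub: "A \<subseteq> ?G - Dm" if "A \<in> F" for A using FU that by blast
  have Ftouch: "\<exists>x\<in>C. \<phi> x \<in> A" if AF: "A \<in> F" for A
  proof -
    obtain Y where Y: "Y \<in> ?G - Dm" "A = cmp Y" using AF by (auto simp: F_def)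
    from cc(5)[OF Y(1)] obtain x y where xy: "x \<in> cmp Y" "y \<in> Dm" "neighbours x y" by blast
    have "x \<in> ?G - Dm" using xy(1) cc(1)[OF Y(1)] by (rule subsetD[rotated])
    then have "x \<in> S" by (rule touch[OF _ xy(2,3)])
    then show ?thesis using xy(1) Y(2) by (auto simp: S_def)
  qed
  have Fbad: "F \<subseteq> bad_contours ?bad t"
  proof
    fix A assume AF: "A \<in> F"
    then obtain Y where Y: "Y \<in> ?G - Dm" "A = cmp Y" by (auto simp: F_def)
    have Asub: "A \<subseteq> ?G - Dm" using cc(1)[OF Y(1)] Y(2) by simp
    have "card A \<le> card (?G - Dm)" using Asub by (intro card_mono) auto
    also have "\<dots> = ?N - card Dm" using Dm cG finDm by (subst card_Diff_subset) auto
    finally have "2 * card A \<le> ?N" using Dmbig by linarith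
    moreover have "A \<noteq> {}" using Ftouch[OF AF] by blast
    ultimately have Ac: "A \<in> contours t" using cc(2,3)[OF Y(1)] Asub unfolding Y(2) by (intro contoursI) auto
    \<comment> \<open>Of the two blocks, one is touched by C and the other is not. The trace of C on
      the pair is thus nonempty and proper, and all edges leaving it are closed because C is a
      component.\<close>
    have bad1: "?bad e" if e: "e \<in> bdry t A" and uv: "u \<in> A" "v \<in> ?G - A" "neighbours u v" "{fst e, fst e + unit (snd e)} = {u, v}" for e u v
    proof -
      have v: "v \<in> Dm" using cc(4)[OF Y(1), of u v] uv Y(2) by blast
      have u: "u \<in> S" using touch[of u v] uv v Asub by blast
      have vS: "v \<notin> S" using v Dmsub by blast
      let ?U = "block_pair \<Lambda> \<phi> e"
      have U: "?U = ?\<beta> {u, v}" using uv(4) by (simp add: block_pair_def)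
      define W where "W = C \<inter> ?U"
      obtain x where x: "x \<in> C" "\<phi> x = u" using u by (auto simp: S_def)
      have "x \<in> W" using x Csub by (auto simp: W_def U block_def)
      obtain y where y: "y \<in> \<Lambda>" "\<phi> y = v" using ne v Dm by blast
      have "y \<in> ?U - W" using y vS by (auto simp: W_def U block_def S_def)
      then have "W \<in> cut_sets ?U" using \<open>x \<in> W\<close> by (auto simp: cut_sets_def W_def)
      moreover have "\<not> \<eta> e'" if e': "e' \<in> cut_edges ?U W" for e'
      proof
        assume "\<eta> e'"
        obtain a c where ac: "e' = {a, c}" "a \<in> W" "c \<in> ?U - W" using e' by (auto simp: cut_edges_def)
        then have "vadj \<eta> a c" using \<open>\<eta> e'\<close> by (auto simp: vadj_def)
        then have "c \<in> C" using Ccl[of a c] ac by (auto simp: W_def U block_def)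
        then show False using ac by (auto simp: W_def)
      qed
      ultimately show ?thesis unfolding bad_edge_def by blast
    qed
    have "?bad e" if e: "e \<in> bdry t A" for e
    proof -
      obtain x i where ex: "e = (x, i)" by (cases e)
      have g: "x \<in> ?G" "x + unit i \<in> ?G" "(x \<in> A) \<noteq> (x + unit i \<in> A)" using e by (auto simp: bdry_def ex)
      have n: "neighbours x (x + unit i)" "neighbours (x + unit i) x" by (auto simp: neighbours_def)
      show ?thesis
      proof (cases "x \<in> A")
        case True
        show ?thesis by (rule bad1[OF e True, of "x + unit i"]) (use g n True in \<open>simp_all add: ex\<close>)
      next
        case False
        then have A': "x + unit i \<in> A" using g by simp
        have "{fst e, fst e + unit (snd e)} = {x + unit i, x}" by (auto simp: ex)
        then show ?thesis by (intro bad1[OF e A', of x]) (use g n False in simp_all)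
      qed
    qed
    then show "A \<in> bad_contours ?bad t" using Ac by (simp add: bad_contours_def)
  qed
  have Fsep: "separated F" unfolding separated_def
  proof (intro ballI impI)
    fix A B x y assume AB: "A \<in> F" "B \<in> F" "A \<noteq> B" "x \<in> A" "y \<in> B"
    have "\<not> neighbours x y"
    proof
      assume n: "neighbours x y"
      obtain Y where Y: "Y \<in> ?G - Dm" "A = conn_component neighbours (?G - Dm) Y" using AB(1) by (auto simp: F_def cmp_def)
      have "x \<in> ?G - Dm" "y \<in> ?G - Dm" using Fsub AB by blast+
      then have "y \<in> A" using conn_component_step[of x neighbours "?G - Dm" Y y] n AB Y(2) by blast
      then show False using Fdisj[OF AB(1-3)] AB by blast
    qed
    then show "x \<noteq> y \<and> \<not> neighbours x y" using Fdisj[OF AB(1-3)] AB by blast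
  qed
  have Flink: "cut_connected (link ?\<beta> \<eta>) F" unfolding cut_connected_def
  proof (intro allI impI)
    fix F' assume F': "F' \<subseteq> F" "F' \<noteq> {}" "F' \<noteq> F"
    \<comment> \<open>This is a nonempty proper part of C because C touches every member of F. The
      open edge by which C leaves it is the required link.\<close>
    define W where "W = {x\<in>C. \<phi> x \<in> \<Union>F'}"
    obtain A where A: "A \<in> F'" using F' by blast
    obtain xa where xa: "xa \<in> C" "\<phi> xa \<in> A" using Ftouch A F' by blast
    obtain A' where A': "A' \<in> F" "A' \<notin> F'" using F' by blast
    obtain xb where xb: "xb \<in> C" "\<phi> xb \<in> A'" using Ftouch A' by blast
    have "xb \<notin> W" using xb Fdisj[of A'] A' F' unfolding W_def by blast
    moreover have "W \<subseteq> C" "W \<noteq> {}" using xa A by (auto simp: W_def)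
    ultimately have "\<exists>x\<in>W. \<exists>y\<in>C - W. vadj \<eta> x y" using xb(1) by (intro cut_connected_ex[OF Cc]) auto
    then obtain u v where uv: "u \<in> W" "v \<in> C" "v \<notin> W" "vadj \<eta> u v" by blast
    obtain A1 where A1: "A1 \<in> F'" "\<phi> u \<in> A1" using uv(1) by (auto simp: W_def)
    have "\<phi> v \<in> S" using uv(2) by (simp add: S_def)
    then have "\<phi> v \<in> ?G - Dm" using SG Dmsub by blast
    then obtain A2 where A2: "A2 \<in> F" "\<phi> v \<in> A2" using FU by blast
    have "A2 \<notin> F'" using uv(2,3) A2 by (auto simp: W_def)
    moreover have "link ?\<beta> \<eta> A1 A2"
      unfolding link_def using uv A1 A2 Csub by (auto simp: vadj_def block_def W_def)
    ultimately show "\<exists>x\<in>F'. \<exists>y\<in>F - F'. link ?\<beta> \<eta> x y" using A1 A2 by blast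
  qed
  have "C \<subseteq> ?\<beta> (?G - Dm)" using Csub Dmsub SG by (auto simp: block_def S_def)
  then have "card C \<le> card (?\<beta> (?G - Dm))" using \<Lambda>(1) by (intro card_mono) (auto simp: block_def)
  also have "\<dots> \<le> m * card (?G - Dm)" using m by (intro card_block_le) auto
  also have "card (?G - Dm) = (\<Sum>A\<in>F. card A)"
    unfolding FU[symmetric]
  proof (rule card_Union_disjoint)
    show "pairwise disjnt F" using Fdisj by (auto simp: pairwise_def disjnt_def)
    show "finite A" if "A \<in> F" for A using Fsub[OF that] finite_subset[OF _ finite_grid] by blast
  qed
  finally have "k \<le> m * (\<Sum>A\<in>F. card A)" using k x1(2) by (simp add: C_def)
  moreover have "F \<noteq> {}"
  proof -
    have "x1 \<in> C" by (simp add: C_def)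
    then have "\<phi> x1 \<in> ?G - Dm" using SG Dmsub by (auto simp: S_def)
    then show ?thesis by (auto simp: F_def)
  qed
  ultimately show ?thesis using Fbad Fsep Flink by blast
qed

section \<open>Union bounds over contours\<close>

text \<open>Markov's inequality for a weighted count of events.\<close>

lemma prob_le_weighted_sum:
  fixes P :: "'b pmf"
  assumes I: "finite I" and c: "\<And>i. i \<in> I \<Longrightarrow> 0 \<le> c i"
    and le: "\<And>x. x \<in> A \<Longrightarrow> 1 \<le> (\<Sum>i\<in>I. c i * indicator (B i) x)"
  shows "measure_pmf.prob P A \<le> (\<Sum>i\<in>I. c i * measure_pmf.prob P (B i))"
proof -
  have int: "integrable (measure_pmf P) (indicator S :: _ \<Rightarrow> real)" for S
    by (rule integrable_real_indicator) (auto simp: less_top[symmetric])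
  have "measure_pmf.prob P A = measure_pmf.expectation P (indicator A)" by simp
  also have "\<dots> \<le> measure_pmf.expectation P (\<lambda>x. \<Sum>i\<in>I. c i * indicator (B i) x)"
  proof (rule integral_mono)
    show "integrable (measure_pmf P) (\<lambda>x. \<Sum>i\<in>I. c i * indicator (B i) x :: real)"
      by (intro Bochner_Integration.integrable_sum integrable_mult_right int)
    show "indicator A x \<le> (\<Sum>i\<in>I. c i * indicator (B i) x :: real)" for x
      using le[of x] c by (auto simp: indicator_def intro!: sum_nonneg split: if_splits)
  qed (rule int)
  also have "\<dots> = (\<Sum>i\<in>I. c i * measure_pmf.prob P (B i))"
    by (simp add: Bochner_Integration.integral_sum int)
  finally show ?thesis .
qed

text \<open>The parameters: q bounds the probability of a bad edge, \<rho> is the price per boundary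
  edge of a contour, \<mu> the rate of decay to be extracted, s the total weight of the contours
  through a point, and H the expected number of open edges leaving a set per boundary edge. In the
  contour weight, exp(1) pays for attached links and exp(\<mu>) for the decay;
  \<open>s * H \<le> 1\<close> is the convergence criterion for the links.\<close>

locale coarse =
  fixes \<Lambda> :: "'v set" and \<phi> :: "'v \<Rightarrow> int ^ 'd::finite" and t :: nat
    and p :: "'v set \<Rightarrow> real" and q \<rho> \<mu> s H :: real
  assumes fin: "finite \<Lambda>" and onto: "\<phi> ` \<Lambda> = grid t"
    and p0: "\<And>e. 0 \<le> p e" and p1: "\<And>e. e \<in> pairs \<Lambda> \<Longrightarrow> p e \<le> 1"
    and q: "0 \<le> q" "q \<le> 1"
    and bad_prob: "\<And>x i. x \<in> grid t \<Longrightarrow> x + unit i \<in> grid t \<Longrightarrow>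
       (\<Sum>W\<in>cut_sets (block_pair \<Lambda> \<phi> (x, i)). \<Prod>e\<in>cut_edges (block_pair \<Lambda> \<phi> (x, i)) W. 1 - p e) \<le> q"
    and \<rho>: "0 \<le> \<rho>" "\<rho> \<le> 1" "q powr (1 / (2 * CARD('d))) \<le> \<rho>\<^sup>2"
    and \<mu>: "0 \<le> \<mu>"
    and s: "\<And>Y :: int ^ 'd. Y \<in> grid t \<Longrightarrow> (\<Sum>A\<in>{A\<in>contours t. Y \<in> A}. (\<rho> * exp (1 + \<mu>)) ^ card (bdry t A)) \<le> s"
    and H: "\<And>A. A \<subseteq> grid t \<Longrightarrow>
       (\<Sum>x\<in>block \<Lambda> \<phi> A. \<Sum>y\<in>block \<Lambda> \<phi> (grid t - A). p {x, y}) \<le> H * card (bdry t A)"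
    and sH: "0 \<le> s" "s * H \<le> 1"
begin

abbreviation "Prob \<equiv> measure_pmf.prob (perc (pairs \<Lambda>) p)"

abbreviation "\<C> \<equiv> contours t :: (int ^ 'd) set set"

abbreviation "bad \<equiv> bad_edge \<Lambda> \<phi>"

abbreviation "z \<equiv> \<rho> * exp (1 + \<mu>)"

text \<open>Boundaries of disjoint contours may overlap, but each of the two ends of an edge lies in
  at most one member, so an edge is counted at most twice. This is why the locale asks for the
  square of \<rho>.\<close>

lemma prob_family_bad:
  assumes F: "F \<subseteq> \<C>" "disjoint F" and T: "T \<subseteq> far_pairs \<Lambda> \<phi>"
  shows "Prob {\<eta>. (\<forall>A\<in>F. \<forall>e\<in>bdry t A. bad \<eta> e) \<and> (\<forall>e\<in>T. \<eta> e)} \<le> (\<Prod>A\<in>F. \<rho> ^ card (bdry t A)) * (\<Prod>e\<in>T. p e)"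
proof -
  define M where "M = (\<Union>A\<in>F. bdry t A)"
  have finF: "finite F" by (rule finite_subset[OF F(1) finite_contours])
  have finM: "finite M" using finF by (simp add: M_def)
  have "{\<eta>. (\<forall>A\<in>F. \<forall>e\<in>bdry t A. bad \<eta> e) \<and> (\<forall>e\<in>T. \<eta> e)} = {\<eta>. (\<forall>e\<in>M. bad \<eta> e) \<and> (\<forall>e\<in>T. \<eta> e)}"
    by (auto simp: M_def)
  then have "Prob {\<eta>. (\<forall>A\<in>F. \<forall>e\<in>bdry t A. bad \<eta> e) \<and> (\<forall>e\<in>T. \<eta> e)}
     = Prob {\<eta>. (\<forall>e\<in>M. bad \<eta> e) \<and> (\<forall>e\<in>T. \<eta> e)}" by simp
  also have "\<dots> \<le> (q powr (1 / (2 * CARD('d)))) ^ card M * (\<Prod>e\<in>T. p e)"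
  proof (rule prob_bad_edges_le[OF fin _ q finM _ T])
    show "0 \<le> p e \<and> p e \<le> 1" if "e \<in> pairs \<Lambda>" for e using p0 p1 that by blast
    fix e assume "e \<in> M"
    then have "fst e \<in> grid t" "fst e + unit (snd e) \<in> grid t" by (auto simp: M_def bdry_def)
    then show "(\<Sum>W\<in>cut_sets (block_pair \<Lambda> \<phi> e). \<Prod>e'\<in>cut_edges (block_pair \<Lambda> \<phi> e) W. 1 - p e') \<le> q"
      using bad_prob[of "fst e" "snd e"] by simp
  qed
  also have "\<dots> \<le> (\<Prod>A\<in>F. \<rho> ^ card (bdry t A)) * (\<Prod>e\<in>T. p e)"
  proof (rule mult_right_mono)
    show "0 \<le> (\<Prod>e\<in>T. p e)" by (intro prod_nonneg) (simp add: p0)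
    have "(\<Sum>A\<in>F. card (bdry t A)) = (\<Sum>A\<in>F. card {e\<in>M. e \<in> bdry t A})"
      by (intro sum.cong refl arg_cong[where f=card]) (auto simp: M_def)
    also have "\<dots> = (\<Sum>e\<in>M. card {A\<in>F. e \<in> bdry t A})"
      by (rule card_Collect_pair_swap[OF finM finF])
    also have "\<dots> \<le> (\<Sum>e\<in>M. 2)"
    proof (rule sum_mono)
      fix e :: "(int ^ 'd) \<times> 'd"
      have one: "card {A\<in>F. x \<in> A} \<le> 1" for x
      proof -
        have "A = B" if "A \<in> {A\<in>F. x \<in> A}" "B \<in> {A\<in>F. x \<in> A}" for A B
          using that F(2) by (auto simp: disjoint_def)
        then show ?thesis using finF by (simp add: card_le_Suc0_iff_eq)
      qed
      have "{A\<in>F. e \<in> bdry t A} \<subseteq> {A\<in>F. fst e \<in> A} \<union> {A\<in>F. fst e + unit (snd e) \<in> A}"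
        by (auto simp: bdry_def)
      then have "card {A\<in>F. e \<in> bdry t A} \<le> card ({A\<in>F. fst e \<in> A} \<union> {A\<in>F. fst e + unit (snd e) \<in> A})"
        using finF by (intro card_mono) auto
      also have "\<dots> \<le> 2" using card_Un_le[of "{A\<in>F. fst e \<in> A}" "{A\<in>F. fst e + unit (snd e) \<in> A}"]
        one[of "fst e"] one[of "fst e + unit (snd e)"] by linarith
      finally show "card {A\<in>F. e \<in> bdry t A} \<le> 2" .
    qed
    finally have le: "(\<Sum>A\<in>F. card (bdry t A)) \<le> 2 * card M" by simp
    have "(q powr (1 / (2 * CARD('d)))) ^ card M \<le> (\<rho>\<^sup>2) ^ card M"
      using \<rho>(3) by (intro power_mono) auto
    also have "\<dots> = \<rho> ^ (2 * card M)" by (rule power_mult[symmetric])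
    also have "\<dots> \<le> \<rho> ^ (\<Sum>A\<in>F. card (bdry t A))" by (rule power_decreasing[OF le \<rho>(1,2)])
    also have "\<dots> = (\<Prod>A\<in>F. \<rho> ^ card (bdry t A))" by (rule power_sum)
    finally show "(q powr (1 / (2 * CARD('d)))) ^ card M \<le> (\<Prod>A\<in>F. \<rho> ^ card (bdry t A))" .
  qed
  finally show ?thesis .
qed

lemma prob_family_bad':
  assumes F: "F \<subseteq> \<C>" "disjoint F"
  shows "Prob {\<eta>. \<forall>A\<in>F. \<forall>e\<in>bdry t A. bad \<eta> e} \<le> (\<Prod>A\<in>F. \<rho> ^ card (bdry t A))"
  using prob_family_bad[OF F, of "{}"] by simp

lemma z_nonneg: "0 \<le> z"
  using \<rho> by simp

lemma \<rho>_le_z: "\<rho> * exp 1 \<le> z"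
  using \<mu> \<rho> by (intro mult_left_mono) auto

lemma sum_card_contours: "(\<Sum>A\<in>\<C>. real (card A) * z ^ card (bdry t A)) \<le> real (t ^ CARD('d)) * s"
proof -
  have "(\<Sum>A\<in>\<C>. real (card A) * z ^ card (bdry t A)) = (\<Sum>A\<in>\<C>. \<Sum>Y\<in>{Y\<in>grid t. Y \<in> A}. z ^ card (bdry t A))"
  proof (rule sum.cong[OF refl])
    fix A :: "(int ^ 'd) set" assume "A \<in> \<C>"
    then have "{Y\<in>grid t. Y \<in> A} = A" by (auto simp: contours_def)
    then show "real (card A) * z ^ card (bdry t A) = (\<Sum>Y\<in>{Y\<in>grid t. Y \<in> A}. z ^ card (bdry t A))" by simp
  qed
  also have "\<dots> = (\<Sum>Y\<in>grid t. \<Sum>A\<in>{A\<in>\<C>. Y \<in> A}. z ^ card (bdry t A))"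
    by (rule sum.swap_restrict) auto
  also have "\<dots> \<le> (\<Sum>Y\<in>(grid t :: (int ^ 'd) set). s)" by (intro sum_mono s)
  finally show ?thesis by (simp add: card_grid)
qed

lemma sum_contours: "(\<Sum>A\<in>\<C>. z ^ card (bdry t A)) \<le> real (t ^ CARD('d)) * s"
proof -
  have "(\<Sum>A\<in>\<C>. z ^ card (bdry t A)) \<le> (\<Sum>A\<in>\<C>. real (card A) * z ^ card (bdry t A))"
  proof (rule sum_mono)
    fix A :: "(int ^ 'd) set" assume "A \<in> \<C>"
    then have "A \<noteq> {}" "finite A" using finite_subset[OF _ finite_grid] by (auto simp: contours_def)
    then have "1 \<le> real (card A)" by (simp add: Suc_le_eq card_gt_0_iff)
    then have "1 * z ^ card (bdry t A) \<le> real (card A) * z ^ card (bdry t A)"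
      using z_nonneg by (intro mult_right_mono) auto
    then show "z ^ card (bdry t A) \<le> real (card A) * z ^ card (bdry t A)" by simp
  qed
  then show ?thesis using sum_card_contours by linarith
qed

text \<open>Exponential tilting: with at least m0 boundary edges present, a factor
  \<open>exp \<mu>\<close> for each of them is worth \<open>exp (\<mu> * m0)\<close>.\<close>

lemma exp_discount:
  assumes "m0 \<le> real n" shows "\<rho> ^ n \<le> exp (- (\<mu> * m0)) * (\<rho> * exp \<mu>) ^ n"
proof -
  have "exp (- (\<mu> * m0)) * exp \<mu> ^ n = exp (\<mu> * (real n - m0))"
    unfolding exp_of_nat_mult[symmetric] exp_add[symmetric] by (simp add: algebra_simps)
  moreover have "0 \<le> \<mu> * (real n - m0)" using assms \<mu> by (intro mult_nonneg_nonneg) auto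
  ultimately have "1 \<le> exp (- (\<mu> * m0)) * exp \<mu> ^ n" by simp
  then have "\<rho> ^ n * 1 \<le> \<rho> ^ n * (exp (- (\<mu> * m0)) * exp \<mu> ^ n)" using \<rho> by (intro mult_left_mono) auto
  then show ?thesis by (simp add: power_mult_distrib mult_ac)
qed

lemma prob_big_contour:
  assumes m0: "\<And>A. A \<in> \<C> \<Longrightarrow> k \<le> card A \<Longrightarrow> m0 \<le> real (card (bdry t A))"
  shows "Prob {\<eta>. \<exists>A\<in>bad_contours (bad \<eta>) t. k \<le> card A} \<le> exp (- (\<mu> * m0)) * (real (t ^ CARD('d)) * s)"
proof -
  let ?I = "{A\<in>\<C>. k \<le> card A}"
  have "Prob {\<eta>. \<exists>A\<in>bad_contours (bad \<eta>) t. k \<le> card A} \<le> (\<Sum>A\<in>?I. Prob {\<eta>. \<forall>A\<in>{A}. \<forall>e\<in>bdry t A. bad \<eta> e})"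
    by (rule prob_UN_le) (auto simp: bad_contours_def)
  also have "\<dots> \<le> (\<Sum>A\<in>?I. exp (- (\<mu> * m0)) * z ^ card (bdry t A))"
  proof (rule sum_mono)
    fix A assume A: "A \<in> ?I"
    have "Prob {\<eta>. \<forall>A\<in>{A}. \<forall>e\<in>bdry t A. bad \<eta> e} \<le> (\<Prod>A\<in>{A}. \<rho> ^ card (bdry t A))"
      using A by (intro prob_family_bad') (auto simp: disjoint_def)
    also have "\<dots> = \<rho> ^ card (bdry t A)" by simp
    also have "\<dots> \<le> exp (- (\<mu> * m0)) * (\<rho> * exp \<mu>) ^ card (bdry t A)" using A m0 by (intro exp_discount) auto
    also have "\<dots> \<le> exp (- (\<mu> * m0)) * z ^ card (bdry t A)"
      using \<rho> by (intro mult_left_mono power_mono) (auto intro: mult_left_mono)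
    finally show "Prob {\<eta>. \<forall>A\<in>{A}. \<forall>e\<in>bdry t A. bad \<eta> e} \<le> exp (- (\<mu> * m0)) * z ^ card (bdry t A)" .
  qed
  also have "\<dots> \<le> (\<Sum>A\<in>\<C>. exp (- (\<mu> * m0)) * z ^ card (bdry t A))"
    using z_nonneg by (intro sum_mono2) auto
  also have "\<dots> \<le> exp (- (\<mu> * m0)) * (real (t ^ CARD('d)) * s)"
    using sum_contours by (simp add: sum_distrib_left[symmetric] mult_left_mono)
  finally show ?thesis .
qed

text \<open>
  An exponential moment bound: \<open>exp (\<theta> * vol F) = (\<Prod>A\<in>F. 1 + (exp (\<theta> * card A) - 1))\<close> expands into a sum
  over the subfamilies of \<open>F\<close>, and a disjoint family is bad with probability at most the product
  of the weights of its members.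
\<close>

lemma prob_bad_volume:
  fixes \<theta> :: real
  assumes \<theta>: "0 \<le> \<theta>" "\<And>A. A \<in> \<C> \<Longrightarrow> card A < k \<Longrightarrow> \<theta> * card A \<le> card (bdry t A)"
  shows "Prob {\<eta>. \<exists>F\<subseteq>bad_contours (bad \<eta>) t. disjoint F \<and> (\<forall>A\<in>F. card A < k) \<and> D \<le> (\<Sum>A\<in>F. card A)}
    \<le> exp (- (\<theta> * (real D - real (t ^ CARD('d)) * s)))"
proof -
  let ?V = "{A :: (int ^ 'd) set. A \<in> \<C> \<and> card A < k}"
  let ?I = "{F\<in>Pow ?V. disjoint F}"
  have finV: "finite ?V" by simp
  define g where "g A = exp (\<theta> * card A) - 1" for A :: "(int ^ 'd) set"
  have g0: "0 \<le> g A" for A using \<theta>(1) by (simp add: g_def)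
  define Bd where "Bd F = {\<eta>. \<forall>A\<in>F. \<forall>e\<in>bdry t A. bad \<eta> e}" for F
  let ?c = "\<lambda>F. exp (- (\<theta> * D)) * (\<Prod>A\<in>F. g A)"
  have "Prob {\<eta>. \<exists>F\<subseteq>bad_contours (bad \<eta>) t. disjoint F \<and> (\<forall>A\<in>F. card A < k) \<and> D \<le> (\<Sum>A\<in>F. card A)}
     \<le> (\<Sum>F\<in>?I. ?c F * Prob (Bd F))"
  proof (rule prob_le_weighted_sum)
    show "finite ?I" using finV by simp
    show "0 \<le> ?c F" for F using g0 by (intro mult_nonneg_nonneg prod_nonneg) auto
    fix \<eta> assume "\<eta> \<in> {\<eta>. \<exists>F\<subseteq>bad_contours (bad \<eta>) t. disjoint F \<and> (\<forall>A\<in>F. card A < k) \<and> D \<le> (\<Sum>A\<in>F. card A)}"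
    then obtain F where F: "F \<subseteq> bad_contours (bad \<eta>) t" "disjoint F" "\<forall>A\<in>F. card A < k" "D \<le> (\<Sum>A\<in>F. card A)" by blast
    have FV: "F \<subseteq> ?V" using F(1,3) by (auto simp: bad_contours_def)
    have finF: "finite F" by (rule finite_subset[OF FV finV])
    have "\<theta> * D \<le> \<theta> * (\<Sum>A\<in>F. real (card A))" using F(4) \<theta>(1) by (intro mult_left_mono) (auto simp flip: of_nat_sum)
    then have "1 \<le> exp (- (\<theta> * D)) * exp (\<theta> * (\<Sum>A\<in>F. real (card A)))" by (simp flip: exp_add)
    also have "exp (\<theta> * (\<Sum>A\<in>F. real (card A))) = (\<Prod>A\<in>F. 1 + g A)"
      using finF by (simp add: g_def exp_sum sum_distrib_left)
    also have "\<dots> = (\<Sum>F'\<in>Pow F. \<Prod>A\<in>F'. g A)" by (rule sum_Pow_prod[OF finF, symmetric])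
    also have "exp (- (\<theta> * D)) * \<dots> = (\<Sum>F'\<in>Pow F. ?c F' * indicator (Bd F') \<eta>)"
      unfolding sum_distrib_left
    proof (rule sum.cong[OF refl])
      fix F' assume "F' \<in> Pow F"
      then have "\<eta> \<in> Bd F'" using F(1) by (auto simp: Bd_def bad_contours_def)
      then show "exp (- (\<theta> * D)) * (\<Prod>A\<in>F'. g A) = ?c F' * indicator (Bd F') \<eta>" by simp
    qed
    also have "\<dots> \<le> (\<Sum>F'\<in>?I. ?c F' * indicator (Bd F') \<eta>)"
    proof (rule sum_mono2)
      show "finite ?I" using finV by simp
      show "Pow F \<subseteq> ?I" using FV F(2) by (auto simp: disjoint_def)
      show "0 \<le> ?c F' * indicator (Bd F') \<eta>" for F' using g0 by (intro mult_nonneg_nonneg prod_nonneg) auto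
    qed
    finally show "1 \<le> (\<Sum>F\<in>?I. ?c F * indicator (Bd F) \<eta>)" .
  qed
  also have "\<dots> \<le> (\<Sum>F\<in>?I. exp (- (\<theta> * D)) * (\<Prod>A\<in>F. g A * \<rho> ^ card (bdry t A)))"
  proof (rule sum_mono)
    fix F assume F: "F \<in> ?I"
    have "Prob (Bd F) \<le> (\<Prod>A\<in>F. \<rho> ^ card (bdry t A))" unfolding Bd_def using F by (intro prob_family_bad') auto
    then have "?c F * Prob (Bd F) \<le> ?c F * (\<Prod>A\<in>F. \<rho> ^ card (bdry t A))"
      using g0 by (intro mult_left_mono mult_nonneg_nonneg prod_nonneg) auto
    then show "?c F * Prob (Bd F) \<le> exp (- (\<theta> * D)) * (\<Prod>A\<in>F. g A * \<rho> ^ card (bdry t A))"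
      by (simp add: prod.distrib mult_ac)
  qed
  also have "\<dots> \<le> (\<Sum>F\<in>Pow ?V. exp (- (\<theta> * D)) * (\<Prod>A\<in>F. g A * \<rho> ^ card (bdry t A)))"
    using g0 \<rho> by (intro sum_mono2) (auto intro!: mult_nonneg_nonneg prod_nonneg)
  also have "\<dots> = exp (- (\<theta> * D)) * (\<Sum>F\<in>Pow ?V. \<Prod>A\<in>F. g A * \<rho> ^ card (bdry t A))"
    by (simp add: sum_distrib_left)
  also have "\<dots> \<le> exp (- (\<theta> * D)) * exp (\<Sum>A\<in>?V. g A * \<rho> ^ card (bdry t A))"
    using g0 \<rho> finV by (intro mult_left_mono sum_Pow_prod_le_exp) auto
  also have "\<dots> \<le> exp (- (\<theta> * D)) * exp (\<theta> * (real (t ^ CARD('d)) * s))"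
  proof -
    have "(\<Sum>A\<in>?V. g A * \<rho> ^ card (bdry t A)) \<le> (\<Sum>A\<in>?V. \<theta> * (real (card A) * z ^ card (bdry t A)))"
    proof (rule sum_mono)
      fix A assume A: "A \<in> ?V"
      let ?x = "\<theta> * card A"
      \<comment> \<open>This gives e^x - 1 \<le> x e^x for x = \<theta> |A|. The exponential is at
        most exp of the size of the boundary and is absorbed by the exp(1) in z; the linear factor
        |A| leads to \<open>sum_card_contours\<close>.\<close>
      have "1 - ?x \<le> exp (- ?x)" using exp_ge_add_one_self[of "- ?x"] by simp
      then have "exp ?x * (1 - ?x) \<le> exp ?x * exp (- ?x)" by (intro mult_left_mono) auto
      then have "g A \<le> ?x * exp ?x" by (simp add: g_def algebra_simps flip: exp_add)
      also have "\<dots> \<le> ?x * exp (card (bdry t A))" using \<theta> A by (intro mult_left_mono) auto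
      finally have "g A * \<rho> ^ card (bdry t A) \<le> ?x * exp (card (bdry t A)) * \<rho> ^ card (bdry t A)"
        using \<rho> by (intro mult_right_mono) auto
      also have "\<dots> = ?x * (\<rho> * exp 1) ^ card (bdry t A)"
        by (simp add: power_mult_distrib exp_of_nat_mult[symmetric] mult_ac)
      also have "\<dots> \<le> ?x * z ^ card (bdry t A)"
        by (intro mult_left_mono power_mono \<rho>_le_z) (use \<theta>(1) \<rho>(1) in auto)
      finally show "g A * \<rho> ^ card (bdry t A) \<le> \<theta> * (real (card A) * z ^ card (bdry t A))" by (simp add: mult_ac)
    qed
    also have "\<dots> = \<theta> * (\<Sum>A\<in>?V. real (card A) * z ^ card (bdry t A))" by (simp add: sum_distrib_left)
    also have "\<dots> \<le> \<theta> * (\<Sum>A\<in>\<C>. real (card A) * z ^ card (bdry t A))"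
      using \<theta> z_nonneg by (intro mult_left_mono sum_mono2) auto
    also have "\<dots> \<le> \<theta> * (real (t ^ CARD('d)) * s)" using \<theta> sum_card_contours by (intro mult_left_mono) auto
    finally show ?thesis by (intro mult_left_mono) auto
  qed
  also have "\<dots> = exp (- (\<theta> * (real D - real (t ^ CARD('d)) * s)))" by (simp add: algebra_simps flip: exp_add)
  finally show ?thesis .
qed

text \<open>The criterion of \<open>sum_layer_weight_le\<close> with the size of the boundary as
  budget. An edge leaving v ends in some block, the contours through that block have total weight at
  most s, and the edges leaving v have total weight at most H times the boundary of v.\<close>

lemma link_weight_sum_le:
  assumes v: "v \<in> \<C>"
  shows "(\<Sum>u\<in>\<C>. (\<rho> * exp \<mu>) ^ card (bdry t u) * exp (card (bdry t u)) * link_weight (block \<Lambda> \<phi>) p v u)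
     \<le> card (bdry t v)"
proof -
  let ?\<beta> = "block \<Lambda> \<phi>"
  have vG: "v \<subseteq> grid t" using v by (auto simp: contours_def)
  have zz: "(\<rho> * exp \<mu>) ^ n * exp (real n) = z ^ n" for n
    by (simp add: power_mult_distrib exp_add exp_of_nat_mult[symmetric])
  have fin\<beta>: "finite (?\<beta> A)" for A using fin by (simp add: block_def)
  have "(\<Sum>u\<in>\<C>. (\<rho> * exp \<mu>) ^ card (bdry t u) * exp (card (bdry t u)) * link_weight ?\<beta> p v u)
     = (\<Sum>u\<in>\<C>. \<Sum>x\<in>?\<beta> v. \<Sum>y\<in>{y\<in>?\<beta> (grid t - v). \<phi> y \<in> u}. z ^ card (bdry t u) * p {x, y})"
  proof (rule sum.cong[OF refl])
    fix u :: "(int ^ 'd) set" assume "u \<in> \<C>"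
    then have "u \<subseteq> grid t" by (auto simp: contours_def)
    then have "?\<beta> u - ?\<beta> v = {y\<in>?\<beta> (grid t - v). \<phi> y \<in> u}" by (auto simp: block_def)
    then show "(\<rho> * exp \<mu>) ^ card (bdry t u) * exp (card (bdry t u)) * link_weight ?\<beta> p v u =
       (\<Sum>x\<in>?\<beta> v. \<Sum>y\<in>{y\<in>?\<beta> (grid t - v). \<phi> y \<in> u}. z ^ card (bdry t u) * p {x, y})"
      unfolding zz by (simp add: link_weight_def sum_distrib_left)
  qed
  also have "\<dots> = (\<Sum>x\<in>?\<beta> v. \<Sum>u\<in>\<C>. \<Sum>y\<in>{y\<in>?\<beta> (grid t - v). \<phi> y \<in> u}. z ^ card (bdry t u) * p {x, y})"
    by (rule sum.swap)
  also have "\<dots> = (\<Sum>x\<in>?\<beta> v. \<Sum>y\<in>?\<beta> (grid t - v). \<Sum>u\<in>{u\<in>\<C>. \<phi> y \<in> u}. z ^ card (bdry t u) * p {x, y})"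
    using fin\<beta> by (intro sum.cong[OF refl] sum.swap_restrict) auto
  also have "\<dots> \<le> (\<Sum>x\<in>?\<beta> v. \<Sum>y\<in>?\<beta> (grid t - v). s * p {x, y})"
  proof (intro sum_mono)
    fix x y assume "y \<in> ?\<beta> (grid t - v)"
    then have "\<phi> y \<in> grid t" by (auto simp: block_def)
    then have "(\<Sum>u\<in>{u\<in>\<C>. \<phi> y \<in> u}. z ^ card (bdry t u)) * p {x, y} \<le> s * p {x, y}"
      using p0 by (intro mult_right_mono s) auto
    then show "(\<Sum>u\<in>{u\<in>\<C>. \<phi> y \<in> u}. z ^ card (bdry t u) * p {x, y}) \<le> s * p {x, y}"
      by (simp add: sum_distrib_right)
  qed
  also have "\<dots> = s * (\<Sum>x\<in>?\<beta> v. \<Sum>y\<in>?\<beta> (grid t - v). p {x, y})" by (simp add: sum_distrib_left)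
  also have "\<dots> \<le> s * (H * card (bdry t v))" by (intro mult_left_mono H vG sH)
  also have "\<dots> \<le> 1 * real (card (bdry t v))" unfolding mult.assoc[symmetric] by (intro mult_right_mono sH) auto
  finally show ?thesis by simp
qed

text \<open>Union bound over a root r and the remaining members R, explored in layers of links. The
  tilting uses the total boundary of the family, and the budget of the root turns its weight into a
  power of z, which is summed by \<open>sum_contours\<close>.\<close>

lemma prob_linked_contours:
  assumes m0: "\<And>F. F \<subseteq> \<C> \<Longrightarrow> k \<le> (\<Sum>A\<in>F. card A) \<Longrightarrow> m0 \<le> (\<Sum>A\<in>F. real (card (bdry t A)))"
  shows "Prob {\<eta>. \<exists>F. F \<noteq> {} \<and> F \<subseteq> bad_contours (bad \<eta>) t \<and> separated F \<and>
      cut_connected (link (block \<Lambda> \<phi>) \<eta>) F \<and> k \<le> (\<Sum>A\<in>F. card A)} \<le> exp (- (\<mu> * m0)) * (real (t ^ CARD('d)) * s)"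
proof -
  let ?\<beta> = "block \<Lambda> \<phi>" and ?h = "card (\<C>)"
  let ?J = "link_weight ?\<beta> p"
  define ok where "ok r R \<longleftrightarrow> r \<notin> R \<and> separated (insert r R) \<and> m0 \<le> (\<Sum>A\<in>insert r R. real (card (bdry t A)))" for r and R :: "(int ^ 'd) set set"
  \<comment> \<open>The quantifier over \<open>{}\<close> stands for the initial \<open>T0\<close>
    of \<open>prob_layered_le\<close>: no link has been revealed yet.\<close>
  define Ev where "Ev r R = {\<eta>. (\<forall>A\<in>insert r R. \<forall>e\<in>bdry t A. bad \<eta> e) \<and> (\<forall>e\<in>{}. \<eta> e) \<and>
      layered (link ?\<beta> \<eta>) ?h {r} R}" for r and R :: "(int ^ 'd) set set"
  let ?w = "\<lambda>A. (\<rho> * exp \<mu>) ^ card (bdry t A)"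
  have w0: "0 \<le> ?w A" for A using \<rho> by simp
  have fin\<beta>: "finite (?\<beta> A)" for A using fin by (simp add: block_def)
  have J0: "0 \<le> ?J A B" for A B by (auto simp: link_weight_def intro!: sum_nonneg p0)
  have K0: "0 \<le> layer_weight ?J h A B" for h A B by (rule layer_weight_nonneg[OF J0])
  have "Prob {\<eta>. \<exists>F. F \<noteq> {} \<and> F \<subseteq> bad_contours (bad \<eta>) t \<and> separated F \<and>
      cut_connected (link ?\<beta> \<eta>) F \<and> k \<le> (\<Sum>A\<in>F. card A)}
     \<le> (\<Sum>(r, R)\<in>(SIGMA r:\<C>. {R\<in>Pow (\<C>). ok r R}). Prob (Ev r R))"
    unfolding case_prod_unfold
  proof (rule prob_UN_le)
    show "finite (SIGMA r:\<C>. {R\<in>Pow (\<C>). ok r R})" by (intro finite_SigmaI) auto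
    show "{\<eta>. \<exists>F. F \<noteq> {} \<and> F \<subseteq> bad_contours (bad \<eta>) t \<and> separated F \<and>
      cut_connected (link ?\<beta> \<eta>) F \<and> k \<le> (\<Sum>A\<in>F. card A)} \<subseteq>
      (\<Union>i\<in>(SIGMA r:\<C>. {R\<in>Pow (\<C>). ok r R}). Ev (fst i) (snd i))"
    proof
      fix \<eta> assume "\<eta> \<in> {\<eta>. \<exists>F. F \<noteq> {} \<and> F \<subseteq> bad_contours (bad \<eta>) t \<and> separated F \<and>
         cut_connected (link ?\<beta> \<eta>) F \<and> k \<le> (\<Sum>A\<in>F. card A)}"
      then obtain F where F: "F \<noteq> {}" "F \<subseteq> bad_contours (bad \<eta>) t" "separated F"
         "cut_connected (link ?\<beta> \<eta>) F" "k \<le> (\<Sum>A\<in>F. card A)" by blast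
      obtain r where r: "r \<in> F" using F(1) by blast
      have ins: "insert r (F - {r}) = F" using r by blast
      have Fc: "F \<subseteq> \<C>" using F(2) by (auto simp: bad_contours_def)
      have "ok r (F - {r})" unfolding ok_def ins using F(3) m0[OF Fc F(5)] by simp
      moreover have "layered (link ?\<beta> \<eta>) ?h {r} (F - {r})"
      proof (rule layered_of_cut_connected[OF F(4) _ r])
        show "finite F" by (rule finite_subset[OF Fc finite_contours])
        show "card F \<le> ?h" using Fc by (intro card_mono) auto
        show "link ?\<beta> \<eta> v u" if "link ?\<beta> \<eta> u v" for u v
        proof -
          obtain x y where xy: "x \<in> ?\<beta> u" "y \<in> ?\<beta> v" "\<eta> {x, y}" using \<open>link ?\<beta> \<eta> u v\<close> by (auto simp: link_def)
          have "{y, x} = {x, y}" by blast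
          then have "\<eta> {y, x}" using xy(3) by (simp only:)
          then show ?thesis unfolding link_def using xy(1,2) by (intro bexI)
        qed
      qed
      then have "\<eta> \<in> Ev r (F - {r})" unfolding Ev_def ins using F(2) by (auto simp: bad_contours_def)
      ultimately show "\<eta> \<in> (\<Union>i\<in>(SIGMA r:\<C>. {R\<in>Pow (\<C>). ok r R}). Ev (fst i) (snd i))"
        using r Fc by (intro UN_I[of "(r, F - {r})"]) auto
    qed
  qed
  also have "\<dots> = (\<Sum>r\<in>\<C>. \<Sum>R\<in>{R\<in>Pow (\<C>). ok r R}. Prob (Ev r R))"
    by (rule sum.Sigma[symmetric]) auto
  also have "\<dots> \<le> (\<Sum>r\<in>\<C>. exp (- (\<mu> * m0)) * z ^ card (bdry t r))"
  proof (rule sum_mono)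
    fix r :: "(int ^ 'd) set" assume r: "r \<in> \<C>"
    have "(\<Sum>R\<in>{R\<in>Pow (\<C>). ok r R}. Prob (Ev r R)) \<le>
       (\<Sum>R\<in>{R\<in>Pow (\<C>). ok r R}. exp (- (\<mu> * m0)) * ?w r * ((\<Prod>u\<in>R. ?w u) * layer_weight ?J ?h {r} R))"
    proof (rule sum_mono)
      fix R assume "R \<in> {R\<in>Pow (\<C>). ok r R}"
      then have R: "R \<subseteq> \<C>" "ok r R" by auto
      have finR: "finite R" by (rule finite_subset[OF R(1) finite_contours])
      have sep: "separated (insert r R)" and rR: "r \<notin> R" using R by (auto simp: ok_def)
      have dis: "disjoint (insert r R)" using sep unfolding separated_def disjoint_def by blast
      let ?c = "\<Prod>A\<in>insert r R. \<rho> ^ card (bdry t A)"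
      have "Prob (Ev r R) \<le> ?c * (\<Prod>e\<in>{}. p e) * layer_weight ?J ?h {r} R"
        unfolding Ev_def
      proof (rule prob_layered_le[where \<T>="far_pairs \<Lambda> \<phi>"])
        show "0 \<le> ?c" using \<rho> by (intro prod_nonneg) auto
        show "Prob {\<eta>. (\<forall>A\<in>insert r R. \<forall>e\<in>bdry t A. bad \<eta> e) \<and> (\<forall>e\<in>T. \<eta> e)} \<le> ?c * (\<Prod>e\<in>T. p e)"
          if "T \<subseteq> far_pairs \<Lambda> \<phi>" for T
          using R r dis that by (intro prob_family_bad) auto
        show "{r} \<inter> R = {}" using rR by blast
        show "?\<beta> A \<inter> ?\<beta> B = {}" if "A \<in> {r} \<union> R" "B \<in> {r} \<union> R" "A \<noteq> B" for A B
          using dis that unfolding disjoint_def block_def by blast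
        show "{x, y} \<in> far_pairs \<Lambda> \<phi>" if "A \<in> {r} \<union> R" "B \<in> R" "A \<noteq> B" "x \<in> ?\<beta> A" "y \<in> ?\<beta> B" for A B x y
        proof -
          have "\<phi> x \<in> A" "\<phi> y \<in> B" "x \<in> \<Lambda>" "y \<in> \<Lambda>" using that by (auto simp: block_def)
          moreover have "\<phi> x \<noteq> \<phi> y \<and> \<not> neighbours (\<phi> x) (\<phi> y)" using sep that(1,2,3) calculation unfolding separated_def by blast
          ultimately show ?thesis unfolding far_pairs_def by blast
        qed
      qed (use fin\<beta> p0 finR in auto)
      also have "?c * (\<Prod>e\<in>{}. p e) * layer_weight ?J ?h {r} R = ?c * layer_weight ?J ?h {r} R" by simp
      also have "\<dots> \<le> (exp (- (\<mu> * m0)) * (\<Prod>A\<in>insert r R. ?w A)) * layer_weight ?J ?h {r} R"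
      proof (rule mult_right_mono[OF _ K0])
        have "?c = \<rho> ^ (\<Sum>A\<in>insert r R. card (bdry t A))" by (rule power_sum[symmetric])
        also have "\<dots> \<le> exp (- (\<mu> * m0)) * (\<rho> * exp \<mu>) ^ (\<Sum>A\<in>insert r R. card (bdry t A))"
          using R(2) by (intro exp_discount) (auto simp: ok_def)
        also have "(\<rho> * exp \<mu>) ^ (\<Sum>A\<in>insert r R. card (bdry t A)) = (\<Prod>A\<in>insert r R. ?w A)" by (rule power_sum)
        finally show "?c \<le> exp (- (\<mu> * m0)) * (\<Prod>A\<in>insert r R. ?w A)" .
      qed
      also have "(\<Prod>A\<in>insert r R. ?w A) = ?w r * (\<Prod>A\<in>R. ?w A)" using finR rR by simp
      finally show "Prob (Ev r R) \<le> exp (- (\<mu> * m0)) * ?w r * ((\<Prod>u\<in>R. ?w u) * layer_weight ?J ?h {r} R)"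
        by (simp add: mult_ac)
    qed
    also have "\<dots> \<le> (\<Sum>R\<in>Pow (\<C>). exp (- (\<mu> * m0)) * ?w r * ((\<Prod>u\<in>R. ?w u) * layer_weight ?J ?h {r} R))"
      by (intro sum_mono2) (auto intro!: mult_nonneg_nonneg prod_nonneg K0 w0)
    also have "\<dots> = exp (- (\<mu> * m0)) * ?w r * (\<Sum>R\<in>Pow (\<C>). (\<Prod>u\<in>R. ?w u) * layer_weight ?J ?h {r} R)"
      by (simp add: sum_distrib_left)
    also have "\<dots> \<le> exp (- (\<mu> * m0)) * ?w r * exp (\<Sum>v\<in>{r}. real (card (bdry t v)))"
    proof (rule mult_left_mono)
      show "(\<Sum>R\<in>Pow (\<C>). (\<Prod>u\<in>R. ?w u) * layer_weight ?J ?h {r} R) \<le> exp (\<Sum>v\<in>{r}. real (card (bdry t v)))"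
        by (rule sum_layer_weight_le) (use J0 w0 link_weight_sum_le r in auto)
      show "0 \<le> exp (- (\<mu> * m0)) * ?w r" by (intro mult_nonneg_nonneg w0) simp
    qed
    also have "\<dots> = exp (- (\<mu> * m0)) * z ^ card (bdry t r)"
      by (simp add: power_mult_distrib exp_add exp_of_nat_mult[symmetric])
    finally show "(\<Sum>R\<in>{R\<in>Pow (\<C>). ok r R}. Prob (Ev r R)) \<le> exp (- (\<mu> * m0)) * z ^ card (bdry t r)" .
  qed
  also have "\<dots> \<le> exp (- (\<mu> * m0)) * (real (t ^ CARD('d)) * s)"
    using sum_contours by (simp add: sum_distrib_left[symmetric] mult_left_mono)
  finally show ?thesis .
qed

text \<open>Without a contour of at least k' blocks and without a large total volume of smaller
  ones, the cluster K exists, and then \<open>linked_bad_contours\<close> produces a linked family.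
  By \<open>m * (k' - 1) < k\<close>, covering k vertices takes at least k' blocks.\<close>

lemma prob_second_component_le:
  fixes \<theta> :: real
  assumes m: "\<And>X. card (block \<Lambda> \<phi> {X}) \<le> m"
    and D: "2 * D \<le> t ^ CARD('d)" "2 * m * D \<le> card \<Lambda>" "3 \<le> t ^ CARD('d)"
    and k: "0 < k" "m * (k' - 1) < k" "0 < k'"
    and m0: "\<And>F. F \<subseteq> \<C> \<Longrightarrow> k' \<le> (\<Sum>A\<in>F. card A) \<Longrightarrow> m0 \<le> (\<Sum>A\<in>F. real (card (bdry t A)))"
    and \<theta>: "0 \<le> \<theta>" "\<And>A. A \<in> \<C> \<Longrightarrow> card A < k' \<Longrightarrow> \<theta> * card A \<le> card (bdry t A)"
  shows "Prob {\<eta>. k \<le> card (second_largest_component \<eta> \<Lambda>)} \<le>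
     2 * (exp (- (\<mu> * m0)) * (real (t ^ CARD('d)) * s)) + exp (- (\<theta> * (real D - real (t ^ CARD('d)) * s)))"
proof -
  define E1 where "E1 = {\<eta>. \<exists>A\<in>bad_contours (bad \<eta>) t. k' \<le> card A}"
  define E2 where "E2 = {\<eta>. \<exists>F\<subseteq>bad_contours (bad \<eta>) t. disjoint F \<and> (\<forall>A\<in>F. card A < k') \<and> D \<le> (\<Sum>A\<in>F. card A)}"
  define E3 where "E3 = {\<eta>. \<exists>F. F \<noteq> {} \<and> F \<subseteq> bad_contours (bad \<eta>) t \<and> separated F \<and>
      cut_connected (link (block \<Lambda> \<phi>) \<eta>) F \<and> k' \<le> (\<Sum>A\<in>F. card A)}"
  have "{\<eta>. k \<le> card (second_largest_component \<eta> \<Lambda>)} \<subseteq> E1 \<union> E2 \<union> E3"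
  proof
    fix \<eta> assume "\<eta> \<in> {\<eta>. k \<le> card (second_largest_component \<eta> \<Lambda>)}"
    then have kk: "k \<le> card (second_largest_component \<eta> \<Lambda>)" by simp
    show "\<eta> \<in> E1 \<union> E2 \<union> E3"
    proof (rule ccontr)
      assume n: "\<eta> \<notin> E1 \<union> E2 \<union> E3"
      have n1: "\<And>A. A \<in> bad_contours (bad \<eta>) t \<Longrightarrow> card A < k'" using n by (auto simp: E1_def not_le)
      have small: "(\<Sum>A\<in>F. card A) < D" if F: "F \<subseteq> bad_contours (bad \<eta>) t" "disjoint F" for F
      proof (rule ccontr)
        assume "\<not> ?thesis"
        then have "\<eta> \<in> E2" unfolding E2_def using F n1 by (auto simp: not_less)
        then show False using n by simp
      qed
      have DN: "D \<le> t ^ CARD('d)" using D(1) by linarith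
      obtain K where K: "K \<subseteq> grid t" "cut_connected (good_adj (bad \<eta>)) K" "t ^ CARD('d) < card K + D"
        using good_giant[OF small DN] by blast
      have "\<exists>F. F \<noteq> {} \<and> F \<subseteq> bad_contours (bad \<eta>) t \<and> separated F \<and>
          cut_connected (link (block \<Lambda> \<phi>) \<eta>) F \<and> k \<le> m * (\<Sum>A\<in>F. card A)"
        by (rule linked_bad_contours[OF fin onto m K]) (use D k kk in simp_all)
      then obtain F where F: "F \<noteq> {}" "F \<subseteq> bad_contours (bad \<eta>) t" "separated F"
        "cut_connected (link (block \<Lambda> \<phi>) \<eta>) F" "k \<le> m * (\<Sum>A\<in>F. card A)" by blast
      have "k' \<le> (\<Sum>A\<in>F. card A)"
      proof (rule ccontr)
        assume "\<not> ?thesis"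
        then have "(\<Sum>A\<in>F. card A) \<le> k' - 1" using k(3) by linarith
        then have "m * (\<Sum>A\<in>F. card A) \<le> m * (k' - 1)" by simp
        then show False using F(5) k(2) by linarith
      qed
      then have "\<eta> \<in> E3" unfolding E3_def using F by blast
      then show False using n by simp
    qed
  qed
  then have "Prob {\<eta>. k \<le> card (second_largest_component \<eta> \<Lambda>)} \<le> Prob (E1 \<union> E2 \<union> E3)"
    by (intro measure_pmf.finite_measure_mono) auto
  also have "\<dots> \<le> Prob (E1 \<union> E2) + Prob E3" by (intro measure_Un_le) auto
  also have "\<dots> \<le> Prob E1 + Prob E2 + Prob E3"
    by (intro add_right_mono measure_Un_le) auto
  also have "Prob E1 \<le> exp (- (\<mu> * m0)) * (real (t ^ CARD('d)) * s)" unfolding E1_def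
  proof (rule prob_big_contour)
    fix A :: "(int ^ 'd) set" assume "A \<in> \<C>" "k' \<le> card A"
    then show "m0 \<le> real (card (bdry t A))" using m0[of "{A}"] by simp
  qed
  also have "Prob E2 \<le> exp (- (\<theta> * (real D - real (t ^ CARD('d)) * s)))" unfolding E2_def by (rule prob_bad_volume[OF \<theta>])
  also have "Prob E3 \<le> exp (- (\<mu> * m0)) * (real (t ^ CARD('d)) * s)" unfolding E3_def by (rule prob_linked_contours[OF m0])
  finally show ?thesis by linarith
qed

end

section \<open>Coarse-graining a cube\<close>

definition int_cube :: "int \<Rightarrow> nat \<Rightarrow> (int ^ 'd::finite) set" where
  "int_cube a s = {x. \<forall>i. a \<le> x $ i \<and> x $ i < a + int s}"

text \<open>The minimum lets the last block in each direction absorb the remainder, so that block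
  sides are at least L and less than 2 L.\<close>

definition coarse_map :: "int \<Rightarrow> nat \<Rightarrow> nat \<Rightarrow> int ^ 'd \<Rightarrow> int ^ 'd::finite" where
  "coarse_map a s L x = (\<chi> i. min ((x $ i - a) div int L) (int (s div L) - 1))"

lemma int_cube_eq_int_box: "int_cube a s = int_box (\<chi> i. a) (\<chi> i. a + int s - 1)"
  by (auto simp: int_cube_def int_box_def)

lemma finite_int_cube [simp]: "finite (int_cube a s)"
  by (simp add: int_cube_eq_int_box)

lemma card_int_cube: "card (int_cube a s :: (int ^ 'd::finite) set) = s ^ CARD('d)"
  by (simp add: int_cube_eq_int_box card_int_box)

lemma coarse_map_bounds:
  assumes L: "0 < L" "L \<le> s" and x: "x \<in> int_cube a s"
  shows "0 \<le> coarse_map a s L x $ i" "coarse_map a s L x $ i < int (s div L)"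
    "a + coarse_map a s L x $ i * int L \<le> x $ i" "x $ i < a + coarse_map a s L x $ i * int L + 2 * int L"
proof -
  define t where "t = int (s div L)"
  define y where "y = x $ i - a"
  have t1: "1 \<le> t" using L by (simp add: t_def Suc_le_eq div_greater_zero_iff)
  have "a \<le> x $ i \<and> x $ i < a + int s" using x by (auto simp: int_cube_def)
  then have y: "0 \<le> y" "y < int s" by (auto simp: y_def)
  have c: "coarse_map a s L x $ i = min (y div int L) (t - 1)" by (simp add: coarse_map_def y_def t_def)
  have yd: "0 \<le> y div int L" using y L by (simp add: pos_imp_zdiv_nonneg_iff)
  have yl: "y div int L * int L \<le> y" "y < y div int L * int L + int L"
  proof -
    have "y = y div int L * int L + y mod int L" by simp
    moreover have "0 \<le> y mod int L" "y mod int L < int L" using L by auto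
    ultimately show "y div int L * int L \<le> y" "y < y div int L * int L + int L" by linarith+
  qed
  show "0 \<le> coarse_map a s L x $ i" "coarse_map a s L x $ i < int (s div L)" using c yd t1 by (auto simp: t_def)
  have "s < (s div L + 1) * L" using L by (metis dividend_less_times_div mult.commute Suc_eq_plus1 mult_Suc_right add.commute)
  then have "int s < (t + 1) * int L" unfolding t_def by (metis of_nat_less_iff of_nat_mult of_nat_add of_nat_1)
  then have st: "int s < (t - 1) * int L + 2 * int L" by (simp add: algebra_simps)
  show "a + coarse_map a s L x $ i * int L \<le> x $ i"
  proof -
    have "min (y div int L) (t - 1) * int L \<le> y div int L * int L" using L by (intro mult_right_mono) auto
    then show ?thesis unfolding c using yl(1) y_def by linarith
  qed
  show "x $ i < a + coarse_map a s L x $ i * int L + 2 * int L"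
  proof (cases "y div int L \<le> t - 1")
    case True then show ?thesis using c yl L by (simp add: y_def min_def)
  next
    case False then show ?thesis using c st y by (simp add: y_def min_def)
  qed
qed

lemma coarse_map_base:
  assumes L: "0 < L" "L \<le> s" and X: "X \<in> grid (s div L)"
    and x: "\<And>i. a + X $ i * int L \<le> x $ i \<and> x $ i < a + X $ i * int L + int L"
  shows "x \<in> int_cube a s" "coarse_map a s L x = X"
proof -
  have Xi: "0 \<le> X $ i" "X $ i \<le> int (s div L) - 1" for i using X by (auto simp: grid_def)
  have sL: "int (s div L) * int L \<le> int s" by (metis of_nat_mult of_nat_le_iff div_times_less_eq_dividend)
  show "x \<in> int_cube a s" unfolding int_cube_def
  proof (intro CollectI allI)
    fix i
    have "X $ i * int L \<le> (int (s div L) - 1) * int L" using Xi L by (intro mult_right_mono) auto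
    then have "X $ i * int L + int L \<le> int s" using sL by (simp add: algebra_simps)
    moreover have "0 \<le> X $ i * int L" using Xi by simp
    ultimately show "a \<le> x $ i \<and> x $ i < a + int s" using x[of i] by linarith
  qed
  have "(x $ i - a) div int L = X $ i" for i
    by (rule int_div_pos_eq[where r="x $ i - a - X $ i * int L"]) (use x[of i] in auto)
  then show "coarse_map a s L x = X" using Xi by (simp add: coarse_map_def vec_eq_iff min_absorb1)
qed

lemma coarse_map_onto:
  assumes L: "0 < L" "L \<le> s"
  shows "coarse_map a s L ` (int_cube a s :: (int ^ 'd::finite) set) = grid (s div L)"
proof
  show "coarse_map a s L ` (int_cube a s :: (int ^ 'd) set) \<subseteq> grid (s div L)"
  proof
    fix X :: "int ^ 'd" assume "X \<in> coarse_map a s L ` int_cube a s"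
    then obtain x :: "int ^ 'd" where x: "x \<in> int_cube a s" "X = coarse_map a s L x" by blast
    show "X \<in> grid (s div L)" unfolding grid_def x(2) by (intro CollectI allI conjI coarse_map_bounds(1,2)[OF L x(1)])
  qed
  show "grid (s div L) \<subseteq> coarse_map a s L ` (int_cube a s :: (int ^ 'd) set)"
  proof
    fix X :: "int ^ 'd" assume X: "X \<in> grid (s div L)"
    define x :: "int ^ 'd" where "x = (\<chi> i. a + X $ i * int L)"
    have "a + X $ i * int L \<le> x $ i \<and> x $ i < a + X $ i * int L + int L" for i using L by (simp add: x_def)
    from coarse_map_base[OF L X this] show "X \<in> coarse_map a s L ` int_cube a s" by blast
  qed
qed

lemma card_block_coarse_map:
  fixes X :: "int ^ 'd::finite"
  assumes L: "0 < L" "L \<le> s"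
  shows "card (block (int_cube a s) (coarse_map a s L) {X}) \<le> (2 * L) ^ CARD('d)"
    "X \<in> grid (s div L) \<Longrightarrow> L ^ CARD('d) \<le> card (block (int_cube a s) (coarse_map a s L) {X})"
proof -
  let ?B = "block (int_cube a s) (coarse_map a s L) {X}"
  have "?B \<subseteq> int_box (\<chi> i. a + X $ i * int L) (\<chi> i. a + X $ i * int L + 2 * int L - 1)"
  proof
    fix x assume "x \<in> ?B"
    then have x: "x \<in> int_cube a s" "coarse_map a s L x = X" by (auto simp: block_def)
    show "x \<in> int_box (\<chi> i. a + X $ i * int L) (\<chi> i. a + X $ i * int L + 2 * int L - 1)"
      using coarse_map_bounds(3,4)[OF L x(1)] x(2) by (auto simp: int_box_def)
  qed
  then have "card ?B \<le> card (int_box (\<chi> i. a + X $ i * int L) (\<chi> i. a + X $ i * int L + 2 * int L - 1))"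
    by (intro card_mono) auto
  then show "card ?B \<le> (2 * L) ^ CARD('d)" by (simp add: card_int_box nat_mult_distrib)
  assume X: "X \<in> grid (s div L)"
  have "int_box (\<chi> i. a + X $ i * int L) (\<chi> i. a + X $ i * int L + int L - 1) \<subseteq> ?B"
  proof
    fix x assume "x \<in> int_box (\<chi> i. a + X $ i * int L) (\<chi> i. a + X $ i * int L + int L - 1)"
    then have "a + X $ i * int L \<le> x $ i \<and> x $ i < a + X $ i * int L + int L" for i by (auto simp: int_box_def)
    then show "x \<in> ?B" using coarse_map_base[OF L X] by (auto simp: block_def)
  qed
  then have "card (int_box (\<chi> i. a + X $ i * int L) (\<chi> i. a + X $ i * int L + int L - 1)) \<le> card ?B"
    by (intro card_mono) (auto simp: block_def)
  then show "L ^ CARD('d) \<le> card ?B" by (simp add: card_int_box)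
qed

section \<open>Edge probabilities and boundary weights on the scale of blocks\<close>

lemma edge_prob_nonneg: "0 \<le> p \<Longrightarrow> 0 \<le> edge_prob p \<alpha> \<beta> e"
  by (simp add: edge_prob_def)

lemma edge_prob_le_1:
  fixes x y :: "int ^ 'd::finite" and p \<alpha> \<beta> :: real
  assumes "0 \<le> p" "p \<le> 1" "0 \<le> \<beta>" and \<alpha>: "0 \<le> \<alpha>"
  shows "edge_prob p \<alpha> \<beta> {x, y} \<le> 1"
proof -
  have "0 \<le> min 1 (\<beta> / edge_length {x, y})" using assms by (simp add: edge_length_doubleton)
  then have "min 1 (\<beta> / edge_length {x, y}) powr (real CARD('d) * \<alpha>) \<le> 1"
    using \<alpha> by (intro powr_le1) auto
  then have "p * min 1 (\<beta> / edge_length {x, y}) powr (real CARD('d) * \<alpha>) \<le> 1 * 1"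
    using assms by (intro mult_mono) auto
  then show ?thesis by (simp add: edge_prob_def)
qed

text \<open>Points in blocks at distance R are at distance at least (R - 2) L, hence at least R L /
  2 once R \<ge> 4. For R \<le> 4 the right-hand side is at least 1, thanks to the summand
  4.\<close>

lemma edge_prob_coarse_le:
  fixes x y :: "int ^ 'd::finite" and p \<alpha> \<beta> :: real
  assumes L: "0 < L" "L \<le> s" and xy: "x \<in> int_cube a s" "y \<in> int_cube a s" "coarse_map a s L x \<noteq> coarse_map a s L y"
    and p: "0 \<le> p" "p \<le> 1" and \<beta>: "0 < \<beta>" and \<alpha>: "0 \<le> \<alpha>"
  shows "edge_prob p \<alpha> \<beta> {x, y} \<le> (4 + 2 * \<beta> / L) powr (CARD('d) * \<alpha>) *
     real (sup_norm (coarse_map a s L x - coarse_map a s L y)) powr (- (CARD('d) * \<alpha>))"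
proof -
  let ?R = "sup_norm (coarse_map a s L x - coarse_map a s L y)" and ?e = "real CARD('d) * \<alpha>"
  have e0: "0 \<le> ?e" using \<alpha> by simp
  have R0: "0 < ?R" using xy(3) sup_norm_eq_0[of "coarse_map a s L x - coarse_map a s L y"] by simp
  have form: "(4 + 2 * \<beta> / L) powr ?e * real ?R powr (- ?e) = ((4 + 2 * \<beta> / L) / ?R) powr ?e"
    using R0 \<beta> L by (subst powr_divide) (simp_all add: powr_minus_divide)
  have "edge_prob p \<alpha> \<beta> {x, y} \<le> ((4 + 2 * \<beta> / L) / ?R) powr ?e"
  proof (cases "?R \<le> 4")
    case True
    have "real ?R \<le> 4 + 2 * \<beta> / L" using True \<beta> by (simp add: add_increasing2)
    then have "1 \<le> (4 + 2 * \<beta> / L) / ?R" using R0 by (simp add: le_divide_eq)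
    then have "1 \<le> ((4 + 2 * \<beta> / L) / ?R) powr ?e" using e0 by (rule ge_one_powr_ge_zero)
    then show ?thesis using edge_prob_le_1[of p \<beta> \<alpha> x y] p \<beta> \<alpha> by linarith
  next
    case False
    obtain i where i: "?R = nat \<bar>(coarse_map a s L x - coarse_map a s L y) $ i\<bar>"
    proof -
      have "?R \<in> range (\<lambda>i. nat \<bar>(coarse_map a s L x - coarse_map a s L y) $ i\<bar>)" unfolding sup_norm_def by (intro Max_in) auto
      then show thesis using that by blast
    qed
    let ?u = "coarse_map a s L x $ i" and ?v = "coarse_map a s L y $ i"
    have bx: "a + ?u * int L \<le> x $ i" "x $ i < a + ?u * int L + 2 * int L" using coarse_map_bounds(3,4)[OF L xy(1)] by auto
    have by': "a + ?v * int L \<le> y $ i" "y $ i < a + ?v * int L + 2 * int L" using coarse_map_bounds(3,4)[OF L xy(2)] by auto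
    have R: "int ?R = \<bar>?u - ?v\<bar>" using i by simp
    have "int ?R * int L = \<bar>?u * int L - ?v * int L\<bar>" unfolding R by (simp add: abs_mult left_diff_distrib[symmetric])
    then have d1: "int ?R * int L - 2 * int L \<le> \<bar>x $ i - y $ i\<bar>" using bx by' by linarith
    define w where "w = int ?R * int L"
    have "4 * int L \<le> w" unfolding w_def using False by (intro mult_right_mono) auto
    moreover define v where "v = \<bar>x $ i - y $ i\<bar>"
    ultimately have "w \<le> 2 * v" using d1 unfolding w_def[symmetric] v_def[symmetric] by linarith
    then have "int ?R * int L \<le> 2 * \<bar>x $ i - y $ i\<bar>" unfolding w_def v_def .
    then have "real_of_int (int ?R * int L) \<le> real_of_int (2 * \<bar>x $ i - y $ i\<bar>)" by (rule of_int_le_iff[THEN iffD2])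
    then have d2: "real ?R * real L / 2 \<le> \<bar>real_of_int (x $ i) - real_of_int (y $ i)\<bar>" by simp
    also have "\<dots> \<le> norm (lattice_point x - lattice_point y)"
      using component_le_norm_cart[of "lattice_point x - lattice_point y" i] by (simp add: lattice_point_def)
    finally have len: "real ?R * real L / 2 \<le> edge_length {x, y}" by (simp add: edge_length_doubleton)
    have pos: "0 < real ?R * real L / 2" using R0 L by simp
    have "\<beta> / edge_length {x, y} \<le> \<beta> / (real ?R * real L / 2)" using len pos \<beta> by (intro divide_left_mono) auto
    also have "\<dots> = (2 * \<beta> / L) / ?R" by (simp add: field_simps)
    also have "\<dots> \<le> (4 + 2 * \<beta> / L) / ?R" using R0 by (intro divide_right_mono) auto
    finally have 1: "min 1 (\<beta> / edge_length {x, y}) \<le> (4 + 2 * \<beta> / L) / ?R" by simp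
    have 0: "0 \<le> min 1 (\<beta> / edge_length {x, y})" using len pos \<beta> by auto
    have "edge_prob p \<alpha> \<beta> {x, y} \<le> 1 * min 1 (\<beta> / edge_length {x, y}) powr ?e"
      unfolding edge_prob_def using p by (intro mult_right_mono) auto
    also have "\<dots> \<le> ((4 + 2 * \<beta> / L) / ?R) powr ?e" using 0 1 e0 by (simp add: powr_mono2)
    finally show ?thesis .
  qed
  then show ?thesis unfolding form .
qed

lemma sum_block_le:
  fixes g :: "'x \<Rightarrow> real"
  assumes A: "finite A" and fin: "finite \<Lambda>" and m: "\<And>X. card (block \<Lambda> \<phi> {X}) \<le> m" and g: "\<And>X. X \<in> A \<Longrightarrow> 0 \<le> g X"
  shows "(\<Sum>x\<in>block \<Lambda> \<phi> A. g (\<phi> x)) \<le> real m * (\<Sum>X\<in>A. g X)"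
proof -
  have finB: "finite (block \<Lambda> \<phi> A)" using fin by (simp add: block_def)
  have "(\<Sum>x\<in>block \<Lambda> \<phi> A. g (\<phi> x)) = (\<Sum>X\<in>A. \<Sum>x\<in>{x\<in>block \<Lambda> \<phi> A. \<phi> x = X}. g (\<phi> x))"
    by (rule sum.group[symmetric, OF finB A]) (auto simp: block_def)
  also have "\<dots> \<le> (\<Sum>X\<in>A. real m * g X)"
  proof (rule sum_mono)
    fix X assume X: "X \<in> A"
    have eq: "{x\<in>block \<Lambda> \<phi> A. \<phi> x = X} = block \<Lambda> \<phi> {X}" using X by (auto simp: block_def)
    have "(\<Sum>x\<in>{x\<in>block \<Lambda> \<phi> A. \<phi> x = X}. g (\<phi> x)) = (\<Sum>x\<in>{x\<in>block \<Lambda> \<phi> A. \<phi> x = X}. g X)" by (rule sum.cong) auto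
    also have "\<dots> = real (card (block \<Lambda> \<phi> {X})) * g X" unfolding eq by simp
    also have "\<dots> \<le> real m * g X" using m[of X] g[OF X] by (intro mult_right_mono) auto
    finally show "(\<Sum>x\<in>{x\<in>block \<Lambda> \<phi> A. \<phi> x = X}. g (\<phi> x)) \<le> real m * g X" .
  qed
  finally show ?thesis by (simp add: sum_distrib_left)
qed

text \<open>A block has at most (2 L)^d points; this factor is paid once for x and once for
  y.\<close>

lemma coarse_boundary_weight:
  fixes A :: "(int ^ 'd::finite) set" and p \<alpha> \<beta> C H :: real
  assumes L: "0 < L" "L \<le> s" and p: "0 \<le> p" "p \<le> 1" and \<beta>: "0 < \<beta>" and \<alpha>: "0 \<le> \<alpha>"
    and A: "A \<subseteq> grid (s div L)"
    and C: "(\<Sum>X\<in>A. \<Sum>Y\<in>grid (s div L) - A. real (sup_norm (X - Y)) powr (- (real CARD('d) * \<alpha>))) \<le> C * real (card (bdry (s div L) A))"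
    and H: "(2 * real L) ^ (2 * CARD('d)) * (4 + 2 * \<beta> / L) powr (CARD('d) * \<alpha>) * C \<le> H"
  shows "(\<Sum>x\<in>block (int_cube a s) (coarse_map a s L) A. \<Sum>y\<in>block (int_cube a s) (coarse_map a s L) (grid (s div L) - A).
     edge_prob p \<alpha> \<beta> {x, y}) \<le> H * card (bdry (s div L) A)"
proof -
  let ?G = "grid (s div L) :: (int ^ 'd) set" and ?\<Lambda> = "int_cube a s :: (int ^ 'd) set" and ?\<phi> = "coarse_map a s L :: int ^ 'd \<Rightarrow> int ^ 'd"
  let ?\<beta> = "block ?\<Lambda> ?\<phi>" and ?m = "(2 * L) ^ CARD('d)"
  let ?k = "(4 + 2 * \<beta> / L) powr (CARD('d) * \<alpha>)"
  let ?f = "\<lambda>X Y :: int ^ 'd. real (sup_norm (X - Y)) powr (- (real CARD('d) * \<alpha>))"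
  have finA: "finite A" by (rule finite_subset[OF A finite_grid])
  have m: "card (?\<beta> {X}) \<le> ?m" for X by (rule card_block_coarse_map(1)[OF L])
  have calc: "M * (\<Sum>X\<in>A. M * (\<Sum>Y\<in>B. k * f X Y)) = M * M * k * (\<Sum>X\<in>A. \<Sum>Y\<in>B. f X Y)"
    for M k :: real and B and f :: "int ^ 'd \<Rightarrow> int ^ 'd \<Rightarrow> real"
    by (simp add: sum_distrib_left mult_ac)
  have mm: "real ?m * real ?m = (2 * real L) ^ (2 * CARD('d))"
    unfolding of_nat_power of_nat_mult mult_2[of "CARD('d)"] power_add by simp
  have "(\<Sum>x\<in>?\<beta> A. \<Sum>y\<in>?\<beta> (?G - A). edge_prob p \<alpha> \<beta> {x, y}) \<le> (\<Sum>x\<in>?\<beta> A. \<Sum>y\<in>?\<beta> (?G - A). ?k * ?f (?\<phi> x) (?\<phi> y))"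
  proof (intro sum_mono)
    fix x y assume "x \<in> ?\<beta> A" "y \<in> ?\<beta> (?G - A)"
    then have "x \<in> ?\<Lambda>" "y \<in> ?\<Lambda>" "?\<phi> x \<noteq> ?\<phi> y" by (auto simp: block_def)
    then show "edge_prob p \<alpha> \<beta> {x, y} \<le> ?k * ?f (?\<phi> x) (?\<phi> y)" by (intro edge_prob_coarse_le[OF L _ _ _ p \<beta> \<alpha>])
  qed
  also have "\<dots> \<le> (\<Sum>x\<in>?\<beta> A. real ?m * (\<Sum>Y\<in>?G - A. ?k * ?f (?\<phi> x) Y))"
  proof (rule sum_mono)
    fix x
    show "(\<Sum>y\<in>?\<beta> (?G - A). ?k * ?f (?\<phi> x) (?\<phi> y)) \<le> real ?m * (\<Sum>Y\<in>?G - A. ?k * ?f (?\<phi> x) Y)"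
      by (rule sum_block_le[where g="\<lambda>Y. ?k * ?f (?\<phi> x) Y", OF _ finite_int_cube m]) simp_all
  qed
  also have "\<dots> \<le> real ?m * (\<Sum>X\<in>A. real ?m * (\<Sum>Y\<in>?G - A. ?k * ?f X Y))"
    by (rule sum_block_le[where g="\<lambda>X. real ?m * (\<Sum>Y\<in>?G - A. ?k * ?f X Y)", OF finA finite_int_cube m])
      (intro mult_nonneg_nonneg sum_nonneg, simp_all)
  also have "\<dots> = real ?m * real ?m * ?k * (\<Sum>X\<in>A. \<Sum>Y\<in>?G - A. ?f X Y)" by (rule calc)
  also have "\<dots> \<le> real ?m * real ?m * ?k * (C * card (bdry (s div L) A))"
    by (intro mult_left_mono C mult_nonneg_nonneg of_nat_0_le_iff powr_ge_zero)
  also have "\<dots> = ((2 * real L) ^ (2 * CARD('d)) * ?k * C) * card (bdry (s div L) A)"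
    unfolding mm[symmetric] by (simp only: mult.assoc)
  also have "\<dots> \<le> H * card (bdry (s div L) A)" by (intro mult_right_mono H) auto
  finally show ?thesis .
qed

lemma second_largest_cong:
  assumes "\<And>e. e \<in> pairs V \<Longrightarrow> \<omega> e = \<omega>' e"
  shows "second_largest_component \<omega> V = second_largest_component \<omega>' V"
proof -
  have eq: "\<omega> {x, y} = \<omega>' {x, y}" if "x \<in> V" "y \<in> V" "x \<noteq> y" for x y
  proof (rule assms)
    show "{x, y} \<in> pairs V" unfolding pairs_def by (intro CollectI exI[of _ x] exI[of _ y] conjI refl that)
  qed
  have "induced_adj \<omega> V = induced_adj \<omega>' V" by (auto simp: induced_adj_def eq)
  then have "component_of \<omega> V = component_of \<omega>' V" by (simp add: component_of_def fun_eq_iff)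
  then show ?thesis by (simp add: second_largest_component_def largest_component_def graph_components_def)
qed

lemma lattice_box_eq_int_cube:
  fixes n :: nat
  obtains a s where "(lattice_box n :: (int ^ 'd::finite) set) = int_cube a s"
    "real n powr (1 / CARD('d)) - 1 \<le> real s" "real s \<le> real n powr (1 / CARD('d)) + 1"
proof -
  define r where "r = real n powr (1 / CARD('d))"
  define a where "a = \<lceil>- (r / 2)\<rceil>"
  define b where "b = \<lceil>r / 2\<rceil>"
  have "0 \<le> r" by (simp add: r_def)
  then have "a \<le> b" unfolding a_def b_def by (intro ceiling_mono) auto
  then have s: "int (nat (b - a)) = b - a" by simp
  have mem: "real_of_int z \<in> {- (r / 2)..<r / 2} \<longleftrightarrow> a \<le> z \<and> z < a + int (nat (b - a))" for z
  proof -
    have "- (r / 2) \<le> real_of_int z \<longleftrightarrow> a \<le> z" unfolding a_def by (rule ceiling_le_iff[symmetric])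
    moreover have "real_of_int z < r / 2 \<longleftrightarrow> z < b" unfolding b_def by (rule less_ceiling_iff[symmetric])
    ultimately show ?thesis unfolding s by simp
  qed
  have "(lattice_box n :: (int ^ 'd) set) = int_cube a (nat (b - a))"
    unfolding lattice_box_def int_cube_def r_def[symmetric] mem ..
  moreover have rs: "real (nat (b - a)) = real_of_int b - real_of_int a" using s by (metis of_int_diff of_int_of_nat_eq)
  moreover have "r - 1 \<le> real_of_int b - real_of_int a" unfolding a_def b_def by linarith
  moreover have "real_of_int b - real_of_int a \<le> r + 1" unfolding a_def b_def by linarith
  ultimately show thesis using that[of a "nat (b - a)"] unfolding r_def by simp
qed

lemma card_cut_edges:
  assumes "finite U" "W \<subseteq> U"
  shows "card (cut_edges U W) = card W * card (U - W)"
proof -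
  have inj: "inj_on (\<lambda>(x, y). {x, y}) (W \<times> (U - W))"
    by (auto simp: inj_on_def doubleton_eq_iff)
  have "cut_edges U W = (\<lambda>(x, y). {x, y}) ` (W \<times> (U - W))"
  proof (intro set_eqI iffI)
    fix e assume "e \<in> cut_edges U W"
    then obtain x y where "e = {x, y}" "x \<in> W" "y \<in> U - W" unfolding cut_edges_def by (elim CollectE exE conjE)
    then show "e \<in> (\<lambda>(x, y). {x, y}) ` (W \<times> (U - W))" by (intro image_eqI[of _ _ "(x, y)"]) simp_all
  next
    fix e assume "e \<in> (\<lambda>(x, y). {x, y}) ` (W \<times> (U - W))"
    then obtain z where z: "e = (\<lambda>(x, y). {x, y}) z" "z \<in> W \<times> (U - W)" by (elim imageE)
    show "e \<in> cut_edges U W" unfolding cut_edges_def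
      by (intro CollectI exI[of _ "fst z"] exI[of _ "snd z"]) (use z in \<open>simp add: case_prod_unfold mem_Times_iff\<close>)
  qed
  then have "card (cut_edges U W) = card (W \<times> (U - W))" using card_image[OF inj] by simp
  then show ?thesis by (simp add: card_cartesian_product)
qed

text \<open>A cut into w and card U - w vertices has w (card U - w) edges, and one side has at least
  h vertices. With y = x^h its weight is thus at most y to the size of the other side. By symmetry
  both cases sum to at most (1 + y)^(card U) - 1, which is at most 2 V y.\<close>

lemma dense_bad_prob:
  fixes U :: "'v set" and x :: real
  assumes U: "finite U" and x: "0 \<le> x" "x \<le> 1"
    and p: "\<And>e. e \<in> pairs U \<Longrightarrow> p e \<le> 1 \<and> 1 - p e \<le> x"
    and h: "2 * h \<le> card U" and V: "real (card U) \<le> V" "4 * V * x ^ h \<le> 1"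
  shows "(\<Sum>W\<in>cut_sets U. \<Prod>e\<in>cut_edges U W. 1 - p e) \<le> 4 * V * x ^ h"
proof -
  define y where "y = x ^ h"
  have y: "0 \<le> y" using x by (simp add: y_def)
  have finP: "finite (Pow U)" using U by simp
  have pow: "(\<Sum>W\<in>Pow U. y ^ card W) = (1 + y) ^ card U"
    using sum_Pow_prod[OF U, of "\<lambda>_. y"] by simp
  have "(\<Sum>W\<in>cut_sets U. \<Prod>e\<in>cut_edges U W. 1 - p e) \<le> (\<Sum>W\<in>cut_sets U. y ^ card W + y ^ card (U - W))"
  proof (rule sum_mono)
    fix W assume W: "W \<in> cut_sets U"
    then have WU: "W \<subseteq> U" by (simp add: cut_sets_def)
    have finW: "finite W" by (rule finite_subset[OF WU U])
    have cc: "card U = card W + card (U - W)" using card_Diff_subset[OF finW WU] card_mono[OF U WU] by simp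
    have "(\<Prod>e\<in>cut_edges U W. 1 - p e) \<le> (\<Prod>e\<in>cut_edges U W. x)"
    proof (rule prod_mono)
      fix e assume "e \<in> cut_edges U W"
      then have "e \<in> pairs U" using cut_edges_subset_pairs[OF WU] by blast
      then show "0 \<le> 1 - p e \<and> 1 - p e \<le> x" using p by auto
    qed
    also have "\<dots> = x ^ (card W * card (U - W))" using card_cut_edges[OF U WU] by simp
    also have "\<dots> \<le> y ^ card W + y ^ card (U - W)"
    proof (cases "h \<le> card (U - W)")
      case True
      then have "x ^ (card W * card (U - W)) \<le> x ^ (h * card W)" using x by (intro power_decreasing) (simp_all add: mult.commute)
      also have "\<dots> = y ^ card W" by (simp add: y_def power_mult)
      finally show ?thesis using y by (simp add: add_increasing2)
    next
      case False
      then have "h \<le> card W" using h cc by linarith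
      then have "x ^ (card W * card (U - W)) \<le> x ^ (h * card (U - W))" using x by (intro power_decreasing) (simp_all add: mult_right_mono)
      also have "\<dots> = y ^ card (U - W)" by (simp add: y_def power_mult)
      finally show ?thesis using y by (simp add: add_increasing)
    qed
    finally show "(\<Prod>e\<in>cut_edges U W. 1 - p e) \<le> y ^ card W + y ^ card (U - W)" .
  qed
  also have "\<dots> = (\<Sum>W\<in>cut_sets U. y ^ card W) + (\<Sum>W\<in>cut_sets U. y ^ card (U - W))" by (rule sum.distrib)
  also have "(\<Sum>W\<in>cut_sets U. y ^ card (U - W)) = (\<Sum>W\<in>cut_sets U. y ^ card W)"
    by (rule sum.reindex_bij_witness[where i="\<lambda>W. U - W" and j="\<lambda>W. U - W"])
       (auto simp: cut_sets_def double_diff)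
  also have "(\<Sum>W\<in>cut_sets U. y ^ card W) \<le> (\<Sum>W\<in>Pow U - {{}}. y ^ card W)"
    using U y by (intro sum_mono2) (auto simp: cut_sets_def)
  also have "\<dots> = (1 + y) ^ card U - 1" using pow finP by (subst sum_diff1) auto
  also have "\<dots> \<le> 2 * V * y"
  proof -
    have Vy: "V * y \<le> 1 / 4" using V(2) by (simp add: y_def)
    have "(1 + y) ^ card U \<le> exp y ^ card U" using y by (intro power_mono exp_ge_add_one_self) auto
    also have "\<dots> = exp (card U * y)" by (rule exp_of_nat_mult[symmetric])
    also have "\<dots> \<le> exp (V * y)" using V(1) y by (simp add: mult_right_mono)
    also have "\<dots> \<le> 1 + V * y + (V * y)\<^sup>2" using V Vy y by (intro exp_bound) auto
    also have "(V * y)\<^sup>2 \<le> V * y" unfolding power2_eq_square using V(1) Vy y by (intro mult_left_le) auto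
    finally show ?thesis by simp
  qed
  finally show ?thesis by (simp add: y_def)
qed

section \<open>Elementary estimates for the final bound\<close>

lemma real_power_powr: "0 < x \<Longrightarrow> (x powr a) ^ n = x powr (a * real n)" for x :: real
  by (simp only: powr_powr[symmetric]) (simp add: powr_realpow)

text \<open>Turns the logarithmic condition into a linear one with a prescribed factor K: either ln
  n > K and the logarithm yields the factor, or n is at most exp K and k is too large for
  \<open>kn\<close>.\<close>

lemma volume_condition:
  fixes K k e :: real
  assumes K: "1 \<le> K" and e: "1 \<le> e" and n: "2 \<le> n" and k: "exp K * ln 2 powr (- e) < k"
    and kn: "k \<le> real n * ln (real n) powr (- e)"
  shows "K * k \<le> real n"
proof (cases "ln (real n) \<le> K")
  case True
  have l2: "0 < ln (2::real)" "ln 2 \<le> ln (real n)" using n by auto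
  have "real n = exp (ln (real n))" using n by simp
  then have "real n \<le> exp K" using True by (metis exp_le_cancel_iff)
  moreover have "ln (real n) powr (- e) \<le> ln 2 powr (- e)" using l2 e by (intro powr_mono2') auto
  ultimately have "real n * ln (real n) powr (- e) \<le> exp K * ln 2 powr (- e)" by (intro mult_mono) auto
  then show ?thesis using k kn by linarith
next
  case False
  then have l: "K < ln (real n)" "1 \<le> ln (real n)" using K by linarith+
  have "ln (real n) powr (- e) \<le> ln (real n) powr (- 1)" using l e by (intro powr_mono) auto
  then have "k \<le> real n * ln (real n) powr (- 1)"
    by (intro order_trans[OF kn] mult_left_mono) auto
  also have "\<dots> = real n / ln (real n)" using l by (simp add: powr_minus divide_inverse)
  finally have "ln (real n) * k \<le> real n" using l by (simp add: field_simps)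
  moreover have "0 \<le> exp K * ln 2 powr (- e)" by simp
  then have "K * k \<le> ln (real n) * k" using k l by (intro mult_right_mono) linarith+
  ultimately show ?thesis by linarith
qed

text \<open>The rates are doubled so that one factor exp(-\<kappa>) can be spent on the constant
  2^(d+3), which is at most exp(d + 3). The factor ln n is bounded below by ln 2 \<ge> 1/2.\<close>

lemma final_estimate:
  fixes n d :: nat and N \<kappa> :: real
  assumes n: "2 \<le> n" and N: "0 \<le> N" "N \<le> 2 ^ d * real n" and s: "0 \<le> s" "s \<le> 1"
    and a: "2 * \<kappa> \<le> a" and b: "2 * \<kappa> \<le> b" and \<kappa>: "real d + 3 \<le> \<kappa>"
  shows "2 * (exp (- a) * (N * s)) + exp (- b) \<le> real n * ln (real n) * exp (- \<kappa>)"
proof -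
  have "(2::real) ^ (d + 3) \<le> exp 1 ^ (d + 3)" using exp_ge_add_one_self[of 1] by (intro power_mono) auto
  also have "\<dots> = exp (real (d + 3))" by (simp flip: exp_of_nat_mult)
  also have "\<dots> \<le> exp \<kappa>" using \<kappa> by simp
  finally have two: "2 ^ (d + 3) * exp (- \<kappa>) \<le> 1" by (simp add: exp_minus field_simps)
  have "2 * (exp (- a) * (N * s)) + exp (- b) \<le> 2 * (exp (- (2 * \<kappa>)) * (2 ^ d * real n * 1)) + exp (- (2 * \<kappa>))"
    using a b N s by (intro add_mono mult_left_mono mult_mono) auto
  also have "\<dots> \<le> 2 * (exp (- (2 * \<kappa>)) * (2 ^ d * real n)) + exp (- (2 * \<kappa>)) * (2 * 2 ^ d * real n)"
  proof -
    have "1 * 1 \<le> 2 ^ d * real n" using n by (intro mult_mono) auto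
    then have "1 \<le> 2 * 2 ^ d * real n" by simp
    then have "exp (- (2 * \<kappa>)) * 1 \<le> exp (- (2 * \<kappa>)) * (2 * 2 ^ d * real n)" by (intro mult_left_mono) auto
    then show ?thesis by linarith
  qed
  also have "\<dots> = real n * (2 ^ (d + 3) * exp (- \<kappa>)) * (1 / 2) * exp (- \<kappa>)"
  proof -
    have "exp (- (2 * \<kappa>)) = exp (- \<kappa>) * exp (- \<kappa>)" by (simp flip: exp_add)
    then show ?thesis by (simp add: power_add)
  qed
  also have "\<dots> \<le> real n * 1 * ln (real n) * exp (- \<kappa>)"
  proof (intro mult_right_mono mult_mono mult_left_mono two)
    have "1 / 2 \<le> ln (2::real)" using ln2_ge_two_thirds by linarith
    also have "\<dots> \<le> ln (real n)" using n by simp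
    finally show "1 / 2 \<le> ln (real n)" .
  qed auto
  finally show ?thesis by simp
qed

section \<open>The bound for a fixed coarse-graining\<close>

text \<open>Fixes the constants for blocks of side L. The exponent 4d in \<open>q\<rho>\<close> is
  2d for passing to a matching times 2 for edges shared by two contours.\<close>

lemma core_bound:
  fixes \<alpha> \<beta> p q H CS CL :: real and L :: nat
  assumes d2: "CARD('d::finite) \<ge> 2" and \<alpha>: "0 \<le> \<alpha>"
    and CS: "1 \<le> CS" "\<And>z t (Y :: int ^ 'd). 0 \<le> z \<Longrightarrow> CS * z \<le> 1 \<Longrightarrow>
        (\<Sum>A\<in>{A\<in>contours t. Y \<in> A}. z ^ card (bdry t A)) \<le> CS * z"
    and CL: "\<And>t A. A \<subseteq> (grid t :: (int ^ 'd) set) \<Longrightarrow>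
        (\<Sum>X\<in>A. \<Sum>Y\<in>grid t - A. real (sup_norm (X - Y)) powr (- (real CARD('d) * \<alpha>))) \<le> CL * real (card (bdry t A))"
    and L: "0 < L" and p: "0 < p" "p \<le> 1" and \<beta>: "0 < \<beta>" and q: "0 \<le> q"
    and H: "0 \<le> H" "(2 * real L) ^ (2 * CARD('d)) * (4 + 2 * \<beta> / L) powr (CARD('d) * \<alpha>) * CL \<le> H"
    and q\<rho>: "q \<le> (exp (- 1 - 2 * real (perim_const CARD('d)) * (2 * real L) ^ (CARD('d) - 1)) /
        (CS * (2 ^ (CARD('d) + 3) + H))) ^ (4 * CARD('d))"
    and bad: "\<And>a s x i. L \<le> s \<Longrightarrow> x \<in> (grid (s div L) :: (int ^ 'd) set) \<Longrightarrow> x + unit i \<in> grid (s div L) \<Longrightarrow>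
       (\<Sum>W\<in>cut_sets (block_pair (int_cube a s) (coarse_map a s L) (x, i)).
         \<Prod>e\<in>cut_edges (block_pair (int_cube a s) (coarse_map a s L) (x, i)) W. 1 - edge_prob p \<alpha> \<beta> e) \<le> q"
  shows "\<forall>\<^sub>F k :: real in at_top. \<forall>n\<ge>2.
              real n * ln (real n) powr (- (2 * real CARD('d) / (real CARD('d) - 1))) \<ge> k \<longrightarrow>
              \<P>(\<omega> in lrp p \<alpha> \<beta>.
                  real (card (second_largest_component \<omega> (lattice_box n :: (int ^ 'd) set))) \<ge> k)
                \<le> real n * ln (real n) *
                   exp (- (k powr ((real CARD('d) - 1) / real CARD('d))))"
proof -
  define d where "d = CARD('d)"
  have d: "2 \<le> d" using d2 by (simp add: d_def)
  define P where "P = real (perim_const d)"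
  define I where "I = real (iso_const d)"
  have P1: "1 \<le> P"
  proof -
    have "0 < perim_const d" using d by (simp add: perim_const_def iso_const_def)
    then show ?thesis by (simp add: P_def)
  qed
  have I1: "1 \<le> I"
  proof -
    have "0 < iso_const d" using d by (simp add: iso_const_def)
    then show ?thesis by (simp add: I_def)
  qed
  \<comment> \<open>Chosen to give \<open>A1\<close>, that is, \<mu> l^(d-1) / P \<ge> 2 \<kappa>.
    The factor 2 is used up in \<open>final_estimate\<close>, and (2 L)^(d-1) compensates for
    counting blocks instead of vertices.\<close>
  define \<mu> where "\<mu> = 2 * P * (2 * real L) ^ (d - 1)"
  have \<mu>0: "0 \<le> \<mu>" using P1 by (simp add: \<mu>_def)
  define \<rho> where "\<rho> = exp (- 1 - \<mu>) / (CS * (2 ^ (d + 3) + H))"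
  have den: "1 \<le> CS * (2 ^ (d + 3) + H)"
  proof -
    have "(1::real) \<le> 2 ^ (d + 3)" by simp
    then have "1 * 1 \<le> CS * (2 ^ (d + 3) + H)" using CS(1) H(1) by (intro mult_mono) linarith+
    then show ?thesis by simp
  qed
  have \<rho>0: "0 < \<rho>" using den by (simp add: \<rho>_def)
  have \<rho>1: "\<rho> \<le> 1"
  proof -
    have "exp (- 1 - \<mu>) \<le> 1" using \<mu>0 by simp
    then have "exp (- 1 - \<mu>) \<le> CS * (2 ^ (d + 3) + H)" using den by linarith
    then show ?thesis unfolding \<rho>_def using den by (intro divide_le_eq_1_pos[THEN iffD2]) linarith+
  qed
  have q\<rho>': "q \<le> \<rho> ^ (4 * d)" using q\<rho> unfolding \<rho>_def \<mu>_def P_def d_def by simp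
  have q1: "q \<le> 1" using q\<rho>' power_le_one[of \<rho> "4 * d"] \<rho>0 \<rho>1 by linarith
  have q2: "q powr (1 / (2 * d)) \<le> \<rho>\<^sup>2"
  proof -
    have "q powr (1 / (2 * d)) \<le> (\<rho> ^ (4 * d)) powr (1 / (2 * d))" using q q\<rho>' by (intro powr_mono2) auto
    also have "\<dots> = \<rho> powr (real (4 * d) * (1 / (2 * d)))" using \<rho>0 by (simp only: powr_powr[symmetric]) (simp add: powr_realpow[symmetric])
    also have "real (4 * d) * (1 / (2 * d)) = real 2" using d by simp
    also have "\<rho> powr real 2 = \<rho>\<^sup>2" using \<rho>0 by (rule powr_realpow)
    finally show ?thesis .
  qed
  \<comment> \<open>The contour sum is tuned to this value: \<open>s0 * H \<le> 1\<close> controls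
    the links, and s0 \<le> 2^-(d+3) keeps the volume enclosed by bad contours below D on
    average.\<close>
  define s0 where "s0 = 1 / (2 ^ (d + 3) + H)"
  have Hpos: "0 < 2 ^ (d + 3) + H" using H(1) by (simp add: add_pos_nonneg)
  have z: "CS * (\<rho> * exp (1 + \<mu>)) = s0"
  proof -
    have "\<rho> * exp (1 + \<mu>) = 1 / (CS * (2 ^ (d + 3) + H))" by (simp add: \<rho>_def flip: exp_add)
    then show ?thesis using CS(1) by (simp add: s0_def)
  qed
  have s00: "0 \<le> s0" "s0 * H \<le> 1" "s0 \<le> 1 / 2 ^ (d + 3)" "s0 \<le> 1"
  proof -
    show "0 \<le> s0" using Hpos by (simp add: s0_def)
    show "s0 * H \<le> 1" using Hpos by (simp add: s0_def divide_le_eq)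
    show "s0 \<le> 1 / 2 ^ (d + 3)" unfolding s0_def using H(1) by (intro divide_left_mono) (auto intro!: mult_pos_pos Hpos)
    also have "\<dots> \<le> 1" by simp
    finally show "s0 \<le> 1" .
  qed
  \<comment> \<open>The number of blocks per unit of k that makes the Chernoff exponent in
    \<open>A2\<close> at least 2 \<kappa>.\<close>
  define K1 where "K1 = 3 * 2 ^ (2 * d + 5) * I * (2 * real L) ^ (d - 1)"
  have L1: "1 \<le> real L" using L by simp
  have K1: "2 ^ (d + 2) \<le> K1" "6 \<le> K1"
  proof -
    have a: "1 \<le> I * (2 * real L) ^ (d - 1)"
    proof -
      have "1 * 1 \<le> I * (2 * real L) ^ (d - 1)" using I1 L1 by (intro mult_mono one_le_power) auto
      then show ?thesis by simp
    qed
    have "3 * 2 ^ (2 * d + 5) * 1 \<le> 3 * 2 ^ (2 * d + 5) * (I * (2 * real L) ^ (d - 1))" using a by (intro mult_left_mono) auto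
    then have b: "3 * 2 ^ (2 * d + 5) \<le> K1" by (simp add: K1_def mult.assoc)
    have "(2::real) ^ (d + 2) \<le> 2 ^ (2 * d + 5)" by (intro power_increasing) auto
    moreover have p: "(0::real) < 2 ^ (2 * d + 5)" by simp
    ultimately show "2 ^ (d + 2) \<le> K1" using b by linarith
    have "(2::real) ^ 1 \<le> 2 ^ (2 * d + 5)" by (intro power_increasing) auto
    then have "(2::real) \<le> 2 ^ (2 * d + 5)" by (simp only: power_one_right)
    then show "6 \<le> K1" using b by linarith
  qed
  \<comment> \<open>The grid has at least n / (4 L)^d blocks, so K2 k \<le> n yields K1 k
    blocks.\<close>
  define K2 where "K2 = K1 * (4 * real L) ^ d"
  have L4: "1 \<le> (4 * real L) ^ d" using L1 by (intro one_le_power) auto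
  have K2: "1 \<le> K2" "(4 * real L) ^ d \<le> K2"
  proof -
    have "1 * (4 * real L) ^ d \<le> K1 * (4 * real L) ^ d" using K1 by (intro mult_right_mono) auto
    then show "(4 * real L) ^ d \<le> K2" unfolding K2_def by (simp only: mult_1)
    then show "1 \<le> K2" using L4 by linarith
  qed
  define e where "e = 2 * real d / (real d - 1)"
  have e1: "1 \<le> e" using d by (simp add: e_def field_simps)
  \<comment> \<open>The square gives \<kappa> \<ge> d + 3, because (d - 1)/d \<ge> 1/2; the other
    term serves \<open>volume_condition\<close>.\<close>
  define k0 where "k0 = max ((real d + 3)\<^sup>2) (exp K2 * ln 2 powr (- e) + 1)"
  have main: "\<P>(\<omega> in lrp p \<alpha> \<beta>. k \<le> real (card (second_largest_component \<omega> (lattice_box n :: (int ^ 'd) set))))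
       \<le> real n * ln (real n) * exp (- (k powr ((real d - 1) / real d)))"
    if k: "k0 \<le> k" and n: "2 \<le> n" and kn: "k \<le> real n * ln (real n) powr (- e)" for k :: real and n :: nat
  proof -
    have kd: "(real d + 3)\<^sup>2 \<le> k" using k by (simp add: k0_def)
    have k1: "1 \<le> k"
    proof -
      have "(1::real)\<^sup>2 \<le> (real d + 3)\<^sup>2" by (intro power_mono) auto
      then have "1 \<le> (real d + 3)\<^sup>2" by (simp only: power_one)
      then show ?thesis using kd by linarith
    qed
    have nK: "K2 * k \<le> real n"
      by (rule volume_condition[OF K2(1) e1 n _ kn]) (use k in \<open>simp add: k0_def\<close>)
    define r where "r = real n powr (1 / d)"
    have rd: "r ^ d = real n"
    proof -
      have "r ^ d = real n powr (1 / d * real d)" unfolding r_def using n by (intro real_power_powr) simp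
      then show ?thesis using d n by simp
    qed
    have r0: "0 \<le> r" by (simp add: r_def)
    have r4: "4 * real L \<le> r"
    proof (rule ccontr)
      assume "\<not> ?thesis"
      then have "r ^ d < (4 * real L) ^ d" using r0 d by (intro power_strict_mono) auto
      moreover have "(4 * real L) ^ d * 1 \<le> K2 * k" using K2 k1 L4 by (intro mult_mono) auto
      ultimately show False using nK rd by linarith
    qed
    obtain a s where as: "(lattice_box n :: (int ^ 'd) set) = int_cube a s" "r - 1 \<le> real s" "real s \<le> r + 1"
      using lattice_box_eq_int_cube[of n, where 'd='d] unfolding r_def d_def by blast
    have Ls: "L \<le> s"
    proof -
      have "real L \<le> real s" using as(2) r4 L1 by linarith
      then show ?thesis by simp
    qed
    define t where "t = s div L"
    define \<phi> :: "int ^ 'd \<Rightarrow> int ^ 'd" where "\<phi> = coarse_map a s L"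
    define \<Lambda> :: "(int ^ 'd) set" where "\<Lambda> = int_cube a s"
    define N where "N = t ^ d"
    have tr: "r / (4 * real L) \<le> real t"
    proof -
      have "real s < (real t + 1) * real L"
      proof -
        have "s < L + L * (s div L)" by (rule dividend_less_times_div[OF L])
        then have "s < (t + 1) * L" by (simp add: t_def algebra_simps)
        then have "real s < real ((t + 1) * L)" by (rule of_nat_less_iff[THEN iffD2])
        then show ?thesis by (simp add: algebra_simps)
      qed
      then have "r \<le> 1 + real t * real L + real L" using as(2) by (simp add: algebra_simps)
      then have "r \<le> 4 * (real t * real L)" using r4 L1 by linarith
      then show ?thesis using L1 by (simp add: divide_le_eq mult_ac)
    qed
    have Nn: "K1 * k \<le> real N"
    proof -
      have "K1 * k * (4 * real L) ^ d \<le> r ^ d" using nK rd by (simp add: K2_def mult_ac)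
      then have "K1 * k \<le> r ^ d / (4 * real L) ^ d" using L1 by (simp add: le_divide_eq)
      also have "\<dots> = (r / (4 * real L)) ^ d" by (simp add: power_divide)
      also have "\<dots> \<le> real t ^ d" using tr r0 by (intro power_mono) auto
      finally show ?thesis by (simp add: N_def)
    qed
    have Nup: "real N \<le> 2 ^ d * real n"
    proof -
      have "real t \<le> real s" by (simp add: t_def)
      also have "\<dots> \<le> 2 * r" using as(3) r4 L1 by linarith
      finally have "real t ^ d \<le> (2 * r) ^ d" by (intro power_mono) auto
      then show ?thesis by (simp add: N_def power_mult_distrib rd)
    qed
    define kk where "kk = nat \<lceil>k\<rceil>"
    have kk: "k \<le> real kk" "real kk \<le> k + 1" "0 < kk" using k1 by (auto simp: kk_def)
    define m where "m = (2 * L) ^ d"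
    have m0: "0 < m" using L by (simp add: m_def)
    \<comment> \<open>The ceiling of kk / m, the number of blocks of at most m points needed to hold
      kk vertices.\<close>
    define k' where "k' = (kk - 1) div m + 1"
    have k'k: "real k' \<le> 2 * k"
    proof -
      have "k' \<le> kk" using kk(3) div_le_dividend[of "kk - 1" m] unfolding k'_def by linarith
      then have "real k' \<le> real kk" by simp
      then show ?thesis using kk k1 by linarith
    qed
    have "k' - 1 = (kk - 1) div m" by (simp add: k'_def)
    then have "m * (k' - 1) \<le> kk - 1" by (simp only: times_div_less_eq_dividend)
    then have k'm: "m * (k' - 1) < kk" using kk(3) by linarith
    have kkm: "kk \<le> m * k'"
    proof -
      have "kk - 1 < m + m * ((kk - 1) div m)" by (rule dividend_less_times_div[OF m0])
      also have "\<dots> = m * k'" by (simp add: k'_def)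
      finally show ?thesis by linarith
    qed
    have k'0: "0 < k'" by (simp add: k'_def)
    have k'N: "2 * k' \<le> N"
    proof -
      have "6 * k \<le> K1 * k" using K1(2) k1 by (intro mult_right_mono) auto
      then have "2 * real k' \<le> real N" using k'k Nn k1 by linarith
      then have "real (2 * k') \<le> real N" by (simp only: of_nat_mult of_nat_numeral)
      then show ?thesis by (rule of_nat_le_iff[THEN iffD1])
    qed
    define l where "l = cube_side d k'"
    have l0: "0 < l" unfolding l_def using d k'0 by (intro cube_side_pos) auto
    \<comment> \<open>The largest D for which D blocks of (2 L)^d points make up at most half of N
      L^d, a lower bound for the number of vertices.\<close>
    define D where "D = N div 2 ^ (d + 1)"
    have D1: "D * 2 ^ (d + 1) \<le> N" unfolding D_def by (rule div_times_less_eq_dividend)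
    have N2: "2 ^ (d + 2) \<le> real N"
    proof -
      have "2 ^ (d + 2) * 1 \<le> K1 * k" using K1 k1 by (intro mult_mono) auto
      then show ?thesis using Nn by linarith
    qed
    \<comment> \<open>In units of N / 2^(d+3), D is more than 4 minus the rounding error 1, which is
      at most 2 units by \<open>N2\<close>, and N s0 is at most 1 unit.\<close>
    have Ds: "real N / 2 ^ (d + 3) \<le> real D - real N * s0"
    proof -
      have "N < 2 ^ (d + 1) + 2 ^ (d + 1) * (N div 2 ^ (d + 1))" by (rule dividend_less_times_div) simp
      also have "\<dots> = (D + 1) * 2 ^ (d + 1)" by (simp add: D_def)
      finally have "N < (D + 1) * 2 ^ (d + 1)" .
      then have "real N < real ((D + 1) * 2 ^ (d + 1))" by (rule of_nat_less_iff[THEN iffD2])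
      then have "real N < (real D + 1) * 2 ^ (d + 1)"
        by (simp only: of_nat_mult of_nat_add of_nat_1 of_nat_power of_nat_numeral)
      then have "real N / 2 ^ (d + 1) < real D + 1"
        by (simp only: pos_divide_less_eq zero_less_power zero_less_numeral)
      moreover have "1 \<le> real N / 2 ^ (d + 2)" using N2 by (simp add: le_divide_eq)
      moreover have "real N * s0 \<le> real N / 2 ^ (d + 3)" using mult_left_mono[OF s00(3), of "real N"] by simp
      moreover have "real N / 2 ^ (d + 1) = 4 * (real N / 2 ^ (d + 3))" "real N / 2 ^ (d + 2) = 2 * (real N / 2 ^ (d + 3))"
        by (simp_all add: power_add)
      ultimately show ?thesis by linarith
    qed
    interpret C: coarse \<Lambda> \<phi> t "edge_prob p \<alpha> \<beta>" q \<rho> \<mu> s0 H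
    proof
      show "finite \<Lambda>" by (simp add: \<Lambda>_def)
      show "\<phi> ` \<Lambda> = grid t" unfolding \<phi>_def \<Lambda>_def t_def by (rule coarse_map_onto[OF L Ls])
      show "0 \<le> edge_prob p \<alpha> \<beta> e" for e :: "(int ^ 'd) set" using p by (intro edge_prob_nonneg) simp
      show "edge_prob p \<alpha> \<beta> e \<le> 1" if e: "e \<in> pairs \<Lambda>" for e :: "(int ^ 'd) set"
      proof -
        obtain x y where "e = {x, y}" using e by (auto simp: pairs_def)
        then show ?thesis using edge_prob_le_1[of p \<beta> \<alpha> x y] p \<beta> \<alpha> by simp
      qed
      show "(\<Sum>W\<in>cut_sets (block_pair \<Lambda> \<phi> (x, i)). \<Prod>e\<in>cut_edges (block_pair \<Lambda> \<phi> (x, i)) W. 1 - edge_prob p \<alpha> \<beta> e) \<le> q"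
        if "x \<in> grid t" "x + unit i \<in> grid t" for x i
        using bad[OF Ls, of x i a] that unfolding \<phi>_def \<Lambda>_def t_def by simp
      show "q powr (1 / real (2 * CARD('d))) \<le> \<rho>\<^sup>2" using q2 by (simp add: d_def)
      show "(\<Sum>A\<in>{A\<in>contours t. Y \<in> A}. (\<rho> * exp (1 + \<mu>)) ^ card (bdry t A)) \<le> s0" for Y :: "int ^ 'd"
        unfolding z[symmetric] using \<rho>0 s00 z by (intro CS(2)) auto
      show "(\<Sum>x\<in>block \<Lambda> \<phi> A. \<Sum>y\<in>block \<Lambda> \<phi> (grid t - A). edge_prob p \<alpha> \<beta> {x, y}) \<le> H * real (card (bdry t A))"
        if A: "A \<subseteq> grid t" for A :: "(int ^ 'd) set"
        unfolding \<phi>_def \<Lambda>_def t_def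
        by (rule coarse_boundary_weight[OF L Ls _ p(2) \<beta> \<alpha> _ CL H(2)]) (use A p in \<open>simp_all add: t_def\<close>)
    qed (use q q1 \<rho>0 \<rho>1 \<mu>0 s00 in auto)
    have bound: "C.Prob {\<eta>. kk \<le> card (second_largest_component \<eta> \<Lambda>)} \<le>
       2 * (exp (- (\<mu> * (real (l ^ (d - 1)) / P))) * (real (t ^ CARD('d)) * s0)) +
         exp (- (1 / (I * l) * (real D - real (t ^ CARD('d)) * s0)))"
    proof (rule C.prob_second_component_le)
      show "card (block \<Lambda> \<phi> {X}) \<le> m" for X
        unfolding \<phi>_def \<Lambda>_def m_def d_def by (rule card_block_coarse_map(1)[OF L Ls])
      have "D * 2 \<le> D * 2 ^ (d + 1)" by (intro mult_left_mono) auto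
      then have "2 * D \<le> N" using D1 by linarith
      then show "2 * D \<le> t ^ CARD('d)" unfolding N_def d_def .
      have "2 * m * D = L ^ d * (D * 2 ^ (d + 1))" by (simp add: m_def power_mult_distrib)
      also have "\<dots> \<le> L ^ d * N" using D1 by (intro mult_left_mono) auto
      also have "\<dots> = (t * L) ^ d" by (simp add: N_def power_mult_distrib)
      also have "\<dots> \<le> s ^ d" unfolding t_def by (intro power_mono div_times_less_eq_dividend) auto
      finally show "2 * m * D \<le> card \<Lambda>" by (simp add: \<Lambda>_def card_int_cube d_def)
      have "6 * 1 \<le> K1 * k" using K1(2) k1 by (intro mult_mono) auto
      then have "3 \<le> N" using Nn by linarith
      then show "3 \<le> t ^ CARD('d)" unfolding N_def d_def .
      show "0 < kk" "m * (k' - 1) < kk" "0 < k'" by fact+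
      show "real (l ^ (d - 1)) / P \<le> (\<Sum>A\<in>F. real (card (bdry t A)))"
        if F: "F \<subseteq> contours t" "k' \<le> (\<Sum>A\<in>F. card A)" for F :: "(int ^ 'd) set set"
      proof -
        have "l ^ (d - 1) \<le> perim_const d * (\<Sum>A\<in>F. card (bdry t A))" unfolding l_def d_def
        proof (rule perimeter_bound)
          show "finite F" by (rule finite_subset[OF F(1) finite_contours])
          show "2 * k' \<le> t ^ CARD('d)" using k'N by (simp add: N_def d_def)
        qed (use F k'0 in \<open>auto simp: contours_def\<close>)
        then have "real (l ^ (d - 1)) \<le> real (perim_const d * (\<Sum>A\<in>F. card (bdry t A)))" by (rule of_nat_le_iff[THEN iffD2])
        then have "real (l ^ (d - 1)) \<le> P * (\<Sum>A\<in>F. real (card (bdry t A)))" by (simp add: P_def)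
        then show ?thesis using P1 by (simp add: divide_le_eq mult.commute)
      qed
      show "0 \<le> 1 / (I * l)" using I1 by simp
      show "1 / (I * real l) * real (card A) \<le> real (card (bdry t A))"
        if A: "A \<in> contours t" "card A < k'" for A :: "(int ^ 'd) set"
      proof -
        have "card A \<le> iso_const d * l * card (bdry t A)" unfolding l_def d_def
          by (rule iso_cube_side) (use A k'N in \<open>auto simp: contours_def N_def d_def\<close>)
        then have "real (card A) \<le> real (iso_const d * l * card (bdry t A))" by (rule of_nat_le_iff[THEN iffD2])
        then have "real (card A) \<le> I * real l * real (card (bdry t A))" by (simp add: I_def)
        then show ?thesis using I1 l0 by (simp add: divide_le_eq mult_ac)
      qed
    qed
    define \<kappa> where "\<kappa> = k powr ((real d - 1) / real d)"
    have l2: "2 * k' \<le> l ^ d" unfolding l_def using d by (intro cube_side_ge) auto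
    have lup: "l ^ d \<le> 2 ^ (d + 1) * k'" unfolding l_def using d k'0 by (intro cube_side_upper) auto
    have \<kappa>l: "\<kappa> \<le> (2 * real L) ^ (d - 1) * real l ^ (d - 1)"
    proof -
      have "k' \<le> l ^ d" using l2 by linarith
      then have "m * k' \<le> m * l ^ d" by (rule mult_le_mono2)
      then have "kk \<le> m * l ^ d" using kkm by linarith
      then have "real kk \<le> real (m * l ^ d)" by (rule of_nat_le_iff[THEN iffD2])
      then have "k \<le> (2 * real L * real l) ^ d" using kk(1) by (simp add: m_def power_mult_distrib)
      then have "\<kappa> \<le> ((2 * real L * real l) ^ d) powr ((real d - 1) / real d)"
        unfolding \<kappa>_def using k1 d by (intro powr_mono2) auto
      also have "\<dots> = (2 * real L * real l) powr (real d * ((real d - 1) / real d))"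
        using L1 l0 by (simp only: powr_powr[symmetric]) (simp add: powr_realpow[symmetric])
      also have "real d * ((real d - 1) / real d) = real (d - 1)" using d by simp
      also have "(2 * real L * real l) powr real (d - 1) = (2 * real L * real l) ^ (d - 1)"
        using L1 l0 by (intro powr_realpow) simp
      finally show ?thesis by (simp add: power_mult_distrib)
    qed
    have A1: "2 * \<kappa> \<le> \<mu> * (real (l ^ (d - 1)) / P)"
      using \<kappa>l P1 by (simp add: \<mu>_def)
    have A2: "2 * \<kappa> \<le> 1 / (I * l) * (real D - real N * s0)"
    proof -
      have ld: "real l * real l ^ (d - 1) = real l ^ d" using power_minus_mult[of d "real l"] d by (simp add: mult.commute)
      have "2 * d + 5 = (d + 4) + (d + 1)" by simp
      then have pw: "(2::real) ^ (2 * d + 5) = 2 ^ (d + 4) * 2 ^ (d + 1)" by (simp only: power_add[of _ "d + 4" "d + 1"])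
      have pw2: "(2::real) ^ (d + 4) = 2 * 2 ^ (d + 3)" by (simp add: power_add)
      have gen: "a * i * M * (b * (2 * x)) = (2 / 3) * (3 * (a * b) * i * M * x)" for a b i M x :: real by simp
      have gen2: "2 * (M * y) * (i * x) * c = (2 * c) * i * M * (x * y)" for M y i x c :: real by simp
      have "real (l ^ d) \<le> real (2 ^ (d + 1) * k')" using lup by (rule of_nat_le_iff[THEN iffD2])
      then have "real l ^ d \<le> 2 ^ (d + 1) * real k'" by (simp only: of_nat_power of_nat_mult of_nat_numeral)
      also have "\<dots> \<le> 2 ^ (d + 1) * (2 * k)" using k'k by (intro mult_left_mono) auto
      finally have l3: "real l ^ d \<le> 2 ^ (d + 1) * (2 * k)" .
      have "2 * \<kappa> * (I * real l) * 2 ^ (d + 3) \<le> 2 * ((2 * real L) ^ (d - 1) * real l ^ (d - 1)) * (I * real l) * 2 ^ (d + 3)"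
        using \<kappa>l I1 by (intro mult_right_mono mult_left_mono) auto
      also have "\<dots> = 2 ^ (d + 4) * I * (2 * real L) ^ (d - 1) * real l ^ d"
        unfolding ld[symmetric] pw2 by (rule gen2)
      also have "\<dots> \<le> 2 ^ (d + 4) * I * (2 * real L) ^ (d - 1) * (2 ^ (d + 1) * (2 * k))"
        using I1 by (intro mult_left_mono l3) auto
      also have "\<dots> = (2 / 3) * (K1 * k)" unfolding K1_def pw by (rule gen)
      also have "\<dots> \<le> real N"
      proof -
        have "0 \<le> K1 * k" using K1(2) k1 by (intro mult_nonneg_nonneg) linarith+
        then show ?thesis using Nn by linarith
      qed
      finally have "2 * \<kappa> * (I * real l) * 2 ^ (d + 3) \<le> real N" .
      then have "2 * \<kappa> * (I * real l) \<le> real N / 2 ^ (d + 3)" by (simp add: le_divide_eq)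
      also have "\<dots> \<le> real D - real N * s0" by (rule Ds)
      finally show ?thesis using I1 l0 by (simp add: le_divide_eq)
    qed
    have \<kappa>d: "real d + 3 \<le> \<kappa>"
    proof -
      have "real d + 3 = ((real d + 3)\<^sup>2) powr (1 / 2)" by (simp add: powr_half_sqrt)
      also have "\<dots> \<le> k powr (1 / 2)" using kd by (intro powr_mono2) auto
      also have "\<dots> \<le> k powr ((real d - 1) / real d)" using k1 d by (intro powr_mono) (auto simp: field_simps)
      finally show ?thesis by (simp add: \<kappa>_def)
    qed
    have "\<P>(\<omega> in lrp p \<alpha> \<beta>. k \<le> real (card (second_largest_component \<omega> (lattice_box n :: (int ^ 'd) set))))
       \<le> C.Prob {\<eta>. k \<le> real (card (second_largest_component \<eta> \<Lambda>))}"
      unfolding lrp_def as(1) \<Lambda>_def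
    proof (rule PiM_bernoulli_le_perc)
      show "finite (pairs (int_cube a s :: (int ^ 'd) set))" by (rule finite_pairs) simp
      show "pairs (int_cube a s) \<subseteq> potential_edges" unfolding pairs_def potential_edges_def by blast
      show "0 \<le> edge_prob p \<alpha> \<beta> e \<and> edge_prob p \<alpha> \<beta> e \<le> 1" if e: "e \<in> potential_edges" for e :: "(int ^ 'd) set"
      proof -
        obtain x y where "e = {x, y}" using e by (auto simp: potential_edges_def)
        then show ?thesis using edge_prob_le_1[of p \<beta> \<alpha> x y] edge_prob_nonneg[of p \<alpha> \<beta> e] p \<beta> \<alpha> by simp
      qed
      fix \<omega> \<omega>' :: "(int ^ 'd) set \<Rightarrow> bool"
      assume "\<And>e. e \<in> pairs (int_cube a s) \<Longrightarrow> \<omega> e = \<omega>' e"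
      then have "second_largest_component \<omega> (int_cube a s) = second_largest_component \<omega>' (int_cube a s)" by (rule second_largest_cong)
      then show "(k \<le> real (card (second_largest_component \<omega> (int_cube a s)))) = (k \<le> real (card (second_largest_component \<omega>' (int_cube a s))))" by simp
    qed
    also have "{\<eta>. k \<le> real (card (second_largest_component \<eta> \<Lambda>))} = {\<eta>. kk \<le> card (second_largest_component \<eta> \<Lambda>)}"
      by (auto simp: kk_def nat_le_iff ceiling_le_iff)
    also note bound
    also have "2 * (exp (- (\<mu> * (real (l ^ (d - 1)) / P))) * (real (t ^ CARD('d)) * s0)) +
         exp (- (1 / (I * l) * (real D - real (t ^ CARD('d)) * s0)))
       = 2 * (exp (- (\<mu> * (real (l ^ (d - 1)) / P))) * (real N * s0)) +
         exp (- (1 / (I * l) * (real D - real N * s0)))" by (simp add: N_def d_def)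
    also have "\<dots> \<le> real n * ln (real n) * exp (- \<kappa>)"
      by (rule final_estimate[OF n _ Nup s00(1,4) A1 A2 \<kappa>d]) simp
    finally show ?thesis unfolding \<kappa>_def .
  qed
  show ?thesis
    unfolding eventually_at_top_linorder d_def[symmetric] e_def[symmetric]
    by (intro exI[of _ k0] allI impI) (rule main)
qed

section \<open>Choice of the block size\<close>

text \<open>Volume beats surface: the left side decays like exp(-p L^d), up to powers of L, while
  the right side is at least an exponential with exponent of order L^(d-1). Powers of L are bounded
  by exponentials of L, and L \<le> L^(d-1) because d \<ge> 2.\<close>

lemma exists_block_size:
  fixes d :: nat and p B G P :: real
  assumes d: "2 \<le> d" and p: "0 < p" and B: "1 \<le> B" and G: "0 \<le> G" and P: "0 \<le> P"
  shows "\<exists>L0 \<ge> 1. \<forall>L\<ge>L0. 8 * (2 * real L) ^ d * exp (- p) ^ (L ^ d) \<le>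
    (exp (- 1 - 2 * P * (2 * real L) ^ (d - 1)) / (B * (2 ^ (d + 3) + G * (2 * real L) ^ (2 * d)))) ^ (4 * d)"
proof -
  define B' where "B' = B * (2 ^ (d + 3) + G)"
  \<comment> \<open>Collects the coefficients of M = L^(d-1) from both exponents, so that the
    comparison reduces to C \<le> p L.\<close>
  define C where "C = 8 + 2 * real d + 4 * real d * (1 + 2 * P * 2 ^ (d - 1) + B' + 4 * real d)"
  have B'0: "0 \<le> B'" using B G by (simp add: B'_def)
  have "8 * (2 * real L) ^ d * exp (- p) ^ (L ^ d) \<le>
    (exp (- 1 - 2 * P * (2 * real L) ^ (d - 1)) / (B * (2 ^ (d + 3) + G * (2 * real L) ^ (2 * d)))) ^ (4 * d)"
    if L: "max 1 (nat \<lceil>C / p\<rceil>) \<le> L" for L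
  proof -
    have L1: "1 \<le> real L" using L by simp
    have CL: "C \<le> p * real L"
    proof -
      have "C / p \<le> real L" using L by linarith
      then show ?thesis using p by (simp add: divide_le_eq mult.commute)
    qed
    define M where "M = real L ^ (d - 1)"
    have LM: "real L \<le> M" unfolding M_def using L1 d by (intro self_le_power) auto
    have M1: "1 \<le> M" using LM L1 by linarith
    have Ld: "real (L ^ d) = real L * M" unfolding M_def using power_minus_mult[of d "real L"] d by (simp add: mult.commute)
    have pw: "(2 * real L) ^ n \<le> exp (2 * real n * real L)" for n
    proof -
      have "2 * real L \<le> exp (2 * real L)" using exp_ge_add_one_self[of "2 * real L"] by linarith
      then have "(2 * real L) ^ n \<le> exp (2 * real L) ^ n" using L1 by (intro power_mono) auto
      also have "\<dots> = exp (real n * (2 * real L))" by (rule exp_of_nat_mult[symmetric])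
      finally show ?thesis by (simp add: mult_ac)
    qed
    have "8 \<le> exp (8::real)" using exp_ge_add_one_self[of "8::real"] by linarith
    then have "8 * (2 * real L) ^ d * exp (- p) ^ (L ^ d) \<le> exp 8 * exp (2 * real d * real L) * exp (- p) ^ (L ^ d)"
      using pw[of d] L1 by (intro mult_mono) auto
    also have "\<dots> = exp (8 + 2 * real d * real L - p * (real L * M))"
      unfolding exp_of_nat_mult[symmetric] Ld by (simp add: exp_add[symmetric] algebra_simps)
    also have "\<dots> \<le> exp (real (4 * d) * (- 1 - 2 * P * 2 ^ (d - 1) * M - B' - 4 * real d * real L))"
    proof -
      have a1: "8 * 1 \<le> 8 * M" using M1 by simp
      have a2: "2 * real d * real L \<le> 2 * real d * M" using LM by (intro mult_left_mono) auto
      have a3: "4 * real d * 1 \<le> 4 * real d * M" using M1 by (intro mult_left_mono) auto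
      have a4: "4 * real d * B' * 1 \<le> 4 * real d * B' * M" using M1 B'0 by (intro mult_left_mono) auto
      have a5: "4 * real d * (4 * real d) * real L \<le> 4 * real d * (4 * real d) * M" using LM by (intro mult_left_mono) auto
      have "C * M \<le> p * real L * M" using CL M1 by (intro mult_right_mono) auto
      moreover have "C * M = 8 * M + 2 * real d * M + 4 * real d * M + 4 * real d * (2 * P * 2 ^ (d - 1)) * M + 4 * real d * B' * M + 4 * real d * (4 * real d) * M"
        by (simp add: C_def algebra_simps)
      moreover have "real (4 * d) * (- 1 - 2 * P * 2 ^ (d - 1) * M - B' - 4 * real d * real L) =
         - (4 * real d * 1) - 4 * real d * (2 * P * 2 ^ (d - 1)) * M - 4 * real d * B' * 1 - 4 * real d * (4 * real d) * real L"
        by (simp add: algebra_simps)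
      moreover have "p * (real L * M) = p * real L * M" by simp
      ultimately have "8 + 2 * real d * real L - p * (real L * M) \<le> real (4 * d) * (- 1 - 2 * P * 2 ^ (d - 1) * M - B' - 4 * real d * real L)"
        using a1 a2 a3 a4 a5 by linarith
      then show ?thesis by simp
    qed
    also have "\<dots> = exp (- 1 - 2 * P * 2 ^ (d - 1) * M - B' - 4 * real d * real L) ^ (4 * d)" by (rule exp_of_nat_mult)
    also have "\<dots> \<le> (exp (- 1 - 2 * P * (2 * real L) ^ (d - 1)) / (B * (2 ^ (d + 3) + G * (2 * real L) ^ (2 * d)))) ^ (4 * d)"
    proof (rule power_mono)
      let ?den = "B * (2 ^ (d + 3) + G * (2 * real L) ^ (2 * d))"
      have pos: "0 < ?den" using B G L1 by (intro mult_pos_pos add_pos_nonneg) auto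
      have one: "1 \<le> (2 * real L) ^ (2 * d)" using L1 by (intro one_le_power) auto
      have "2 ^ (d + 3) * 1 \<le> 2 ^ (d + 3) * (2 * real L) ^ (2 * d)" using one by (intro mult_left_mono) auto
      then have "2 ^ (d + 3) + G * (2 * real L) ^ (2 * d) \<le> (2 ^ (d + 3) + G) * (2 * real L) ^ (2 * d)"
        unfolding distrib_right by linarith
      then have "?den \<le> B * ((2 ^ (d + 3) + G) * (2 * real L) ^ (2 * d))" using B by (intro mult_left_mono) auto
      also have "\<dots> = B' * (2 * real L) ^ (2 * d)" by (simp add: B'_def)
      also have "\<dots> \<le> exp B' * exp (2 * real (2 * d) * real L)"
      proof (intro mult_mono pw)
        show "B' \<le> exp B'" using exp_ge_add_one_self[of B'] by linarith
      qed (use L1 in auto)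
      also have "\<dots> = exp (B' + 4 * real d * real L)" by (simp add: exp_add)
      finally have den: "?den \<le> exp (B' + 4 * real d * real L)" .
      have "exp (- 1 - 2 * P * 2 ^ (d - 1) * M - B' - 4 * real d * real L) =
          exp (- 1 - 2 * P * (2 * real L) ^ (d - 1)) / exp (B' + 4 * real d * real L)"
        by (simp add: exp_diff[symmetric] power_mult_distrib M_def algebra_simps)
      also have "\<dots> \<le> exp (- 1 - 2 * P * (2 * real L) ^ (d - 1)) / ?den"
        using den pos by (intro divide_left_mono) auto
      finally show "exp (- 1 - 2 * P * 2 ^ (d - 1) * M - B' - 4 * real d * real L) \<le>
          exp (- 1 - 2 * P * (2 * real L) ^ (d - 1)) / ?den" .
    qed simp
    finally show ?thesis .
  qed
  then show ?thesis by (intro exI[of _ "max 1 (nat \<lceil>C / p\<rceil>)"]) auto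
qed

lemma block_pair_eq: "block_pair \<Lambda> \<phi> (X, i) = block \<Lambda> \<phi> {X} \<union> block \<Lambda> \<phi> {X + unit i}"
  by (auto simp: block_pair_def block_def)

lemma card_block_pair_coarse_map:
  fixes X :: "int ^ 'd::finite"
  assumes L: "0 < L" "L \<le> s" and X: "X \<in> grid (s div L)" "X + unit i \<in> grid (s div L)"
  shows "2 * L ^ CARD('d) \<le> card (block_pair (int_cube a s) (coarse_map a s L) (X, i))"
    "card (block_pair (int_cube a s) (coarse_map a s L) (X, i)) \<le> 2 * (2 * L) ^ CARD('d)"
proof -
  let ?b = "\<lambda>X. block (int_cube a s) (coarse_map a s L) {X}"
  have ne: "X \<noteq> X + unit i" by (auto simp: vec_eq_iff unit_nth)
  have "block_pair (int_cube a s) (coarse_map a s L) (X, i) = ?b X \<union> ?b (X + unit i)"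
    by (rule block_pair_eq)
  moreover have "card (?b X \<union> ?b (X + unit i)) = card (?b X) + card (?b (X + unit i))"
    using ne by (intro card_Un_disjoint) (auto simp: block_def)
  ultimately have eq: "card (block_pair (int_cube a s) (coarse_map a s L) (X, i)) = card (?b X) + card (?b (X + unit i))"
    by (simp only:)
  show "2 * L ^ CARD('d) \<le> card (block_pair (int_cube a s) (coarse_map a s L) (X, i))" unfolding eq
    using card_block_coarse_map(2)[OF L X(1), of a] card_block_coarse_map(2)[OF L X(2), of a] by linarith
  show "card (block_pair (int_cube a s) (coarse_map a s L) (X, i)) \<le> 2 * (2 * L) ^ CARD('d)" unfolding eq
    using card_block_coarse_map(1)[OF L, of a X] card_block_coarse_map(1)[OF L, of a "X + unit i"] by linarith
qed

text \<open>Coordinates of points in two adjacent blocks differ by less than 3 L, so their distance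
  is at most 4 d L \<le> \<beta>, and the minimum in the edge probability is 1.\<close>

lemma edge_prob_block_pair:
  fixes X u v :: "int ^ 'd::finite" and p \<alpha> \<beta> :: real
  assumes L: "0 < L" "L \<le> s" and \<beta>: "4 * real CARD('d) * real L \<le> \<beta>"
    and uv: "u \<in> block_pair (int_cube a s) (coarse_map a s L) (X, i)" "v \<in> block_pair (int_cube a s) (coarse_map a s L) (X, i)" "u \<noteq> v"
  shows "edge_prob p \<alpha> \<beta> {u, v} = p"
proof -
  let ?w = "lattice_point u - lattice_point v"
  have rng: "a + X $ j * int L \<le> w $ j \<and> w $ j < a + X $ j * int L + 3 * int L"
    if "w \<in> block_pair (int_cube a s) (coarse_map a s L) (X, i)" for w j
  proof -
    have w: "w \<in> int_cube a s" "coarse_map a s L w \<in> {X, X + unit i}" using that by (auto simp: block_pair_def block_def)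
    have b: "a + coarse_map a s L w $ j * int L \<le> w $ j" "w $ j < a + coarse_map a s L w $ j * int L + 2 * int L"
      using coarse_map_bounds(3,4)[OF L w(1)] by auto
    consider "coarse_map a s L w = X" | "coarse_map a s L w = X + unit i" using w(2) by blast
    then have c: "coarse_map a s L w $ j = X $ j \<or> coarse_map a s L w $ j = X $ j + 1"
      by cases (simp_all add: unit_nth)
    have e: "(X $ j + 1) * int L = X $ j * int L + int L" by (simp add: distrib_right)
    have "0 < int L" using L by simp
    from c show ?thesis
    proof
      assume c1: "coarse_map a s L w $ j = X $ j"
      show ?thesis using b \<open>0 < int L\<close> unfolding c1 by linarith
    next
      assume c1: "coarse_map a s L w $ j = X $ j + 1"
      show ?thesis using b \<open>0 < int L\<close> unfolding c1 e by linarith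
    qed
  qed
  have comp: "\<bar>?w $ j\<bar> \<le> 4 * real L" for j
  proof -
    have "u $ j - v $ j \<le> 4 * int L" "v $ j - u $ j \<le> 4 * int L"
      using rng[OF uv(1), of j] rng[OF uv(2), of j] by linarith+
    then have "\<bar>u $ j - v $ j\<bar> \<le> 4 * int L" by (rule abs_leI[OF _ order_trans[OF eq_refl[OF minus_diff_eq]]])
    then have "real_of_int \<bar>u $ j - v $ j\<bar> \<le> real_of_int (4 * int L)" by (rule of_int_le_iff[THEN iffD2])
    then show ?thesis by (simp add: lattice_point_def)
  qed
  have "norm ?w \<le> (\<Sum>j\<in>UNIV. \<bar>?w $ j\<bar>)" by (rule norm_le_l1_cart)
  also have "\<dots> \<le> (\<Sum>j\<in>(UNIV :: 'd set). 4 * real L)" by (intro sum_mono comp)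
  also have "\<dots> \<le> \<beta>" using \<beta> by (simp add: mult_ac)
  finally have n: "edge_length {u, v} \<le> \<beta>" by (simp add: edge_length_doubleton)
  have "lattice_point u \<noteq> lattice_point v" using uv(3) by (auto simp: lattice_point_def vec_eq_iff)
  then have "0 < edge_length {u, v}" by (simp add: edge_length_doubleton)
  then have "1 \<le> \<beta> / edge_length {u, v}" using n by (simp add: le_divide_eq)
  then show ?thesis by (simp add: edge_prob_def)
qed

lemma coarse_map_1:
  assumes "x \<in> int_cube a s" shows "coarse_map a s 1 x = x - (\<chi> i. a)"
proof -
  have "x $ i - a \<le> int s - 1" for i
  proof -
    have "x $ i < a + int s" using assms by (auto simp: int_cube_def)
    then show ?thesis by simp
  qed
  then show ?thesis by (simp add: coarse_map_def vec_eq_iff min_absorb1)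
qed

text \<open>For side 1 a block pair is a single lattice edge. Its only cut is counted twice, once
  from each side, hence the factor 2.\<close>

lemma bad_prob_unit_blocks:
  fixes x :: "int ^ 'd::finite" and p \<alpha> \<beta> :: real
  assumes s: "1 \<le> s" and x: "x \<in> grid s" "x + unit i \<in> grid s"
    and p: "1 - \<epsilon> \<le> p * min 1 \<beta> powr (real CARD('d) * \<alpha>)"
  shows "(\<Sum>W\<in>cut_sets (block_pair (int_cube a s) (coarse_map a s 1) (x, i)).
         \<Prod>e\<in>cut_edges (block_pair (int_cube a s) (coarse_map a s 1) (x, i)) W. 1 - edge_prob p \<alpha> \<beta> e) \<le> 2 * \<epsilon>"
proof -
  define u where "u = x + (\<chi> i. a)"
  define v where "v = u + unit i"
  have b: "block (int_cube a s) (coarse_map a s 1) {y} = {y + (\<chi> i. a)}" if y: "y \<in> grid s" for y :: "int ^ 'd"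
  proof -
    have m: "y + (\<chi> i. a) \<in> int_cube a s" unfolding int_cube_def
    proof (intro CollectI allI)
      fix j
      have "0 \<le> y $ j" "y $ j < int s" using y by (simp_all add: grid_def)
      then show "a \<le> (y + (\<chi> i. a)) $ j \<and> (y + (\<chi> i. a)) $ j < a + int s" by simp
    qed
    have "coarse_map a s 1 (y + (\<chi> i. a)) = y" unfolding coarse_map_1[OF m] by simp
    moreover have "z = y + (\<chi> i. a)" if z: "z \<in> int_cube a s" "coarse_map a s 1 z = y" for z
      unfolding z(2)[symmetric] coarse_map_1[OF z(1)] by simp
    ultimately show ?thesis unfolding block_def using m by blast
  qed
  have bu: "block (int_cube a s) (coarse_map a s 1) {x} = {u}" using b[OF x(1)] by (simp add: u_def)
  have "x + unit i + (\<chi> i. a) = v" by (simp add: u_def v_def)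
  then have bv: "block (int_cube a s) (coarse_map a s 1) {x + unit i} = {v}" using b[OF x(2)] by simp
  have U: "block_pair (int_cube a s) (coarse_map a s 1) (x, i) = {u, v}" unfolding block_pair_eq bu bv by blast
  have uv: "u \<noteq> v" by (auto simp: v_def vec_eq_iff unit_nth)
  have cs: "cut_sets {u, v} = {{u}, {v}}" using uv by (auto simp: cut_sets_def)
  have d: "{u, v} - {u} = {v}" "{u, v} - {v} = {u}" using uv by auto
  have "cut_edges {u, v} {u} = {{u, v}}" unfolding cut_edges_def d by simp
  moreover have "cut_edges {u, v} {v} = {{v, u}}" unfolding cut_edges_def d by simp
  moreover have "{v, u} = {u, v}" by blast
  ultimately have c1: "cut_edges {u, v} {u} = {{u, v}}" "cut_edges {u, v} {v} = {{u, v}}" by simp_all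
  have "lattice_point u - lattice_point v = - axis i 1"
    by (simp add: lattice_point_def v_def vec_eq_iff axis_def)
  then have "edge_length {u, v} = 1" by (simp add: edge_length_doubleton norm_axis_1)
  then have "1 - edge_prob p \<alpha> \<beta> {u, v} \<le> \<epsilon>" using p by (simp add: edge_prob_def)
  then show ?thesis unfolding U cs using uv c1 by simp
qed

theorem proposition1p5:
  fixes \<alpha> :: real
  assumes "CARD('d::finite) \<ge> 2"
    and "\<alpha> > 1 + 1 / real CARD('d)"
  shows "\<exists>\<epsilon>>0. \<forall>p\<in>{0<..1}. \<exists>\<beta>\<^sub>0. \<forall>\<beta>>0.
           supercritical TYPE('d) p \<alpha> \<beta> \<longrightarrow>
           \<beta> \<ge> \<beta>\<^sub>0 \<or> p * min 1 \<beta> powr (real CARD('d) * \<alpha>) \<ge> 1 - \<epsilon> \<longrightarrow>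
           (\<forall>\<^sub>F k :: real in at_top. \<forall>n\<ge>2.
              real n * ln (real n) powr (- (2 * real CARD('d) / (real CARD('d) - 1))) \<ge> k \<longrightarrow>
              \<P>(\<omega> in lrp p \<alpha> \<beta>.
                  real (card (second_largest_component \<omega> (lattice_box n :: (int ^ 'd) set))) \<ge> k)
                \<le> real n * ln (real n) *
                   exp (- (k powr ((real CARD('d) - 1) / real CARD('d)))))"
proof -
  let ?d = "CARD('d)"
  let ?concl = "\<lambda>p \<beta>. \<forall>\<^sub>F k :: real in at_top. \<forall>n\<ge>2.
              real n * ln (real n) powr (- (2 * real ?d / (real ?d - 1))) \<ge> k \<longrightarrow>
              \<P>(\<omega> in lrp p \<alpha> \<beta>.
                  real (card (second_largest_component \<omega> (lattice_box n :: (int ^ 'd) set))) \<ge> k)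
                \<le> real n * ln (real n) * exp (- (k powr ((real ?d - 1) / real ?d)))"
  have "0 \<le> 1 / real ?d" by simp
  then have \<alpha>: "0 \<le> \<alpha>" using assms(2) by linarith
  obtain CS0 :: real where CS0: "0 < CS0" "\<And>z t (Y :: int ^ 'd). 0 \<le> z \<Longrightarrow> CS0 * z \<le> 1 \<Longrightarrow>
        (\<Sum>A\<in>{A\<in>contours t. Y \<in> A}. z ^ card (bdry t A)) \<le> CS0 * z"
    using contour_sum[OF assms(1)] by blast
  define CS where "CS = max 1 CS0"
  have CS: "1 \<le> CS" by (simp add: CS_def)
  have CS': "(\<Sum>A\<in>{A\<in>contours t. Y \<in> A}. z ^ card (bdry t A)) \<le> CS * z"
    if z: "0 \<le> z" "CS * z \<le> 1" for z t and Y :: "int ^ 'd"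
  proof -
    have le: "CS0 * z \<le> CS * z" using z(1) by (intro mult_right_mono) (simp_all add: CS_def)
    then have "CS0 * z \<le> 1" using z(2) by linarith
    then show ?thesis using CS0(2)[OF z(1), of t Y] le by linarith
  qed
  obtain CL where CL: "0 < CL" "\<And>t A. A \<subseteq> (grid t :: (int ^ 'd) set) \<Longrightarrow>
        (\<Sum>X\<in>A. \<Sum>Y\<in>grid t - A. real (sup_norm (X - Y)) powr (- (real ?d * \<alpha>))) \<le> CL * real (card (bdry t A))"
    using long_range_boundary_sum[OF assms(2)] by blast
  define P where "P = real (perim_const ?d)"
  note core = core_bound[OF assms(1) \<alpha> CS CS' CL(2), folded P_def]

  \<comment> \<open>Uniformity in p \<ge> p0 serves two purposes: p0 = p gives the threshold for
    \<beta>, and p0 = 1/2 gives a threshold independent of p, on which \<epsilon> can be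
    built.\<close>
  have dense: "\<exists>b. \<forall>p\<in>{p0..1}. \<forall>\<beta>\<ge>b. ?concl p \<beta>" if p0: "0 < p0" for p0 :: real
  proof -
    \<comment> \<open>For the block side chosen below, 2 \<beta> / L is at most 16 d, so the
      boundary constant depends on L only through (2 L)^(2 d).\<close>
    define G where "G = (4 + 16 * real ?d) powr (real ?d * \<alpha>) * CL"
    have G0: "0 \<le> G" using CL(1) by (simp add: G_def)
    have P0: "0 \<le> P" by (simp add: P_def)
    obtain L0 where L0: "1 \<le> L0" "\<And>L. L0 \<le> L \<Longrightarrow> 8 * (2 * real L) ^ ?d * exp (- p0) ^ (L ^ ?d) \<le>
      (exp (- 1 - 2 * P * (2 * real L) ^ (?d - 1)) / (CS * (2 ^ (?d + 3) + G * (2 * real L) ^ (2 * ?d)))) ^ (4 * ?d)"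
      using exists_block_size[OF assms(1) p0 CS G0 P0] by blast
    have "?concl p \<beta>" if p: "p \<in> {p0..1}" and \<beta>: "4 * real ?d * real L0 \<le> \<beta>" for p \<beta>
    proof -
      \<comment> \<open>The largest side that \<open>edge_prob_block_pair\<close> admits.\<close>
      define L where "L = nat \<lfloor>\<beta> / (4 * real ?d)\<rfloor>"
      have dpos: "0 < 4 * real ?d" by simp
      have "real L0 \<le> \<beta> / (4 * real ?d)" using \<beta> dpos by (simp add: le_divide_eq mult.commute)
      then have LL: "L0 \<le> L" unfolding L_def by linarith
      have L: "0 < L" using LL L0(1) by linarith
      have Lb: "real L \<le> \<beta> / (4 * real ?d)" "\<beta> / (4 * real ?d) < real L + 1"
        using \<open>real L0 \<le> \<beta> / (4 * real ?d)\<close> unfolding L_def by linarith+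
      have L\<beta>: "4 * real ?d * real L \<le> \<beta>" using Lb(1) dpos by (simp add: le_divide_eq mult.commute)
      have "0 < 4 * real ?d * real L" using L by simp
      then have \<beta>0: "0 < \<beta>" using L\<beta> by linarith
      have "\<beta> / (4 * real ?d) \<le> 2 * real L" using Lb(2) L by linarith
      then have "\<beta> \<le> 2 * real L * (4 * real ?d)" using dpos by (simp only: pos_divide_le_eq)
      then have \<beta>L: "2 * \<beta> / real L \<le> 16 * real ?d" using L by (simp add: divide_le_eq mult_ac)
      let ?q = "8 * (2 * real L) ^ ?d * exp (- p0) ^ (L ^ ?d)" and ?H = "G * (2 * real L) ^ (2 * ?d)"
      have q: "?q \<le> (exp (- 1 - 2 * P * (2 * real L) ^ (?d - 1)) / (CS * (2 ^ (?d + 3) + ?H))) ^ (4 * ?d)"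
        by (rule L0(2)[OF LL])
      have H0: "0 \<le> ?H" using G0 by simp
      have "exp (- 1 - 2 * P * (2 * real L) ^ (?d - 1)) / (CS * (2 ^ (?d + 3) + ?H)) \<le> 1"
      proof -
        have "0 \<le> 2 * P * (2 * real L) ^ (?d - 1)" using P0 by simp
        then have "- 1 - 2 * P * (2 * real L) ^ (?d - 1) \<le> 0" by linarith
        then have "exp (- 1 - 2 * P * (2 * real L) ^ (?d - 1)) \<le> 1" by (simp only: exp_le_one_iff)
        moreover have "1 * 1 \<le> CS * (2 ^ (?d + 3) + ?H)"
        proof (rule mult_mono)
          have "(1::real) \<le> 2 ^ (?d + 3)" by simp
          then show "1 \<le> 2 ^ (?d + 3) + ?H" using H0 by linarith
        qed (use CS in auto)
        ultimately show ?thesis by (intro divide_le_eq_1_pos[THEN iffD2]) linarith+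
      qed
      moreover have "0 \<le> exp (- 1 - 2 * P * (2 * real L) ^ (?d - 1)) / (CS * (2 ^ (?d + 3) + ?H))"
        using CS G0 by (intro divide_nonneg_nonneg mult_nonneg_nonneg add_nonneg_nonneg) auto
      ultimately have "(exp (- 1 - 2 * P * (2 * real L) ^ (?d - 1)) / (CS * (2 ^ (?d + 3) + ?H))) ^ (4 * ?d) \<le> 1"
        by (intro power_le_one)
      then have q1: "?q \<le> 1" using q by linarith
      have 1: "(2 * real L) ^ (2 * ?d) * (4 + 2 * \<beta> / real L) powr (real ?d * \<alpha>) * CL \<le> ?H"
      proof -
        have "(4 + 2 * \<beta> / real L) powr (real ?d * \<alpha>) \<le> (4 + 16 * real ?d) powr (real ?d * \<alpha>)"
          using \<beta>L \<beta>0 \<alpha> by (intro powr_mono2) auto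
        then have "(2 * real L) ^ (2 * ?d) * (4 + 2 * \<beta> / real L) powr (real ?d * \<alpha>) * CL
           \<le> (2 * real L) ^ (2 * ?d) * (4 + 16 * real ?d) powr (real ?d * \<alpha>) * CL"
          using CL(1) by (intro mult_right_mono mult_left_mono) auto
        then show ?thesis by (simp add: G_def mult_ac)
      qed
      have 2: "(\<Sum>W\<in>cut_sets (block_pair (int_cube a s) (coarse_map a s L) (x, i)).
         \<Prod>e\<in>cut_edges (block_pair (int_cube a s) (coarse_map a s L) (x, i)) W. 1 - edge_prob p \<alpha> \<beta> e) \<le> ?q"
        if s: "L \<le> s" and x: "x \<in> (grid (s div L) :: (int ^ 'd) set)" "x + unit i \<in> grid (s div L)" for a s x i
      proof -
        let ?U = "block_pair (int_cube a s) (coarse_map a s L) (x, i)"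
        have qq: "4 * (2 * (2 * real L) ^ ?d) * exp (- p0) ^ (L ^ ?d) = ?q" by simp
        have cU: "real (card ?U) \<le> 2 * (2 * real L) ^ ?d"
        proof -
          have "real (card ?U) \<le> real (2 * (2 * L) ^ ?d)" using card_block_pair_coarse_map(2)[OF L s x] by (rule of_nat_le_iff[THEN iffD2])
          then show ?thesis by simp
        qed
        have "(\<Sum>W\<in>cut_sets ?U. \<Prod>e\<in>cut_edges ?U W. 1 - edge_prob p \<alpha> \<beta> e) \<le> 4 * (2 * (2 * real L) ^ ?d) * exp (- p0) ^ (L ^ ?d)"
        proof (rule dense_bad_prob)
          show "finite ?U" by (simp add: block_pair_def block_def)
          show "0 \<le> exp (- p0)" "exp (- p0) \<le> 1" using p0 by simp_all
          show "2 * L ^ ?d \<le> card ?U" by (rule card_block_pair_coarse_map(1)[OF L s x])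
          show "real (card ?U) \<le> 2 * (2 * real L) ^ ?d" by (rule cU)
          show "4 * (2 * (2 * real L) ^ ?d) * exp (- p0) ^ (L ^ ?d) \<le> 1" unfolding qq by (rule q1)
          fix e assume "e \<in> pairs ?U"
          then obtain u v where e: "e = {u, v}" "u \<in> ?U" "v \<in> ?U" "u \<noteq> v" unfolding pairs_def by (elim CollectE exE conjE)
          have "edge_prob p \<alpha> \<beta> e = p" unfolding e(1) by (rule edge_prob_block_pair[OF L s L\<beta> e(2-4)])
          moreover have "1 - p \<le> exp (- p0)" using p exp_ge_add_one_self[of "- p0"] by simp
          ultimately show "edge_prob p \<alpha> \<beta> e \<le> 1 \<and> 1 - edge_prob p \<alpha> \<beta> e \<le> exp (- p0)" using p by simp
        qed
        then show ?thesis unfolding qq .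
      qed
      have q0: "0 \<le> ?q" by simp
      show ?thesis
        by (rule core[of L p \<beta> ?q ?H]) (use L p p0 \<beta>0 q0 H0 1 q 2 in \<open>simp_all only: atLeastAtMost_iff\<close>, linarith+)
    qed
    then show ?thesis by blast
  qed

  have "(0::real) < 1 / 2" by simp
  from dense[OF this] obtain bh where bh: "\<And>p \<beta>. p \<in> {1 / 2..1} \<Longrightarrow> bh \<le> \<beta> \<Longrightarrow> ?concl p \<beta>" by blast
  \<comment> \<open>As \<epsilon> \<le> 1/2 forces p \<ge> 1/2, the dense case settles all \<beta>
    \<ge> bh. Unit blocks then serve \<beta> \<le> b, where the boundary constant has the bound H
    independent of \<beta> and p.\<close>
  define b where "b = max bh 1"
  define H where "H = (2::real) ^ (2 * ?d) * (4 + 2 * b) powr (real ?d * \<alpha>) * CL"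
  have H0: "0 \<le> H" using CL(1) by (simp add: H_def)
  define \<rho> where "\<rho> = (exp (- 1 - 2 * P * (2 * real 1) ^ (?d - 1)) / (CS * (2 ^ (?d + 3) + H))) ^ (4 * ?d)"
  have \<rho>0: "0 < \<rho>" unfolding \<rho>_def using CS H0
    by (intro zero_less_power divide_pos_pos mult_pos_pos add_pos_nonneg) auto
  \<comment> \<open>Half of \<rho> because of the factor 2 in \<open>bad_prob_unit_blocks\<close>;
    the bound 1/2 is what gives p \<ge> 1/2.\<close>
  define \<epsilon> where "\<epsilon> = min (1 / 2) (\<rho> / 2)"
  have \<epsilon>: "0 < \<epsilon>" "\<epsilon> \<le> 1 / 2" "2 * \<epsilon> \<le> \<rho>" using \<rho>0 by (auto simp: \<epsilon>_def)
  have "\<exists>\<beta>\<^sub>0. \<forall>\<beta>>0. \<beta> \<ge> \<beta>\<^sub>0 \<or> p * min 1 \<beta> powr (real ?d * \<alpha>) \<ge> 1 - \<epsilon> \<longrightarrow> ?concl p \<beta>"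
    if p: "p \<in> {0<..1}" for p
  proof -
    have "0 < p" and pp: "p \<in> {p..1}" using p by simp_all
    from dense[OF this(1)] obtain \<beta>0 where \<beta>0: "\<And>\<beta>. \<beta>0 \<le> \<beta> \<Longrightarrow> ?concl p \<beta>" using pp by blast
    have "?concl p \<beta>" if \<beta>: "0 < \<beta>" and large: "p * min 1 \<beta> powr (real ?d * \<alpha>) \<ge> 1 - \<epsilon>" for \<beta>
    proof -
      have "min 1 \<beta> powr (real ?d * \<alpha>) \<le> 1" using \<beta> \<alpha> by (intro powr_le1) auto
      then have "p * min 1 \<beta> powr (real ?d * \<alpha>) \<le> p * 1" using p by (intro mult_left_mono) auto
      then have p2: "p \<in> {1 / 2..1}" using large \<epsilon>(2) p by simp
      show ?thesis
      proof (cases "bh \<le> \<beta>")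
        case True then show ?thesis using bh p2 by blast
      next
        case False
        then have \<beta>b: "\<beta> \<le> b" by (simp add: b_def)
        have 1: "(2 * real 1) ^ (2 * ?d) * (4 + 2 * \<beta> / real 1) powr (real ?d * \<alpha>) * CL \<le> H"
        proof -
          have "(4 + 2 * \<beta>) powr (real ?d * \<alpha>) \<le> (4 + 2 * b) powr (real ?d * \<alpha>)"
            using \<beta>b \<beta> \<alpha> by (intro powr_mono2) auto
          then have "(2::real) ^ (2 * ?d) * (4 + 2 * \<beta>) powr (real ?d * \<alpha>) * CL \<le> H"
            unfolding H_def using CL(1) by (intro mult_right_mono mult_left_mono) auto
          then show ?thesis by simp
        qed
        have 2: "(\<Sum>W\<in>cut_sets (block_pair (int_cube a s) (coarse_map a s 1) (x, i)).
           \<Prod>e\<in>cut_edges (block_pair (int_cube a s) (coarse_map a s 1) (x, i)) W. 1 - edge_prob p \<alpha> \<beta> e) \<le> 2 * \<epsilon>"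
          if s: "1 \<le> s" and x: "x \<in> (grid (s div 1) :: (int ^ 'd) set)" "x + unit i \<in> grid (s div 1)" for a s x i
          using bad_prob_unit_blocks[OF s _ _ large, of x i a] x by simp
        show ?thesis
        proof (rule core[of 1 p \<beta> "2 * \<epsilon>" H])
          show "2 * \<epsilon> \<le> (exp (- 1 - 2 * P * (2 * real 1) ^ (?d - 1)) / (CS * (2 ^ (?d + 3) + H))) ^ (4 * ?d)"
            using \<epsilon>(3) unfolding \<rho>_def .
        qed (use p \<beta> \<epsilon> H0 1 2 in \<open>auto simp del: of_nat_1\<close>)
      qed
    qed
    then show ?thesis using \<beta>0 by blast
  qed
  then show ?thesis using \<epsilon>(1) by meson
qed

end
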